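(* (1) Let $\mu$ be a compactly supported probability measure on $\mathbb{R}$ and let $D_\mu := \sup\{|x-y| : x,y\in \operatorname{supp}(\mu)\}$. Then $\mu\boxplus S(0,t)$ is unimodal for every $t>0$ with $t\ge 4D_\mu^2$. (2) Let $f\colon\mathbb{R}\to[0,\infty)$ be a Borel measurable function. Then there exists a probability measure $\mu$ on $\mathbb{R}$ such that $\mu\boxplus S(0,t)$ is not unimodal for any $t>0$ and $$\int_{\mathbb{R}} f(x)\,d\mu(x)<\infty.$$ (By (1), such a measure $\mu$ is not compactly supported.)
   Context: Unimodality: a Borel measure $\mu$ on $\mathbb{R}$ is unimodal if there exist $a\in\mathbb{R}$ and a function $f\colon\mathbb{R}\to[0,\infty)$, non-decreasing on $(-\infty,a)$ and non-increasing on $(a,\infty)$, such that $\mu(dx)=\mu(\{a\})\delta_a+f(x)\,dx$. Semicircle distribution: for $t>0$, $S(0,t)$ is the probability measure with density $\frac{1}{2\pi t}\sqrt{4t-x^2}$ on its support $[-2\sqrt t,2\sqrt t]$. Free convolution $\boxplus$: let $\mathbb{C}^{\pm}$ be the open upper/lower half-planes. For a probability measure $\mu$ on $\mathbb{R}$ let $G_\mu(z)=\int_{\mathbb{R}}\frac{1}{z-x}\,d\mu(x)$, $z\in\mathbb{C}^+$, be its Cauchy transform. For every $\gamma>0$ there exist $\alpha,\beta,\delta>0$ such that $G_\mu$ is univalent on $\{z\in\mathbb{C}^+: |\mathrm{Re}\,z|<\alpha\,\mathrm{Im}\,z,\ \mathrm{Im}\,z>\beta\}$ and the image of this set under $G_\mu$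 contains $\{z\in\mathbb{C}^-: |\mathrm{Re}\,z|<\gamma|\mathrm{Im}\,z|,\ |z|<\delta\}$; on the latter set one has the right inverse $G_\mu^{-1}$ and defines the R-transform $R_\mu(z)=G_\mu^{-1}(z)-\frac1z$. For probability measures $\mu,\nu$ on $\mathbb{R}$, $\mu\boxplus\nu$ is the unique probability measure $\lambda$ on $\mathbb{R}$ with $R_\lambda(z)=R_\mu(z)+R_\nu(z)$ on the intersection of the domains of the three transforms. *)

theory Defs
  imports "HOL-Probability.Probability"
begin

text \<open>
  Probability measures on the real line are measures satisfying the library locale predicate
  \<^const>\<open>real_distribution\<close>.
\<close>

definition msupport :: "real measure \<Rightarrow> real set" where
  "msupport \<mu> = {x. \<forall>U. open U \<longrightarrow> x \<in> U \<longrightarrow> emeasure \<mu> U > 0}"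

text \<open>No measurability of \<open>f\<close> is required: the monotonicity conditions imply it.\<close>

definition unimodal :: "real measure \<Rightarrow> bool" where
  "unimodal \<mu> \<longleftrightarrow> sets \<mu> = sets borel \<and>
     (\<exists>a f. (\<forall>x. 0 \<le> f x) \<and> mono_on {..<a} f \<and> antimono_on {a<..} f \<and>
        (\<forall>A\<in>sets borel. emeasure \<mu> A =
           emeasure \<mu> {a} * indicator A a + (\<integral>\<^sup>+ x\<in>A. ennreal (f x) \<partial>lborel)))"

text \<open>
  The distribution \<open>S(0,t)\<close>. The indicator is needed because the library's square root is
  odd, hence negative outside the support interval.
\<close>

definition semicircle :: "real \<Rightarrow> real measure" where
  "semicircle t = density lborel
     (\<lambda>x. ennreal (1 / (2 * pi * t) * sqrt (4 * t - x\<^sup>2)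
                   * indicator {- 2 * sqrt t .. 2 * sqrt t} x))"

definition cauchy_transform :: "real measure \<Rightarrow> complex \<Rightarrow> complex" where
  "cauchy_transform \<mu> z = (LINT x|\<mu>. 1 / (z - complex_of_real x))"

definition upper_cone :: "real \<Rightarrow> real \<Rightarrow> complex set" where
  "upper_cone \<alpha> \<beta> = {z. Im z > 0 \<and> \<bar>Re z\<bar> < \<alpha> * Im z \<and> Im z > \<beta>}"

definition lower_sector :: "real \<Rightarrow> real \<Rightarrow> complex set" where
  "lower_sector \<gamma> \<delta> = {z. Im z < 0 \<and> \<bar>Re z\<bar> < \<gamma> * \<bar>Im z\<bar> \<and> norm z < \<delta>}"

definition R_params :: "real measure \<Rightarrow> real \<Rightarrow> real \<Rightarrow> real \<Rightarrow> real \<Rightarrow> bool" where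
  "R_params \<mu> \<gamma> \<alpha> \<beta> \<delta> \<longleftrightarrow> \<gamma> > 0 \<and> \<alpha> > 0 \<and> \<beta> > 0 \<and> \<delta> > 0 \<and>
     inj_on (cauchy_transform \<mu>) (upper_cone \<alpha> \<beta>) \<and>
     lower_sector \<gamma> \<delta> \<subseteq> cauchy_transform \<mu> ` upper_cone \<alpha> \<beta>"

text \<open>
  Each admissible choice of parameters gives a right inverse of the Cauchy transform on the
  corresponding sector. Any two of these are holomorphic and agree near \<open>0\<close> on the
  (connected) overlap of their sectors, hence agree on all of it; so they glue to one function
  on the union of all such sectors, which is taken as the domain of the R-transform. The
  value of \<open>R_transform\<close> outside \<open>R_domain\<close> is meaningless.
\<close>

definition R_domain :: "real measure \<Rightarrow> complex set" where
  "R_domain \<mu> = {z. \<exists>\<gamma> \<alpha> \<beta> \<delta>. R_params \<mu> \<gamma> \<alpha> \<beta> \<delta> \<and> z \<in> lower_sector \<gamma> \<delta>}"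

definition cauchy_inverse :: "real measure \<Rightarrow> complex \<Rightarrow> complex" where
  "cauchy_inverse \<mu> z = (THE w. \<exists>\<gamma> \<alpha> \<beta> \<delta>. R_params \<mu> \<gamma> \<alpha> \<beta> \<delta> \<and>
     z \<in> lower_sector \<gamma> \<delta> \<and> w \<in> upper_cone \<alpha> \<beta> \<and> cauchy_transform \<mu> w = z)"

definition R_transform :: "real measure \<Rightarrow> complex \<Rightarrow> complex" where
  "R_transform \<mu> z = cauchy_inverse \<mu> z - 1 / z"

definition free_convolution :: "real measure \<Rightarrow> real measure \<Rightarrow> real measure"
    (infixl "\<boxplus>" 65) where
  "\<mu> \<boxplus> \<nu> = (THE \<rho>. real_distribution \<rho> \<and>
     (\<forall>z \<in> R_domain \<mu> \<inter> R_domain \<nu> \<inter> R_domain \<rho>.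
        R_transform \<rho> z = R_transform \<mu> z + R_transform \<nu> z))"

end

theory Submission
  imports Defs "HOL-Complex_Analysis.Complex_Analysis"
begin

text \<open>
  Following Biane, \<open>\<mu> \<boxplus> S(0,t)\<close> is described by subordination. With \<open>G\<close> the Cauchy transform of
  \<open>\<mu>\<close> and \<open>I(w)\<close> the integral of \<open>1 / |w - u|\<^sup>2\<close> (called energy below), the map
  \<open>H(w) = w + t G(w)\<close> satisfies \<open>Im H(w) = Im w (1 - t I(w))\<close> and maps
  \<open>\<Omega> = {w. Im w > 0 \<and> t I(w) < 1}\<close> bijectively onto the upper half-plane; its inverse \<open>\<omega>\<close> is
  Hoelder continuous of exponent 1/3 up to the real line, \<open>G \<circ> \<omega>\<close> is the Cauchy transform of
  \<open>\<mu> \<boxplus> S(0,t)\<close>, and the latter has density \<open>Im \<omega>(x) / (\<pi> t)\<close>.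

  (1) The curve \<open>Im H = \<epsilon>\<close> is the graph of a function whose superlevel sets are described by
  superlevel sets of \<open>x \<mapsto> I(x + i c)\<close> at levels below \<open>1/t\<close>. If \<open>t \<ge> 4 D\<^sup>2\<close> these are intervals, so
  the densities, and their limit as \<open>\<epsilon> \<rightarrow> 0\<close>, are quasi-concave.

  (2) For a discrete measure whose atoms have gaps growing to infinity, the density is positive near
  every atom but vanishes on an interval in the middle of every gap that is long compared to
  \<open>\<surd>t\<close>. The weights of the atoms may decay as fast as desired.
\<close>

section \<open>Cauchy transforms\<close>

text \<open>The obstacle is that \<open>\<boxplus>\<close> is a \<open>THE\<close> over
  R-transforms: nothing is known about its value before a measure with the right R-transform has
  been built and shown unique. The measure is built from boundary values of G \<circ> \<omega>. A
  finite second moment makes this function decay like 1/|z| uniformly up to the real line, so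
  Cauchy's formula on growing rectangles recovers it from its imaginary part there. In (1) the
  second moment is finite by boundedness, in (2) by the choice of weights. S(0,t) is the same
  construction started at the point mass at 0.

  The exponent 1/3 arises because H(w) - H(w') is w - w' times a factor that can vanish at the
  boundary of \<Omega>, but is bounded below by a multiple of |w - w'|^2 on bounded sets.

  The constant 4 in (1) is 3 + 1. The kernel 1/(v^2 + c^2) is concave for |v| \<le> c/sqrt 3, so I
  is concave over the convex hull of the support once c^2 \<ge> 3 D^2. For c^2 \<le> t - D^2 one has
  I \<ge> 1/t there, which no level below 1/t can see. The two ranges cover all heights when 3 D^2
  \<le> t - D^2.\<close>

definition energy :: "real measure \<Rightarrow> complex \<Rightarrow> real" where
  "energy M w = (LINT u|M. 1 / (cmod (w - complex_of_real u))\<^sup>2)"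

lemma Im_le_cmod_diff_of_real: "Im w \<le> cmod (w - complex_of_real u)"
  by (metis Im_complex_of_real minus_complex.sel(2) diff_zero abs_Im_le_cmod abs_le_D1)

lemma diff_of_real_nonzero: "Im w > 0 \<Longrightarrow> w - complex_of_real u \<noteq> 0"
  by auto

lemma norm_inverse_diff_of_real_le: "Im w > 0 \<Longrightarrow> cmod (1 / (w - complex_of_real u)) \<le> 1 / Im w"
  using Im_le_cmod_diff_of_real[of w u] by (simp add: norm_divide frac_le)

context real_distribution
begin

lemma norm_integral_le_integral:
  fixes f :: "real \<Rightarrow> 'b::{banach, second_countable_topology}"
  assumes "integrable M g" "\<And>u. norm (f u) \<le> g u"
  shows "norm (integral\<^sup>L M f) \<le> integral\<^sup>L M g"
proof (cases "integrable M f")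
  case True
  then show ?thesis
    using assms by (intro order_trans[OF integral_norm_bound integral_mono]) auto
next
  \<comment> \<open>The Bochner integral of a non-integrable function is 0 by default, so only
    nonnegativity of \<open>g\<close> is left, and \<open>g\<close> dominates a norm.\<close>
  case False
  have "0 \<le> g u" for u
    using order_trans[OF norm_ge_zero assms(2)] .
  with False show ?thesis by (simp add: not_integrable_integral_eq)
qed

lemma prob_UNIV: "prob UNIV = 1"
  using prob_space by simp

lemma integrable_bounded:
  fixes f :: "real \<Rightarrow> 'b::{banach, second_countable_topology}"
  assumes "f \<in> borel_measurable borel" "\<And>u. norm (f u) \<le> B"
  shows "integrable M f"
  using assms by (intro integrable_const_bound[of _ B]) (auto simp: measurable_cong_sets[OF events_eq_borel refl])

lemma integrable_resolvent:
  assumes "Im w > 0"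
  shows "integrable M (\<lambda>u. 1 / (w - complex_of_real u))"
  by (rule integrable_bounded[OF _ norm_inverse_diff_of_real_le[OF assms]]) measurable

lemma integrable_resolvent_mult:
  assumes "Im w > 0" "Im w' > 0"
  shows "integrable M (\<lambda>u. 1 / ((w - complex_of_real u) * (w' - complex_of_real u)))"
proof (rule integrable_bounded)
  show "cmod (1 / ((w - complex_of_real u) * (w' - complex_of_real u))) \<le> (1 / Im w) * (1 / Im w')" for u
    using mult_mono[OF norm_inverse_diff_of_real_le norm_inverse_diff_of_real_le, of w w' u u] assms
    by (simp add: norm_mult norm_divide)
qed measurable

lemma integrable_energy:
  assumes "Im w > 0"
  shows "integrable M (\<lambda>u. 1 / (cmod (w - complex_of_real u))\<^sup>2)"
  using integrable_norm[OF integrable_resolvent_mult[OF assms assms]]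
  by (simp add: norm_mult norm_divide power2_eq_square)

lemma norm_cauchy_transform_le:
  assumes "Im w > 0"
  shows "cmod (cauchy_transform M w) \<le> 1 / Im w"
proof -
  have "cmod (cauchy_transform M w) \<le> (LINT u|M. 1 / Im w)"
    unfolding cauchy_transform_def
    by (rule norm_integral_le_integral[OF _ norm_inverse_diff_of_real_le[OF assms]]) simp
  then show ?thesis by (simp add: prob_UNIV)
qed

lemma energy_nonneg: "energy M w \<ge> 0"
  unfolding energy_def by (intro integral_nonneg_AE) auto

lemma energy_le:
  assumes "Im w > 0"
  shows "energy M w \<le> 1 / (Im w)\<^sup>2"
proof -
  have "energy M w \<le> (LINT u|M. 1 / (Im w)\<^sup>2)"
    unfolding energy_def using assms Im_le_cmod_diff_of_real[of w]
    by (intro integral_mono integrable_energy) (auto intro!: divide_left_mono power_mono mult_pos_pos zero_less_power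
          simp: diff_of_real_nonzero[OF assms, unfolded right_minus_eq])
  then show ?thesis by (simp add: prob_UNIV)
qed

lemma Im_cauchy_transform:
  assumes "Im w > 0"
  shows "Im (cauchy_transform M w) = - Im w * energy M w"
proof -
  have "Im (cauchy_transform M w) = (LINT u|M. Im (1 / (w - complex_of_real u)))"
    unfolding cauchy_transform_def by (rule integral_Im[OF integrable_resolvent[OF assms], symmetric])
  also have "\<dots> = (LINT u|M. - Im w * (1 / (cmod (w - complex_of_real u))\<^sup>2))"
    by (intro Bochner_Integration.integral_cong refl) (simp add: Im_divide cmod_power2)
  also have "\<dots> = - Im w * energy M w"
    unfolding energy_def by (rule integral_mult_right_zero)
  finally show ?thesis .
qed

text \<open>The resolvent identity 1/a - 1/b = (b - a)/(a b), integrated. The product kernel on the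
  right is what the derivative, injectivity, Hoelder and Lipschitz estimates all work with.\<close>

lemma cauchy_transform_diff:
  assumes "Im w > 0" "Im w' > 0"
  shows "cauchy_transform M w - cauchy_transform M w' =
    - (w - w') * (LINT u|M. 1 / ((w - complex_of_real u) * (w' - complex_of_real u)))"
proof -
  have "cauchy_transform M w - cauchy_transform M w' =
      (LINT u|M. 1 / (w - complex_of_real u) - 1 / (w' - complex_of_real u))"
    unfolding cauchy_transform_def using assms by (simp add: integrable_resolvent)
  also have "\<dots> = (LINT u|M. - (w - w') * (1 / ((w - complex_of_real u) * (w' - complex_of_real u))))"
    using diff_of_real_nonzero[OF assms(1)] diff_of_real_nonzero[OF assms(2)]
    by (intro Bochner_Integration.integral_cong refl) (simp add: field_simps)
  also have "\<dots> = - (w - w') * (LINT u|M. 1 / ((w - complex_of_real u) * (w' - complex_of_real u)))"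
    by (rule integral_mult_right_zero)
  finally show ?thesis .
qed

text \<open>The difference quotient minus the candidate derivative is again an integral with a
  factor \<open>v - w\<close> in front, and the remaining kernel is bounded by
  \<open>1 / ((Im w)\<^sup>2 * Im v)\<close>. This explicit error stands in for differentiation
  under the integral sign.\<close>

lemma has_field_derivative_cauchy_transform:
  assumes "Im w > 0"
  shows "(cauchy_transform M has_field_derivative - (LINT u|M. 1 / (w - complex_of_real u)\<^sup>2)) (at w)"
proof -
  define L where "L = (LINT u|M. 1 / (w - complex_of_real u)\<^sup>2)"
  have int2: "integrable M (\<lambda>u. 1 / (w - complex_of_real u)\<^sup>2)"
    using integrable_resolvent_mult[OF assms assms] by (simp add: power2_eq_square)
  have bound: "cmod ((cauchy_transform M v - cauchy_transform M w) / (v - w) - (- L)) \<le> cmod (v - w) * (1 / ((Im w)\<^sup>2 * Im v))"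
    if v: "Im v > 0" "v \<noteq> w" for v
  proof -
    have "(cauchy_transform M v - cauchy_transform M w) / (v - w) - (- L)
      = L - (LINT u|M. 1 / ((v - complex_of_real u) * (w - complex_of_real u)))"
      using v(2) by (simp add: cauchy_transform_diff[OF v(1) assms] divide_simps) (simp add: algebra_simps)
    also have "\<dots> = (LINT u|M. 1 / (w - complex_of_real u)\<^sup>2 - 1 / ((v - complex_of_real u) * (w - complex_of_real u)))"
      unfolding L_def by (simp add: int2 integrable_resolvent_mult v assms)
    also have "\<dots> = (LINT u|M. (v - w) * ((1 / (w - complex_of_real u)\<^sup>2) * (1 / (v - complex_of_real u))))"
    proof (intro Bochner_Integration.integral_cong refl)
      fix u
      have *: "1 / a\<^sup>2 - 1 / (b * a) = (b - a) * (1 / a\<^sup>2 * (1 / b))" if "a \<noteq> 0" "b \<noteq> 0" for a b :: complex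
        using that by (simp add: field_simps power2_eq_square)
      show "1 / (w - complex_of_real u)\<^sup>2 - 1 / ((v - complex_of_real u) * (w - complex_of_real u))
        = (v - w) * ((1 / (w - complex_of_real u)\<^sup>2) * (1 / (v - complex_of_real u)))"
        using *[OF diff_of_real_nonzero[OF assms] diff_of_real_nonzero[OF v(1)], of u u] by simp
    qed
    also have "cmod \<dots> \<le> (LINT u|M. cmod (v - w) * (1 / ((Im w)\<^sup>2 * Im v)))"
    proof (rule norm_integral_le_integral)
      show "cmod ((v - w) * ((1 / (w - complex_of_real u)\<^sup>2) * (1 / (v - complex_of_real u))))
          \<le> cmod (v - w) * (1 / ((Im w)\<^sup>2 * Im v))" for u
      proof -
        have "cmod (1 / (w - complex_of_real u)) ^ 2 * cmod (1 / (v - complex_of_real u)) \<le> (1 / Im w)\<^sup>2 * (1 / Im v)"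
          using assms v(1) by (intro mult_mono power_mono norm_inverse_diff_of_real_le) auto
        then show ?thesis
          using mult_left_mono[OF _ norm_ge_zero[of "v - w"]]
          by (fastforce simp: norm_mult norm_divide norm_power power_divide mult.commute)
      qed
    qed simp
    also have "\<dots> = cmod (v - w) * (1 / ((Im w)\<^sup>2 * Im v))" by (simp add: prob_UNIV)
    finally show ?thesis .
  qed
  have ev: "eventually (\<lambda>v. Im v > 0 \<and> v \<noteq> w) (at w)"
  proof -
    have "eventually (\<lambda>v. v \<in> {v. Im v > 0}) (at w)"
      using assms by (intro eventually_at_in_open' open_halfspace_Im_gt) auto
    then show ?thesis by (auto simp: eventually_at_filter elim: eventually_mono)
  qed
  have "((\<lambda>v. (cauchy_transform M v - cauchy_transform M w) / (v - w) - (- L)) \<longlongrightarrow> 0) (at w)"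
  proof (rule Lim_null_comparison)
    show "eventually (\<lambda>v. cmod ((cauchy_transform M v - cauchy_transform M w) / (v - w) - (- L))
       \<le> cmod (v - w) * (1 / ((Im w)\<^sup>2 * Im v))) (at w)"
      using ev by eventually_elim (use bound in blast)
    show "((\<lambda>v. cmod (v - w) * (1 / ((Im w)\<^sup>2 * Im v))) \<longlongrightarrow> 0) (at w)"
      using assms by (auto intro!: tendsto_eq_intros)
  qed
  then show ?thesis
    unfolding has_field_derivative_iff L_def[symmetric] by (rule LIM_zero_cancel)
qed

lemma holomorphic_cauchy_transform: "cauchy_transform M holomorphic_on {w. Im w > 0}"
  using has_field_derivative_cauchy_transform
  by (auto simp: holomorphic_on_open open_halfspace_Im_gt)

end

section \<open>Uniqueness\<close>

lemma integrable_inverse_1_plus_square_lborel: "integrable lborel (\<lambda>x::real. 1 / (1 + x\<^sup>2))"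
  using integrable_inverse_1_plus_square by (simp add: set_integrable_def einterval_def inverse_eq_divide)

lemma integral_inverse_1_plus_square_lborel: "(LINT x|lborel. 1 / (1 + x\<^sup>2)) = pi"
  using LBINT_inverse_1_plus_square
  by (simp add: interval_lebesgue_integral_def set_lebesgue_integral_def einterval_def inverse_eq_divide)

lemma integrable_cauchy_kernel:
  fixes y u :: real
  assumes "y > 0"
  shows "integrable lborel (\<lambda>x. 1 / ((x - u)\<^sup>2 + y\<^sup>2))"
proof -
  have "integrable lborel (\<lambda>x. (1 / y\<^sup>2) * (1 / (1 + (- u / y + (1 / y) * x)\<^sup>2)))"
    using assms lborel_integrable_real_affine[OF integrable_inverse_1_plus_square_lborel, of "1 / y" "- u / y"]
    by (intro integrable_mult_right) simp
  also have "(\<lambda>x. (1 / y\<^sup>2) * (1 / (1 + (- u / y + (1 / y) * x)\<^sup>2))) = (\<lambda>x. 1 / ((x - u)\<^sup>2 + y\<^sup>2))"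
    using assms by (auto simp: fun_eq_iff field_simps power2_eq_square)
  finally show ?thesis .
qed

text \<open>Substituting v = y r turns the integral into a positive multiple of the integral of
  exp(i s y r)/(1 + r^2), which tends to \<pi> as y tends to 0. For a fixed frequency one good
  height is enough, so the closed form of this Fourier transform is avoided.\<close>

lemma ex_fourier_cauchy_kernel_nonzero:
  fixes s :: real
  shows "\<exists>y>0. (CLINT v|lborel. iexp (s * v) * complex_of_real (1 / (v\<^sup>2 + y\<^sup>2))) \<noteq> 0"
proof -
  define k where "k = (\<lambda>n. CLINT r|lborel. iexp (s * (inverse (real (Suc n)) * r)) * complex_of_real (1 / (1 + r\<^sup>2)))"
  have "k \<longlonglongrightarrow> (CLINT r|lborel. iexp (s * (0 * r)) * complex_of_real (1 / (1 + r\<^sup>2)))"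
    unfolding k_def
  proof (rule integral_dominated_convergence)
    show "integrable lborel (\<lambda>x::real. 1 / (1 + x\<^sup>2))" by (rule integrable_inverse_1_plus_square_lborel)
    show "AE x in lborel. (\<lambda>n. iexp (s * (inverse (real (Suc n)) * x)) * complex_of_real (1 / (1 + x\<^sup>2)))
        \<longlonglongrightarrow> iexp (s * (0 * x)) * complex_of_real (1 / (1 + x\<^sup>2))"
      by (intro AE_I2 tendsto_intros LIMSEQ_inverse_real_of_nat)
    show "AE x in lborel. norm (iexp (s * (inverse (real (Suc n)) * x)) * complex_of_real (1 / (1 + x\<^sup>2))) \<le> 1 / (1 + x\<^sup>2)" for n
      by (intro AE_I2) (simp only: norm_mult norm_exp_i_times norm_of_real, simp)
  qed measurable
  also have "(CLINT r|lborel. iexp (s * (0 * r)) * complex_of_real (1 / (1 + r\<^sup>2))) = of_real pi"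
    using integral_complex_of_real[of lborel "\<lambda>r::real. 1 / (1 + r\<^sup>2)"] integral_inverse_1_plus_square_lborel
    by simp
  finally have "k \<longlonglongrightarrow> of_real pi" .
  moreover have "of_real pi \<noteq> (0::complex)" by simp
  ultimately have "eventually (\<lambda>n. k n \<noteq> 0) sequentially"
    by (rule tendsto_imp_eventually_ne)
  then obtain n where n: "k n \<noteq> 0"
    by (auto simp: eventually_sequentially)
  define y where "y = inverse (real (Suc n))"
  have y: "y > 0" by (simp add: y_def)
  have "(CLINT v|lborel. iexp (s * v) * complex_of_real (1 / (v\<^sup>2 + y\<^sup>2))) =
      y *\<^sub>R (CLINT r|lborel. iexp (s * (0 + y * r)) * complex_of_real (1 / ((0 + y * r)\<^sup>2 + y\<^sup>2)))"
    using lborel_integral_real_affine[of y "\<lambda>v. iexp (s * v) * complex_of_real (1 / (v\<^sup>2 + y\<^sup>2))" 0] y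
    by simp
  also have "(CLINT r|lborel. iexp (s * (0 + y * r)) * complex_of_real (1 / ((0 + y * r)\<^sup>2 + y\<^sup>2)))
      = (CLINT r|lborel. complex_of_real (1 / y\<^sup>2) * (iexp (s * (y * r)) * complex_of_real (1 / (1 + r\<^sup>2))))"
  proof (intro Bochner_Integration.integral_cong refl)
    fix r :: real
    have "1 / ((0 + y * r)\<^sup>2 + y\<^sup>2) = (1 / y\<^sup>2) * (1 / (1 + r\<^sup>2))"
      using y by (simp add: field_simps power2_eq_square)
    then show "iexp (s * (0 + y * r)) * complex_of_real (1 / ((0 + y * r)\<^sup>2 + y\<^sup>2))
      = complex_of_real (1 / y\<^sup>2) * (iexp (s * (y * r)) * complex_of_real (1 / (1 + r\<^sup>2)))"
      by (simp only: of_real_mult) simp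
  qed
  also have "\<dots> = complex_of_real (1 / y\<^sup>2) * k n"
    unfolding k_def y_def by (rule integral_mult_right_zero)
  finally show ?thesis
    using y n by (intro exI[of _ y]) simp
qed

context real_distribution
begin

text \<open>As a function of the abscissa, the energy at height y is the convolution of
  \<open>M\<close> with 1/(v^2 + y^2); hence its Fourier transform is a product.\<close>

lemma fourier_energy:
  assumes y: "y > 0"
  shows "(CLINT x|lborel. iexp (s * x) * complex_of_real (energy M (Complex x y))) =
    char M s * (CLINT v|lborel. iexp (s * v) * complex_of_real (1 / (v\<^sup>2 + y\<^sup>2)))"
proof -
  interpret P: pair_sigma_finite M lborel
    by unfold_locales
  define f where "f = (\<lambda>(u::real, x::real). iexp (s * x) * complex_of_real (1 / ((x - u)\<^sup>2 + y\<^sup>2)))"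
  have norm_f: "norm (f (u, x)) = 1 / ((x - u)\<^sup>2 + y\<^sup>2)" for u x
  proof -
    have "norm (f (u, x)) = \<bar>1 / ((x - u)\<^sup>2 + y\<^sup>2)\<bar>"
      unfolding f_def by (simp only: norm_mult norm_of_real split_conv norm_exp_i_times)
    then show ?thesis by simp
  qed
  have kern: "(LINT x|lborel. 1 / ((x - u)\<^sup>2 + y\<^sup>2)) = (LINT x|lborel. 1 / (x\<^sup>2 + y\<^sup>2))" for u
    using lborel_integral_real_affine[of 1 "\<lambda>x. 1 / ((x - u)\<^sup>2 + y\<^sup>2)" u] by simp
  have f_meas: "f \<in> borel_measurable (M \<Otimes>\<^sub>M lborel)"
    unfolding f_def by measurable
  have "integrable (M \<Otimes>\<^sub>M lborel) f"
  proof (rule P.Fubini_integrable[OF f_meas])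
    show "integrable M (\<lambda>x. LINT y|lborel. norm (f (x, y)))"
      unfolding norm_f kern by simp
    have "integrable lborel (\<lambda>x. f (u, x))" for u
      by (rule Bochner_Integration.integrable_bound[OF integrable_cauchy_kernel[OF y, of u]])
         (unfold norm_f, auto simp: f_def)
    then show "AE x in M. integrable lborel (\<lambda>y. f (x, y))" by simp
  qed
  then have int: "integrable (M \<Otimes>\<^sub>M lborel) (case_prod (\<lambda>u x. f (u, x)))" by simp
  have "(CLINT x|lborel. iexp (s * x) * complex_of_real (energy M (Complex x y))) =
      (CLINT x|lborel. (CLINT u|M. f (u, x)))"
  proof (intro Bochner_Integration.integral_cong refl)
    fix x
    have "energy M (Complex x y) = (LINT u|M. 1 / ((x - u)\<^sup>2 + y\<^sup>2))"
      unfolding energy_def by (intro Bochner_Integration.integral_cong refl) (simp add: cmod_power2)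
    then show "iexp (s * x) * complex_of_real (energy M (Complex x y)) = (CLINT u|M. f (u, x))"
      unfolding f_def split_conv integral_mult_right_zero integral_complex_of_real by simp
  qed
  also have "\<dots> = (CLINT u|M. (CLINT x|lborel. f (u, x)))"
    by (rule P.Fubini_integral[OF int])
  also have "\<dots> = (CLINT u|M. iexp (s * u) * (CLINT v|lborel. iexp (s * v) * complex_of_real (1 / (v\<^sup>2 + y\<^sup>2))))"
  proof (intro Bochner_Integration.integral_cong refl)
    fix u
    have "(CLINT x|lborel. f (u, x)) = (CLINT v|lborel. f (u, u + 1 * v))"
      using lborel_integral_real_affine[of 1 "\<lambda>x. f (u, x)" u] by simp
    also have "\<dots> = (CLINT v|lborel. iexp (s * u) * (iexp (s * v) * complex_of_real (1 / (v\<^sup>2 + y\<^sup>2))))"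
      unfolding f_def by (intro Bochner_Integration.integral_cong refl)
        (simp add: distrib_left exp_add)
    finally show "(CLINT x|lborel. f (u, x)) =
       iexp (s * u) * (CLINT v|lborel. iexp (s * v) * complex_of_real (1 / (v\<^sup>2 + y\<^sup>2)))"
      by (simp only: integral_mult_right_zero)
  qed
  also have "\<dots> = char M s * (CLINT v|lborel. iexp (s * v) * complex_of_real (1 / (v\<^sup>2 + y\<^sup>2)))"
    unfolding char_def by (rule integral_mult_left_zero)
  finally show ?thesis .
qed

end

text \<open>The imaginary part of the Cauchy transform determines the energy on every horizontal
  line. Dividing the Fourier identity by the kernel's transform, at a height chosen for the
  frequency \<open>s\<close> so that this is nonzero, recovers the characteristic function at
  \<open>s\<close>.\<close>

theorem cauchy_transform_unique:
  assumes "real_distribution M" "real_distribution N"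
    and eq: "\<And>z. Im z > 0 \<Longrightarrow> cauchy_transform M z = cauchy_transform N z"
  shows "M = N"
proof (rule Levy_uniqueness[OF assms(1,2)])
  interpret M: real_distribution M by fact
  interpret N: real_distribution N by fact
  show "char M = char N"
  proof
    fix s
    obtain y where y: "y > 0" and nz: "(CLINT v|lborel. iexp (s * v) * complex_of_real (1 / (v\<^sup>2 + y\<^sup>2))) \<noteq> 0"
      using ex_fourier_cauchy_kernel_nonzero by blast
    have "energy M (Complex x y) = energy N (Complex x y)" for x
      using y M.Im_cauchy_transform[of "Complex x y"] N.Im_cauchy_transform[of "Complex x y"] eq[of "Complex x y"]
      by simp
    with M.fourier_energy[OF y, of s] N.fourier_energy[OF y, of s] nz show "char M s = char N s"
      by simp
  qed
qed

section \<open>Inverting the Cauchy transform in a cone\<close>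

lemma upper_cone_Im: "z \<in> upper_cone \<alpha> \<beta> \<Longrightarrow> Im z > 0"
  by (simp add: upper_cone_def)

lemma open_upper_cone: "open (upper_cone \<alpha> \<beta>)"
proof -
  have "upper_cone \<alpha> \<beta> = {z. Im z > 0} \<inter> {z. \<bar>Re z\<bar> < \<alpha> * Im z} \<inter> {z. Im z > \<beta>}"
    by (auto simp: upper_cone_def)
  also have "open \<dots>"
    by (intro open_Int open_Collect_less continuous_intros)
  finally show ?thesis .
qed

text \<open>As an intersection of half-planes and a disc, the sector is visibly open and
  convex.\<close>

lemma lower_sector_alt:
  "lower_sector \<gamma> \<delta> = {z. Im z < 0} \<inter> {z. Complex 1 \<gamma> \<bullet> z < 0} \<inter> {z. Complex (-1) \<gamma> \<bullet> z < 0} \<inter> ball 0 \<delta>"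
  by (auto simp: lower_sector_def inner_complex_def abs_less_iff)

lemma open_lower_sector: "open (lower_sector \<gamma> \<delta>)"
  unfolding lower_sector_alt by (intro open_Int open_halfspace_lt open_halfspace_Im_lt open_ball)

lemma convex_lower_sector: "convex (lower_sector \<gamma> \<delta>)"
  unfolding lower_sector_alt by (intro convex_Int convex_halfspace_lt convex_halfspace_Im_lt convex_ball)

lemma lower_sector_Int:
  "lower_sector \<gamma> \<delta> \<inter> lower_sector \<gamma>' \<delta>' = lower_sector (min \<gamma> \<gamma>') (min \<delta> \<delta>')"
proof -
  have "min \<gamma> \<gamma>' * \<bar>y\<bar> = min (\<gamma> * \<bar>y\<bar>) (\<gamma>' * \<bar>y\<bar>)" for y
    by (simp add: min_mult_distrib_right)
  then show ?thesis by (auto simp: lower_sector_def)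
qed

lemma lower_sector_mono: "\<gamma> \<le> \<gamma>' \<Longrightarrow> \<delta> \<le> \<delta>' \<Longrightarrow> lower_sector \<gamma> \<delta> \<subseteq> lower_sector \<gamma>' \<delta>'"
  using lower_sector_Int[of \<gamma> \<delta> \<gamma>' \<delta>'] by (auto simp: min_def)

lemma lower_sector_nonempty:
  assumes "\<gamma> > 0" "\<delta> > 0"
  shows "lower_sector \<gamma> \<delta> \<noteq> {}"
proof -
  have "Complex 0 (- \<delta> / 2) \<in> lower_sector \<gamma> \<delta>"
    using assms by (simp add: lower_sector_def cmod_def)
  then show ?thesis by blast
qed

lemma lower_sector_nonzero: "z \<in> lower_sector \<gamma> \<delta> \<Longrightarrow> z \<noteq> 0"
  by (auto simp: lower_sector_def)

text \<open>Any two sectors overlap near 0, whatever their apertures and radii, and a sector is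
  connected; so equality of germs at 0 spreads by the identity theorem.\<close>

lemma holomorphic_sector_eqI:
  assumes "f holomorphic_on lower_sector \<gamma> \<delta>" "g holomorphic_on lower_sector \<gamma> \<delta>"
    and "\<gamma> > 0" "\<delta> > 0" "\<gamma>' > 0" "\<delta>' > 0"
    and "\<And>z. z \<in> lower_sector \<gamma> \<delta> \<Longrightarrow> z \<in> lower_sector \<gamma>' \<delta>' \<Longrightarrow> f z = g z"
    and "z \<in> lower_sector \<gamma> \<delta>"
  shows "f z = g z"
proof (rule analytic_continuation_open[OF _ _ _ _ _ assms(1,2)])
  show "open (lower_sector \<gamma> \<delta> \<inter> lower_sector \<gamma>' \<delta>')"
    by (intro open_Int open_lower_sector)
  show "lower_sector \<gamma> \<delta> \<inter> lower_sector \<gamma>' \<delta>' \<noteq> {}"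
    unfolding lower_sector_Int using assms by (intro lower_sector_nonempty) auto
qed (use assms in \<open>auto intro: open_lower_sector convex_connected convex_lower_sector\<close>)

section \<open>Tail bounds and admissible parameters for the inverse\<close>

context real_distribution
begin

text \<open>Dominated convergence, whatever the tails of \<open>M\<close>. The truncated quantity
  bounds |u/(z - u)| for z in the cone of aperture \<alpha> above height \<beta>, so its integral
  measures how far z G(z) is from 1 there.\<close>

lemma ex_tail_bound:
  fixes \<alpha> \<eta> :: real
  assumes "\<alpha> > 0" "\<eta> > 0"
  shows "\<exists>\<beta>\<^sub>0>0. \<forall>\<beta>\<ge>\<beta>\<^sub>0. (LINT u|M. min (1 + \<alpha>) (\<bar>u\<bar> / \<beta>)) < \<eta>"
proof -
  have int: "integrable M (\<lambda>u. min (1 + \<alpha>) (\<bar>u\<bar> / \<beta>))" if "\<beta> > 0" for \<beta>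
    using that assms by (intro integrable_bounded[where B = "1 + \<alpha>"]) auto
  have "(\<lambda>n. LINT u|M. min (1 + \<alpha>) (\<bar>u\<bar> * inverse (real (Suc n)))) \<longlonglongrightarrow> (LINT u|M. min (1 + \<alpha>) (\<bar>u\<bar> * 0))"
  proof (rule integral_dominated_convergence)
    show "AE u in M. (\<lambda>n. min (1 + \<alpha>) (\<bar>u\<bar> * inverse (real (Suc n)))) \<longlonglongrightarrow> min (1 + \<alpha>) (\<bar>u\<bar> * 0)"
      by (intro AE_I2 tendsto_intros tendsto_min LIMSEQ_inverse_real_of_nat)
    show "AE u in M. norm (min (1 + \<alpha>) (\<bar>u\<bar> * inverse (real (Suc n)))) \<le> 1 + \<alpha>" for n
      using assms by (intro AE_I2) (auto simp: abs_if min_def mult_less_0_iff)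
  qed auto
  then have "(\<lambda>n. LINT u|M. min (1 + \<alpha>) (\<bar>u\<bar> * inverse (real (Suc n)))) \<longlonglongrightarrow> 0"
    using assms by simp
  then have "eventually (\<lambda>n. (LINT u|M. min (1 + \<alpha>) (\<bar>u\<bar> * inverse (real (Suc n)))) < \<eta>) sequentially"
    using assms(2) by (rule order_tendstoD)
  then obtain n where n: "(LINT u|M. min (1 + \<alpha>) (\<bar>u\<bar> * inverse (real (Suc n)))) < \<eta>"
    by (auto simp: eventually_sequentially)
  show ?thesis
  proof (intro exI[of _ "real (Suc n)"] conjI allI impI)
    fix \<beta> assume \<beta>: "real (Suc n) \<le> \<beta>"
    have "(LINT u|M. min (1 + \<alpha>) (\<bar>u\<bar> / \<beta>)) \<le> (LINT u|M. min (1 + \<alpha>) (\<bar>u\<bar> / real (Suc n)))"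
      using \<beta> by (intro integral_mono int min.mono divide_left_mono) auto
    then show "(LINT u|M. min (1 + \<alpha>) (\<bar>u\<bar> / \<beta>)) < \<eta>"
      using n by (simp add: divide_inverse)
  qed auto
qed

lemma norm_divide_diff_of_real_le:
  assumes "\<alpha> > 0" "\<beta> > 0" "\<bar>Re z\<bar> \<le> \<alpha> * Im z" "Im z \<ge> \<beta>"
  shows "cmod (complex_of_real u / (z - complex_of_real u)) \<le> min (1 + \<alpha>) (\<bar>u\<bar> / \<beta>)"
proof -
  have Im: "Im z \<le> cmod (z - complex_of_real u)" by (rule Im_le_cmod_diff_of_real)
  have pos: "cmod (z - complex_of_real u) > 0" using Im assms by linarith
  have "\<bar>u\<bar> \<le> \<bar>Re (z - complex_of_real u)\<bar> + \<bar>Re z\<bar>" by simp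
  also have "\<dots> \<le> cmod (z - complex_of_real u) + \<alpha> * cmod (z - complex_of_real u)"
    using abs_Re_le_cmod[of "z - complex_of_real u"] assms mult_left_mono[OF Im, of \<alpha>] by linarith
  finally have "\<bar>u\<bar> / cmod (z - complex_of_real u) \<le> 1 + \<alpha>"
    using pos by (simp add: divide_le_eq algebra_simps)
  moreover have "\<bar>u\<bar> / cmod (z - complex_of_real u) \<le> \<bar>u\<bar> / \<beta>"
    using pos Im assms by (intro divide_left_mono mult_pos_pos) auto
  ultimately show ?thesis by (simp add: norm_divide)
qed

lemma norm_mult_cauchy_transform_minus_1_le:
  assumes "\<alpha> > 0" "\<beta> > 0" "\<bar>Re z\<bar> \<le> \<alpha> * Im z" "Im z \<ge> \<beta>"
  shows "cmod (z * cauchy_transform M z - 1) \<le> (LINT u|M. min (1 + \<alpha>) (\<bar>u\<bar> / \<beta>))"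
proof -
  have Im: "Im z > 0" using assms by linarith
  have "z * cauchy_transform M z - 1 = (CLINT u|M. z * (1 / (z - complex_of_real u))) - (CLINT u|M. 1)"
    unfolding cauchy_transform_def by (simp only: integral_mult_right_zero) (simp add: prob_UNIV)
  also have "\<dots> = (CLINT u|M. z * (1 / (z - complex_of_real u)) - 1)"
    by (intro Bochner_Integration.integral_diff[symmetric] integrable_mult_right integrable_resolvent Im) simp
  also have "\<dots> = (CLINT u|M. complex_of_real u / (z - complex_of_real u))"
    using diff_of_real_nonzero[OF Im] by (intro Bochner_Integration.integral_cong refl) (simp add: field_simps)
  also have "cmod \<dots> \<le> (LINT u|M. min (1 + \<alpha>) (\<bar>u\<bar> / \<beta>))"
    using assms by (intro norm_integral_le_integral norm_divide_diff_of_real_le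
        integrable_bounded[where B = "1 + \<alpha>"]) auto
  finally show ?thesis .
qed

text \<open>If two distinct points z, w had the same image, the integral \<open>J\<close> of the
  product kernel would vanish; but high up in the cone z w J is within distance less than 1 of
  1.\<close>

lemma inj_on_cauchy_transform_upper_cone:
  assumes "\<alpha> > 0" "\<beta> > 0" and small: "(3 + \<alpha>) * (LINT u|M. min (1 + \<alpha>) (\<bar>u\<bar> / \<beta>)) < 1"
  shows "inj_on (cauchy_transform M) (upper_cone \<alpha> \<beta>)"
proof (rule inj_onI, rule ccontr)
  fix z w assume z: "z \<in> upper_cone \<alpha> \<beta>" and w: "w \<in> upper_cone \<alpha> \<beta>"
    and eq: "cauchy_transform M z = cauchy_transform M w" and "z \<noteq> w"
  have Im: "Im z > 0" "Im w > 0" using z w by (auto simp: upper_cone_def)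
  define J where "J = (CLINT u|M. 1 / ((z - complex_of_real u) * (w - complex_of_real u)))"
  have "J = 0"
    using cauchy_transform_diff[OF Im] eq \<open>z \<noteq> w\<close> by (simp add: J_def)
  have int: "integrable M (\<lambda>u. min (1 + \<alpha>) (\<bar>u\<bar> / \<beta>))"
    using assms by (intro integrable_bounded[where B = "1 + \<alpha>"]) auto
  have "z * w * J - 1 = (CLINT u|M. z * w * (1 / ((z - complex_of_real u) * (w - complex_of_real u)))) - (CLINT u|M. 1)"
    unfolding J_def by (simp only: integral_mult_right_zero) (simp add: prob_UNIV)
  also have "\<dots> = (CLINT u|M. z * w * (1 / ((z - complex_of_real u) * (w - complex_of_real u))) - 1)"
    by (intro Bochner_Integration.integral_diff[symmetric] integrable_mult_right integrable_resolvent_mult Im) simp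
  also have "cmod \<dots> \<le> (LINT u|M. (3 + \<alpha>) * min (1 + \<alpha>) (\<bar>u\<bar> / \<beta>))"
  proof (rule norm_integral_le_integral)
    fix u :: real
    define m where "m = min (1 + \<alpha>) (\<bar>u\<bar> / \<beta>)"
    define a where "a = complex_of_real u / (z - complex_of_real u)"
    define b where "b = complex_of_real u / (w - complex_of_real u)"
    have a: "cmod a \<le> m" and b: "cmod b \<le> m"
      unfolding a_def b_def m_def using assms z w
      by (auto intro!: norm_divide_diff_of_real_le simp: upper_cone_def less_imp_le simp del: min.bounded_iff)
    have m: "m \<le> 1 + \<alpha>" by (simp add: m_def)
    have *: "(p + c) * (q + c) * (1 / (p * q)) - 1 = c / p + c / q + c / p * (c / q)"
      if "p \<noteq> 0" "q \<noteq> 0" for c p q :: complex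
      using that by (simp add: field_simps)
    have "z * w * (1 / ((z - complex_of_real u) * (w - complex_of_real u))) - 1 = a + b + a * b"
      unfolding a_def b_def
      using *[OF diff_of_real_nonzero[OF Im(1)] diff_of_real_nonzero[OF Im(2)], of u "complex_of_real u" u] by simp
    also have "cmod \<dots> \<le> cmod a + cmod b + cmod a * cmod b"
      by (metis norm_mult norm_triangle_ineq add_right_mono order_trans)
    \<comment> \<open>In \<open>a * b\<close> only one factor is replaced by
      \<open>1 + \<alpha>\<close>. The bound stays linear in \<open>m\<close>, and its coefficient
      is the \<open>3 + \<alpha>\<close> of the hypothesis.\<close>
    also have "\<dots> \<le> m + m + (1 + \<alpha>) * m"
      using a b m assms by (intro add_mono mult_mono) auto
    finally show "cmod (z * w * (1 / ((z - complex_of_real u) * (w - complex_of_real u))) - 1)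
        \<le> (3 + \<alpha>) * min (1 + \<alpha>) (\<bar>u\<bar> / \<beta>)"
      unfolding m_def[symmetric] by (simp add: algebra_simps)
  qed (intro integrable_mult_right int)
  also have "\<dots> = (3 + \<alpha>) * (LINT u|M. min (1 + \<alpha>) (\<bar>u\<bar> / \<beta>))"
    by (rule integral_mult_right_zero)
  finally show False using small \<open>J = 0\<close> by simp
qed

text \<open>With w = 1/\<zeta>, the equation G(z) = \<zeta> says that z is a nonzero fixed point of
  z \<mapsto> z G(z) w. Since z G(z) is within 1/5 of 1 in the cone, this map sends the disc of
  radius |w|/5 about w into itself, and Brouwer's theorem applies.\<close>

lemma lower_sector_subset_cauchy_transform_image:
  assumes "\<alpha> \<ge> 2" "\<beta> > 0" and small: "(LINT u|M. min (1 + \<alpha>) (\<bar>u\<bar> / \<beta>)) < 1 / 5"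
  shows "lower_sector 1 (1 / (4 * \<beta>)) \<subseteq> cauchy_transform M ` upper_cone \<alpha> \<beta>"
proof
  fix \<zeta> assume \<zeta>: "\<zeta> \<in> lower_sector 1 (1 / (4 * \<beta>))"
  then have \<zeta>0: "\<zeta> \<noteq> 0" by (rule lower_sector_nonzero)
  define w where "w = 1 / \<zeta>"
  have nw: "cmod w > 4 * \<beta>"
    using \<zeta> \<zeta>0 assms(2) by (simp add: w_def norm_divide lower_sector_def field_simps)
  have rw: "\<bar>Re w\<bar> < Im w"
  proof -
    have pos: "(Re \<zeta>)\<^sup>2 + (Im \<zeta>)\<^sup>2 > 0"
      using \<zeta>0 by (simp add: sum_power2_gt_zero_iff complex_eq_iff)
    have "\<bar>Re \<zeta>\<bar> / ((Re \<zeta>)\<^sup>2 + (Im \<zeta>)\<^sup>2) < - Im \<zeta> / ((Re \<zeta>)\<^sup>2 + (Im \<zeta>)\<^sup>2)"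
      using \<zeta> pos by (intro divide_strict_right_mono) (auto simp: lower_sector_def)
    then show ?thesis
      by (simp add: w_def Re_divide Im_divide abs_div)
  qed
  \<comment> \<open>1.42 is a rational upper bound for sqrt 2. A point within |w|/5 of w then has
    real part below 1.284 Im w in modulus and imaginary part at least 0.716 Im w, so it lies in a
    cone of aperture 2.\<close>
  have nw2: "cmod w \<le> (142/100) * Im w"
  proof (rule power2_le_imp_le)
    have "(Re w)\<^sup>2 \<le> (Im w)\<^sup>2" using rw by (simp add: abs_le_square_iff[symmetric])
    then have "(Re w)\<^sup>2 + (Im w)\<^sup>2 \<le> 20164/10000 * (Im w)\<^sup>2"
      using zero_le_power2[of "Im w"] by linarith
    moreover have "((142/100) * Im w)\<^sup>2 = 20164/10000 * (Im w)\<^sup>2" by (simp add: power2_eq_square)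
    ultimately show "(cmod w)\<^sup>2 \<le> ((142/100) * Im w)\<^sup>2"
      by (simp only: cmod_power2)
  qed (use rw in linarith)
  have w0: "cmod w > 0" using nw assms by linarith
  have ball: "z \<in> upper_cone \<alpha> \<beta>" if "z \<in> cball w (cmod w / 5)" for z
  proof -
    have "\<bar>Re z - Re w\<bar> \<le> cmod w / 5" "\<bar>Im z - Im w\<bar> \<le> cmod w / 5"
      using that abs_Re_le_cmod[of "z - w"] abs_Im_le_cmod[of "z - w"]
      by (auto simp: dist_norm norm_minus_commute)
    then have "\<bar>Re z\<bar> < 2 * Im z" "Im z > \<beta>" using rw nw nw2 w0 assms(2) by linarith+
    moreover have "2 * Im z \<le> \<alpha> * Im z" using \<open>Im z > \<beta>\<close> assms by (intro mult_right_mono) auto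
    ultimately have "\<bar>Re z\<bar> < \<alpha> * Im z" by linarith
    then show ?thesis using \<open>Im z > \<beta>\<close> assms(2) by (simp add: upper_cone_def)
  qed
  define T where "T = (\<lambda>z. z * cauchy_transform M z * w)"
  have "cball w (cmod w / 5) \<subseteq> {z. Im z > 0}"
    using ball upper_cone_Im by blast
  then have "continuous_on (cball w (cmod w / 5)) T"
    unfolding T_def
    by (intro continuous_intros holomorphic_on_imp_continuous_on holomorphic_on_subset[OF holomorphic_cauchy_transform]) auto
  moreover have "T \<in> cball w (cmod w / 5) \<rightarrow> cball w (cmod w / 5)"
  proof
    fix z assume "z \<in> cball w (cmod w / 5)"
    then have "z \<in> upper_cone \<alpha> \<beta>" by (rule ball)
    then have "cmod (z * cauchy_transform M z - 1) \<le> (LINT u|M. min (1 + \<alpha>) (\<bar>u\<bar> / \<beta>))"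
      using assms by (intro norm_mult_cauchy_transform_minus_1_le) (auto simp: upper_cone_def)
    then have "cmod (z * cauchy_transform M z - 1) \<le> 1 / 5" using small by linarith
    then have "cmod w * cmod (z * cauchy_transform M z - 1) \<le> cmod w * (1 / 5)"
      by (intro mult_left_mono) auto
    moreover have "T z - w = w * (z * cauchy_transform M z - 1)" by (simp add: T_def algebra_simps)
    ultimately have "cmod (T z - w) \<le> cmod w / 5"
      by (simp only: norm_mult)
    then show "T z \<in> cball w (cmod w / 5)"
      by (simp add: dist_norm norm_minus_commute)
  qed
  ultimately obtain z where z: "z \<in> cball w (cmod w / 5)" "T z = z"
    using brouwer_ball[of "cmod w / 5" w T] w0 by auto
  have "z \<noteq> 0" using upper_cone_Im[OF ball[OF z(1)]] by auto
  then have "cauchy_transform M z = \<zeta>"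
    using z(2) \<zeta>0 by (simp add: T_def w_def field_simps)
  then show "\<zeta> \<in> cauchy_transform M ` upper_cone \<alpha> \<beta>" using ball[OF z(1)] by blast
qed

text \<open>The tail is made smaller than \<open>1 / (5 + \<alpha>)\<close>, which serves both
  requirements: times \<open>3 + \<alpha>\<close> it is below 1, which gives injectivity, and it is
  at most 1/5, which gives the covering of the sector.\<close>

lemma R_params_eventually:
  assumes "\<alpha> \<ge> 2"
  shows "\<exists>\<beta>\<^sub>0>0. \<forall>\<beta>\<ge>\<beta>\<^sub>0. R_params M 1 \<alpha> \<beta> (1 / (4 * \<beta>))"
proof -
  obtain \<beta>\<^sub>0 where \<beta>\<^sub>0: "\<beta>\<^sub>0 > 0" "\<And>\<beta>. \<beta> \<ge> \<beta>\<^sub>0 \<Longrightarrow> (LINT u|M. min (1 + \<alpha>) (\<bar>u\<bar> / \<beta>)) < 1 / (5 + \<alpha>)"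
    using ex_tail_bound[of \<alpha> "1 / (5 + \<alpha>)"] assms by auto
  show ?thesis
  proof (intro exI[of _ \<beta>\<^sub>0] conjI allI impI)
    fix \<beta> assume "\<beta> \<ge> \<beta>\<^sub>0"
    then have \<beta>: "\<beta> > 0" and small: "(LINT u|M. min (1 + \<alpha>) (\<bar>u\<bar> / \<beta>)) < 1 / (5 + \<alpha>)"
      using \<beta>\<^sub>0 by auto
    have "(3 + \<alpha>) * (LINT u|M. min (1 + \<alpha>) (\<bar>u\<bar> / \<beta>)) \<le> (3 + \<alpha>) * (1 / (5 + \<alpha>))"
      using small assms by (intro mult_left_mono) auto
    also have "\<dots> < 1" using assms by (simp add: divide_less_eq)
    finally have 1: "(3 + \<alpha>) * (LINT u|M. min (1 + \<alpha>) (\<bar>u\<bar> / \<beta>)) < 1" .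
    have "1 / (5 + \<alpha>) \<le> 1 / 5" using assms by (intro divide_left_mono) auto
    then have "(LINT u|M. min (1 + \<alpha>) (\<bar>u\<bar> / \<beta>)) < 1 / 5" using small by linarith
    then show "R_params M 1 \<alpha> \<beta> (1 / (4 * \<beta>))"
      unfolding R_params_def using assms \<beta> 1
        inj_on_cauchy_transform_upper_cone lower_sector_subset_cauchy_transform_image by auto
  qed (rule \<beta>\<^sub>0)
qed

text \<open>G(iy) behaves like -i/y, so it ends up in every sector. This supplies points at which
  inverses belonging to different parameters can be compared.\<close>

lemma cauchy_transform_imaginary_axis_in_sector:
  assumes "\<gamma> > 0" "\<delta> > 0"
  shows "\<exists>Y>0. \<forall>y\<ge>Y. cauchy_transform M (Complex 0 y) \<in> lower_sector \<gamma> \<delta>"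
proof -
  \<comment> \<open>The bound 1/2 forces y Im G < -1/2; the bound \<gamma>/4 then keeps y |Re G|
    below \<gamma> times y |Im G|.\<close>
  define \<eta> where "\<eta> = min (1 / 2) (\<gamma> / 4)"
  have \<eta>: "\<eta> > 0" "\<eta> \<le> 1 / 2" "\<eta> \<le> \<gamma> / 4" using assms by (auto simp: \<eta>_def)
  obtain \<beta> where \<beta>: "\<beta> > 0" "\<And>y. y \<ge> \<beta> \<Longrightarrow> (LINT u|M. min (1 + 1) (\<bar>u\<bar> / y)) < \<eta>"
    using ex_tail_bound[of 1 \<eta>] \<eta>(1) by auto
  show ?thesis
  proof (intro exI[of _ "max \<beta> (2 / \<delta>)"] conjI allI impI)
    fix y assume y: "y \<ge> max \<beta> (2 / \<delta>)"
    then have y0: "y > 0" using \<beta> by auto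
    define g where "g = cauchy_transform M (Complex 0 y)"
    have "cmod (Complex 0 y * g - 1) \<le> (LINT u|M. min (1 + 1) (\<bar>u\<bar> / y))"
      unfolding g_def using y0 by (intro norm_mult_cauchy_transform_minus_1_le) auto
    then have "cmod (Complex 0 y * g - 1) < \<eta>" using \<beta>(2)[of y] y by auto
    moreover have "Re (Complex 0 y * g - 1) = - (y * Im g) - 1" "Im (Complex 0 y * g - 1) = y * Re g" by simp_all
    ultimately have a: "\<bar>- (y * Im g) - 1\<bar> < \<eta>" "\<bar>y * Re g\<bar> < \<eta>"
      using abs_Re_le_cmod[of "Complex 0 y * g - 1"] abs_Im_le_cmod[of "Complex 0 y * g - 1"] by linarith+
    have "\<bar>y * Re g\<bar> = y * \<bar>Re g\<bar>" using y0 by (simp add: abs_mult)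
    then have 1: "y * Im g < - (1 / 2)" "y * \<bar>Re g\<bar> < \<gamma> / 4"
      using \<eta> a by linarith+
    have "y * Im g < 0" using 1 by linarith
    then have Im: "Im g < 0" using y0 by (simp add: mult_less_0_iff)
    have "\<gamma> * (1/2) \<le> \<gamma> * (y * \<bar>Im g\<bar>)" using 1 Im assms by (intro mult_left_mono) auto
    moreover have "\<gamma> / 4 < \<gamma> * (1 / 2)" using assms by simp
    ultimately have "y * \<bar>Re g\<bar> < \<gamma> * (y * \<bar>Im g\<bar>)" using 1(2) by linarith
    then have "y * \<bar>Re g\<bar> < y * (\<gamma> * \<bar>Im g\<bar>)" by (simp only: mult.left_commute)
    then have Re: "\<bar>Re g\<bar> < \<gamma> * \<bar>Im g\<bar>" using y0 by simp
    have "cmod g \<le> 1 / y" unfolding g_def using norm_cauchy_transform_le[of "Complex 0 y"] y0 by simp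
    also have "\<dots> < \<delta>" using y y0 assms by (simp add: divide_less_eq field_simps)
    finally show "cauchy_transform M (Complex 0 y) \<in> lower_sector \<gamma> \<delta>"
      using Im Re by (simp add: lower_sector_def g_def)
  qed (use \<beta> in auto)
qed

lemma R_params_inverse:
  assumes "R_params M \<gamma> \<alpha> \<beta> \<delta>"
  obtains g where "g holomorphic_on lower_sector \<gamma> \<delta>"
    "\<And>z. z \<in> lower_sector \<gamma> \<delta> \<Longrightarrow> g z \<in> upper_cone \<alpha> \<beta> \<and> cauchy_transform M (g z) = z"
    "\<And>w. w \<in> upper_cone \<alpha> \<beta> \<Longrightarrow> g (cauchy_transform M w) = w"
proof -
  have hol: "cauchy_transform M holomorphic_on upper_cone \<alpha> \<beta>"
    by (rule holomorphic_on_subset[OF holomorphic_cauchy_transform]) (auto simp: upper_cone_def)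
  have inj: "inj_on (cauchy_transform M) (upper_cone \<alpha> \<beta>)"
    and sub: "lower_sector \<gamma> \<delta> \<subseteq> cauchy_transform M ` upper_cone \<alpha> \<beta>"
    using assms by (auto simp: R_params_def)
  obtain g where g: "g holomorphic_on (cauchy_transform M ` upper_cone \<alpha> \<beta>)"
    "\<And>w. w \<in> upper_cone \<alpha> \<beta> \<Longrightarrow> g (cauchy_transform M w) = w"
    by (rule holomorphic_has_inverse[OF hol open_upper_cone inj]) metis
  show ?thesis
    by (rule that[OF holomorphic_on_subset[OF g(1) sub]]) (use g(2) sub in auto)
qed

text \<open>Both inverses undo the transform on the image of the common cone. That image is open and
  meets the common sector, by the imaginary axis, so the identity theorem makes the inverses equal
  on the whole common sector. This is what makes the \<open>THE\<close> in
  \<open>cauchy_inverse\<close> well defined.\<close>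

lemma R_params_inverse_unique:
  assumes R: "R_params M \<gamma> \<alpha> \<beta> \<delta>" "R_params M \<gamma>' \<alpha>' \<beta>' \<delta>'"
    and z: "z \<in> lower_sector \<gamma> \<delta>" "z \<in> lower_sector \<gamma>' \<delta>'"
    and w: "w \<in> upper_cone \<alpha> \<beta>" "cauchy_transform M w = z"
    and w': "w' \<in> upper_cone \<alpha>' \<beta>'" "cauchy_transform M w' = z"
  shows "w = w'"
proof -
  obtain g where g: "g holomorphic_on lower_sector \<gamma> \<delta>"
    "\<And>w. w \<in> upper_cone \<alpha> \<beta> \<Longrightarrow> g (cauchy_transform M w) = w"
    using R_params_inverse[OF R(1)] by metis
  obtain h where h: "h holomorphic_on lower_sector \<gamma>' \<delta>'"
    "\<And>w. w \<in> upper_cone \<alpha>' \<beta>' \<Longrightarrow> h (cauchy_transform M w) = w"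
    using R_params_inverse[OF R(2)] by metis
  define S where "S = lower_sector \<gamma> \<delta> \<inter> lower_sector \<gamma>' \<delta>'"
  define C where "C = upper_cone \<alpha> \<beta> \<inter> upper_cone \<alpha>' \<beta>'"
  have pos: "\<gamma> > 0" "\<delta> > 0" "\<gamma>' > 0" "\<delta>' > 0" "\<alpha> > 0" "\<alpha>' > 0" "\<beta> > 0" "\<beta>' > 0"
    using R by (auto simp: R_params_def)
  have "g z = h z"
  proof (rule analytic_continuation_open[where f = g and g = h])
    have "cauchy_transform M holomorphic_on C" "inj_on (cauchy_transform M) C"
      using R unfolding C_def R_params_def
      by (auto intro!: holomorphic_on_subset[OF holomorphic_cauchy_transform] simp: upper_cone_def intro: inj_on_subset)
    then have "open (cauchy_transform M ` C)"
      by (intro open_mapping_thm3) (auto simp: C_def open_upper_cone)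
    then show "open (cauchy_transform M ` C \<inter> S)"
      unfolding S_def by (intro open_Int open_lower_sector)
    show "open S" unfolding S_def by (intro open_Int open_lower_sector)
    show "connected S" unfolding S_def by (intro convex_connected convex_Int convex_lower_sector)
    show "g holomorphic_on S" "h holomorphic_on S"
      using g(1) h(1) by (auto simp: S_def elim: holomorphic_on_subset)
    show "z \<in> S" using z by (simp add: S_def)
    obtain Y where Y: "Y > 0" "\<And>y. y \<ge> Y \<Longrightarrow> cauchy_transform M (Complex 0 y) \<in> S"
      using cauchy_transform_imaginary_axis_in_sector[of "min \<gamma> \<gamma>'" "min \<delta> \<delta>'"] pos
      unfolding S_def lower_sector_Int by auto
    define y where "y = Y + \<beta> + \<beta>'"
    have "Complex 0 y \<in> C" using pos Y(1) by (simp add: C_def upper_cone_def y_def)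
    moreover have "cauchy_transform M (Complex 0 y) \<in> S" using pos by (intro Y(2)) (simp add: y_def)
    ultimately show "cauchy_transform M ` C \<inter> S \<noteq> {}" by blast
    show "g x = h x" if "x \<in> cauchy_transform M ` C \<inter> S" for x
      using that g(2) h(2) by (auto simp: C_def)
  qed (auto simp: S_def)
  then show ?thesis using g(2)[OF w(1)] h(2)[OF w'(1)] w(2) w'(2) by simp
qed

lemma cauchy_inverse_eqI:
  assumes "R_params M \<gamma> \<alpha> \<beta> \<delta>" "z \<in> lower_sector \<gamma> \<delta>" "w \<in> upper_cone \<alpha> \<beta>" "cauchy_transform M w = z"
  shows "cauchy_inverse M z = w"
  unfolding cauchy_inverse_def
proof (rule the_equality)
  show "\<exists>\<gamma> \<alpha> \<beta> \<delta>. R_params M \<gamma> \<alpha> \<beta> \<delta> \<and> z \<in> lower_sector \<gamma> \<delta> \<and> w \<in> upper_cone \<alpha> \<beta> \<and> cauchy_transform M w = z"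
    using assms by blast
next
  fix w' assume "\<exists>\<gamma> \<alpha> \<beta> \<delta>. R_params M \<gamma> \<alpha> \<beta> \<delta> \<and> z \<in> lower_sector \<gamma> \<delta> \<and> w' \<in> upper_cone \<alpha> \<beta> \<and> cauchy_transform M w' = z"
  then show "w' = w" using R_params_inverse_unique assms by blast
qed

lemma cauchy_inverse:
  assumes R: "R_params M \<gamma> \<alpha> \<beta> \<delta>"
  shows cauchy_inverse_holomorphic: "cauchy_inverse M holomorphic_on lower_sector \<gamma> \<delta>"
    and cauchy_inverse_in_upper_cone: "z \<in> lower_sector \<gamma> \<delta> \<Longrightarrow> cauchy_inverse M z \<in> upper_cone \<alpha> \<beta>"
    and cauchy_transform_cauchy_inverse: "z \<in> lower_sector \<gamma> \<delta> \<Longrightarrow> cauchy_transform M (cauchy_inverse M z) = z"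
proof -
  obtain g where g: "g holomorphic_on lower_sector \<gamma> \<delta>"
    "\<And>z. z \<in> lower_sector \<gamma> \<delta> \<Longrightarrow> g z \<in> upper_cone \<alpha> \<beta> \<and> cauchy_transform M (g z) = z"
    using R_params_inverse[OF R] by metis
  have eq: "cauchy_inverse M z = g z" if "z \<in> lower_sector \<gamma> \<delta>" for z
    using that g(2) by (intro cauchy_inverse_eqI[OF R]) auto
  show "cauchy_inverse M holomorphic_on lower_sector \<gamma> \<delta>"
    by (rule holomorphic_transform[OF g(1)]) (simp add: eq)
  show "cauchy_inverse M z \<in> upper_cone \<alpha> \<beta>" "cauchy_transform M (cauchy_inverse M z) = z"
    if "z \<in> lower_sector \<gamma> \<delta>"
    using eq[OF that] g(2)[OF that] by auto
qed

end

section \<open>Characterising the free convolution with a semicircle\<close>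

lemma real_distribution_return: "real_distribution (return borel 0)"
  by (simp add: real_distribution_def real_distribution_axioms_def prob_space_return)

lemma cauchy_transform_return: "cauchy_transform (return borel 0) w = 1 / w"
  unfolding cauchy_transform_def by (subst integral_return) auto

text \<open>If w is the inverse of \<open>M\<close> at \<zeta>, the relation says that
  \<open>N\<close> takes the value \<zeta> at w + t \<zeta>. It remains to see that this point lies
  in a cone on which \<open>N\<close> is injective; the apertures 2 and 3 leave room for the
  shift.\<close>

lemma cauchy_inverse_subordinate:
  fixes t :: real
  assumes "real_distribution M" "real_distribution N" "t > 0"
    and sub: "\<And>w. Im w > B \<Longrightarrow> cauchy_transform N (w + t * cauchy_transform M w) = cauchy_transform M w"
  shows "\<exists>\<delta>>0. \<forall>\<zeta>\<in>lower_sector 1 \<delta>. cauchy_inverse N \<zeta> = cauchy_inverse M \<zeta> + t * \<zeta>"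
proof -
  interpret M: real_distribution M by fact
  interpret N: real_distribution N by fact
  obtain \<beta>\<^sub>1 where \<beta>\<^sub>1: "\<beta>\<^sub>1 > 0" "\<And>\<beta>. \<beta> \<ge> \<beta>\<^sub>1 \<Longrightarrow> R_params M 1 2 \<beta> (1 / (4 * \<beta>))"
    using M.R_params_eventually[of 2] by auto
  obtain \<beta>\<^sub>2 where \<beta>\<^sub>2: "\<beta>\<^sub>2 > 0" "R_params N 1 3 \<beta>\<^sub>2 (1 / (4 * \<beta>\<^sub>2))"
    using N.R_params_eventually[of 3] by auto
  \<comment> \<open>The entry 1 gives |\<zeta>| < 1/4, so the shift has modulus at most t/4. The
    entry \<open>\<beta>\<^sub>2 + t\<close> keeps the shifted point above
    \<open>\<beta>\<^sub>2\<close> and, since then Im w > t, inside aperture 3.\<close>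
  define b where "b = Max {\<beta>\<^sub>1, B, \<beta>\<^sub>2 + t, 1}"
  have b: "b \<ge> \<beta>\<^sub>1" "b \<ge> B" "b \<ge> \<beta>\<^sub>2 + t" "b \<ge> 1" by (auto simp: b_def)
  show ?thesis
  proof (intro exI[of _ "1 / (4 * b)"] conjI ballI)
    show "1 / (4 * b) > 0" using b by simp
    fix \<zeta> assume \<zeta>: "\<zeta> \<in> lower_sector 1 (1 / (4 * b))"
    define w where "w = cauchy_inverse M \<zeta>"
    have R: "R_params M 1 2 b (1 / (4 * b))" using b \<beta>\<^sub>1 by auto
    have w: "w \<in> upper_cone 2 b" "cauchy_transform M w = \<zeta>"
      unfolding w_def by (rule M.cauchy_inverse[OF R] \<zeta>)+
    have "1 / (4 * b) \<le> 1 / (4 * 1)" using b by (intro divide_left_mono) auto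
    then have "cmod (t * \<zeta>) \<le> t / 4"
      using \<zeta> assms(3) by (simp add: norm_mult lower_sector_def)
    define p where "p = t * \<zeta>"
    have "cmod p \<le> t / 4"
      using \<open>cmod (t * \<zeta>) \<le> t / 4\<close> by (simp add: p_def)
    then have "\<bar>Re p\<bar> \<le> t / 4" "\<bar>Im p\<bar> \<le> t / 4"
      using abs_Re_le_cmod[of p] abs_Im_le_cmod[of p] by linarith+
    moreover have "\<bar>Re w\<bar> < 2 * Im w" "Im w > b" using w(1) by (auto simp: upper_cone_def)
    ultimately have "w + p \<in> upper_cone 3 \<beta>\<^sub>2"
      unfolding upper_cone_def plus_complex.sel mem_Collect_eq
      using b \<beta>\<^sub>2(1) assms(3) by auto
    then have "w + t * \<zeta> \<in> upper_cone 3 \<beta>\<^sub>2" by (simp add: p_def)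
    moreover have "\<zeta> \<in> lower_sector 1 (1 / (4 * \<beta>\<^sub>2))"
      using \<zeta> lower_sector_mono[of 1 1 "1 / (4 * b)" "1 / (4 * \<beta>\<^sub>2)"] b \<beta>\<^sub>2(1) assms(3)
      by (auto simp: frac_le)
    moreover have "cauchy_transform N (w + t * \<zeta>) = \<zeta>"
      using sub[of w] w b by (simp add: upper_cone_def)
    ultimately show "cauchy_inverse N \<zeta> = cauchy_inverse M \<zeta> + t * \<zeta>"
      unfolding w_def[symmetric] by (intro N.cauchy_inverse_eqI[OF \<beta>\<^sub>2(2)])
  qed
qed

lemma cauchy_inverse_return:
  "\<exists>\<delta>>0. \<forall>\<zeta>\<in>lower_sector 1 \<delta>. cauchy_inverse (return borel 0) \<zeta> = 1 / \<zeta>"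
proof -
  interpret real_distribution "return borel 0" by (rule real_distribution_return)
  obtain \<beta> where \<beta>: "\<beta> > 0" "R_params (return borel 0) 1 2 \<beta> (1 / (4 * \<beta>))"
    using R_params_eventually[of 2] by auto
  have "cauchy_inverse (return borel 0) \<zeta> = 1 / \<zeta>" if "\<zeta> \<in> lower_sector 1 (1 / (4 * \<beta>))" for \<zeta>
    using cauchy_transform_cauchy_inverse[OF \<beta>(2) that] lower_sector_nonzero[OF that]
    unfolding cauchy_transform_return by (metis inverse_eq_divide inverse_inverse_eq)
  then show ?thesis using \<beta>(1) by (intro exI[of _ "1 / (4 * \<beta>)"]) auto
qed

text \<open>The three sectors containing \<open>z\<close> intersect in a sector again, so one
  connected domain around \<open>z\<close> reaches down to 0.\<close>

lemma R_domain_common_sector: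
  assumes "z \<in> R_domain M \<inter> R_domain N \<inter> R_domain L"
    and "real_distribution M" "real_distribution N" "real_distribution L"
  obtains \<gamma> \<delta> where "\<gamma> > 0" "\<delta> > 0" "z \<in> lower_sector \<gamma> \<delta>"
    "cauchy_inverse M holomorphic_on lower_sector \<gamma> \<delta>"
    "cauchy_inverse N holomorphic_on lower_sector \<gamma> \<delta>"
    "cauchy_inverse L holomorphic_on lower_sector \<gamma> \<delta>"
proof -
  obtain \<gamma>1 \<alpha>1 \<beta>1 \<delta>1 where 1: "R_params M \<gamma>1 \<alpha>1 \<beta>1 \<delta>1" "z \<in> lower_sector \<gamma>1 \<delta>1"
    using assms(1) by (auto simp: R_domain_def)
  obtain \<gamma>2 \<alpha>2 \<beta>2 \<delta>2 where 2: "R_params N \<gamma>2 \<alpha>2 \<beta>2 \<delta>2" "z \<in> lower_sector \<gamma>2 \<delta>2"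
    using assms(1) by (auto simp: R_domain_def)
  obtain \<gamma>3 \<alpha>3 \<beta>3 \<delta>3 where 3: "R_params L \<gamma>3 \<alpha>3 \<beta>3 \<delta>3" "z \<in> lower_sector \<gamma>3 \<delta>3"
    using assms(1) by (auto simp: R_domain_def)
  define \<gamma> where "\<gamma> = min (min \<gamma>1 \<gamma>2) \<gamma>3"
  define \<delta> where "\<delta> = min (min \<delta>1 \<delta>2) \<delta>3"
  have eq: "lower_sector \<gamma> \<delta> = lower_sector \<gamma>1 \<delta>1 \<inter> lower_sector \<gamma>2 \<delta>2 \<inter> lower_sector \<gamma>3 \<delta>3"
    by (simp add: \<gamma>_def \<delta>_def lower_sector_Int)
  show ?thesis
  proof (rule that)
    show "\<gamma> > 0" "\<delta> > 0" using 1 2 3 by (auto simp: \<gamma>_def \<delta>_def R_params_def)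
    show "z \<in> lower_sector \<gamma> \<delta>" using 1 2 3 by (simp add: eq)
    show "cauchy_inverse M holomorphic_on lower_sector \<gamma> \<delta>"
      by (rule holomorphic_on_subset[OF real_distribution.cauchy_inverse_holomorphic[OF assms(2) 1(1)]]) (auto simp: eq)
    show "cauchy_inverse N holomorphic_on lower_sector \<gamma> \<delta>"
      by (rule holomorphic_on_subset[OF real_distribution.cauchy_inverse_holomorphic[OF assms(3) 2(1)]]) (auto simp: eq)
    show "cauchy_inverse L holomorphic_on lower_sector \<gamma> \<delta>"
      by (rule holomorphic_on_subset[OF real_distribution.cauchy_inverse_holomorphic[OF assms(4) 3(1)]]) (auto simp: eq)
  qed
qed

lemma sector_subset_R_domain:
  assumes "real_distribution M"
  shows "\<exists>\<delta>>0. lower_sector 1 \<delta> \<subseteq> R_domain M"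
proof -
  obtain \<beta> where "\<beta> > 0" "R_params M 1 2 \<beta> (1 / (4 * \<beta>))"
    using real_distribution.R_params_eventually[OF assms, of 2] by auto
  then show ?thesis by (intro exI[of _ "1 / (4 * \<beta>)"]) (auto simp: R_domain_def)
qed

lemma R_transform_add_iff:
  "R_transform L z = R_transform M z + R_transform N z \<longleftrightarrow> cauchy_inverse L z = cauchy_inverse M z + (cauchy_inverse N z - 1 / z)"
  by (auto simp: R_transform_def algebra_simps)

text \<open>The common inverse maps a small sector onto an open subset of the upper half-plane, and
  both transforms undo it there. They agree on that set, hence on the half-plane, and the transform
  determines the measure.\<close>

lemma real_distribution_eqI_cauchy_inverse:
  assumes "real_distribution M" "real_distribution N" "\<delta> > 0"
    and "\<And>z. z \<in> lower_sector 1 \<delta> \<Longrightarrow> cauchy_inverse M z = cauchy_inverse N z"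
  shows "M = N"
proof -
  interpret M: real_distribution M by fact
  interpret N: real_distribution N by fact
  obtain \<beta>1 where \<beta>1: "\<beta>1 > 0" "\<And>\<beta>. \<beta> \<ge> \<beta>1 \<Longrightarrow> R_params M 1 2 \<beta> (1 / (4 * \<beta>))"
    using M.R_params_eventually[of 2] by auto
  obtain \<beta>2 where \<beta>2: "\<beta>2 > 0" "\<And>\<beta>. \<beta> \<ge> \<beta>2 \<Longrightarrow> R_params N 1 2 \<beta> (1 / (4 * \<beta>))"
    using N.R_params_eventually[of 2] by auto
  define \<beta> where "\<beta> = max (max \<beta>1 \<beta>2) (1 / (4 * \<delta>))"
  have R: "R_params M 1 2 \<beta> (1 / (4 * \<beta>))" "R_params N 1 2 \<beta> (1 / (4 * \<beta>))"
    using \<beta>1 \<beta>2 by (auto simp: \<beta>_def)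
  have \<beta>: "\<beta> > 0" using \<beta>1 by (auto simp: \<beta>_def)
  have "\<beta> \<ge> 1 / (4 * \<delta>)" by (simp add: \<beta>_def)
  then have "1 / (4 * \<beta>) \<le> \<delta>" using \<beta> assms(3) by (simp add: field_simps)
  define S where "S = lower_sector 1 (1 / (4 * \<beta>))"
  have "S \<subseteq> lower_sector 1 \<delta>" unfolding S_def by (intro lower_sector_mono) (use \<open>1 / (4 * \<beta>) \<le> \<delta>\<close> in auto)
  then have inv_eq: "cauchy_inverse M z = cauchy_inverse N z" if "z \<in> S" for z
    using assms(4) that by blast
  have inj: "inj_on (cauchy_inverse M) S"
    by (rule inj_on_inverseI[of _ "cauchy_transform M"])
      (auto simp: S_def M.cauchy_transform_cauchy_inverse[OF R(1)])
  have hol: "cauchy_inverse M holomorphic_on S"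
    unfolding S_def by (rule M.cauchy_inverse_holomorphic[OF R(1)])
  have op: "open (cauchy_inverse M ` S)"
    by (rule open_mapping_thm3[OF hol _ inj]) (simp add: S_def open_lower_sector)
  have sub: "cauchy_inverse M ` S \<subseteq> {z. Im z > 0}"
    using M.cauchy_inverse_in_upper_cone[OF R(1)] by (auto simp: S_def upper_cone_def)
  have "cauchy_transform M z = cauchy_transform N z" if "Im z > 0" for z
  proof (rule analytic_continuation_open[OF op open_halfspace_Im_gt, where f = "cauchy_transform M" and g = "cauchy_transform N"])
    show "cauchy_inverse M ` S \<noteq> {}"
      using lower_sector_nonempty[of 1 "1 / (4 * \<beta>)"] \<beta> by (simp add: S_def)
    show "cauchy_transform M z = cauchy_transform N z" if "z \<in> cauchy_inverse M ` S" for z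
      using that inv_eq M.cauchy_transform_cauchy_inverse[OF R(1)] N.cauchy_transform_cauchy_inverse[OF R(2)]
      by (auto simp: S_def)
  qed (use sub that M.holomorphic_cauchy_transform N.holomorphic_cauchy_transform
        in \<open>auto intro: convex_connected convex_halfspace_Im_gt\<close>)
  then show ?thesis by (rule cauchy_transform_unique[OF assms(1,2)])
qed

text \<open>Near 0 the two relations say that the R-transform of \<open>S\<close> is t \<zeta> (the
  case of the point mass at 0) and that of \<open>N\<close> exceeds that of \<open>M\<close> by t
  \<zeta>. The identity theorem spreads the resulting equation to all of the common domain, as the
  definition demands; conversely, any competing measure has the same germ at 0 as \<open>N\<close>
  and so equals \<open>N\<close>.\<close>

theorem free_convolution_eqI:
  fixes t :: real
  assumes M: "real_distribution M" and N: "real_distribution N" and S: "real_distribution S" and t: "t > 0"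
    and sub: "\<And>w. Im w > B \<Longrightarrow> cauchy_transform N (w + t * cauchy_transform M w) = cauchy_transform M w"
    and sub': "\<And>w::complex. Im w > B' \<Longrightarrow> cauchy_transform S (w + t / w) = 1 / w"
  shows "M \<boxplus> S = N"
proof -
  obtain \<delta>1 where \<delta>1: "\<delta>1 > 0" "\<And>\<zeta>::complex. \<zeta> \<in> lower_sector 1 \<delta>1 \<Longrightarrow> cauchy_inverse N \<zeta> = cauchy_inverse M \<zeta> + t * \<zeta>"
    using cauchy_inverse_subordinate[OF M N t, of B] sub by auto
  obtain \<delta>2 where \<delta>2: "\<delta>2 > 0" "\<And>\<zeta>::complex. \<zeta> \<in> lower_sector 1 \<delta>2 \<Longrightarrow> cauchy_inverse S \<zeta> = cauchy_inverse (return borel 0) \<zeta> + t * \<zeta>"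
    using cauchy_inverse_subordinate[OF real_distribution_return S t, of B'] sub' by (auto simp: cauchy_transform_return)
  obtain \<delta>3 where \<delta>3: "\<delta>3 > 0" "\<And>\<zeta>::complex. \<zeta> \<in> lower_sector 1 \<delta>3 \<Longrightarrow> cauchy_inverse (return borel 0) \<zeta> = 1 / \<zeta>"
    using cauchy_inverse_return by auto
  define \<delta>0 where "\<delta>0 = min \<delta>1 (min \<delta>2 \<delta>3)"
  have \<delta>0: "\<delta>0 > 0" using \<delta>1 \<delta>2 \<delta>3 by (simp add: \<delta>0_def)
  have sub0: "lower_sector 1 \<delta>0 \<subseteq> lower_sector 1 \<delta>1" "lower_sector 1 \<delta>0 \<subseteq> lower_sector 1 \<delta>2"
    "lower_sector 1 \<delta>0 \<subseteq> lower_sector 1 \<delta>3"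
    unfolding \<delta>0_def by (rule lower_sector_mono; simp)+
  have germ: "cauchy_inverse N z = cauchy_inverse M z + (cauchy_inverse S z - 1 / z)" if "z \<in> lower_sector 1 \<delta>0" for z
  proof -
    have "z \<in> lower_sector 1 \<delta>1" "z \<in> lower_sector 1 \<delta>2" "z \<in> lower_sector 1 \<delta>3"
      using that sub0 by blast+
    then show ?thesis by (simp add: \<delta>1(2) \<delta>2(2) \<delta>3(2))
  qed
  show ?thesis
    unfolding free_convolution_def
  proof (rule the_equality, intro conjI ballI)
    show "real_distribution N" by fact
    fix z assume "z \<in> R_domain M \<inter> R_domain S \<inter> R_domain N"
    then obtain \<gamma> \<delta> where s: "\<gamma> > 0" "\<delta> > 0" "z \<in> lower_sector \<gamma> \<delta>"
      "cauchy_inverse M holomorphic_on lower_sector \<gamma> \<delta>"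
      "cauchy_inverse S holomorphic_on lower_sector \<gamma> \<delta>"
      "cauchy_inverse N holomorphic_on lower_sector \<gamma> \<delta>"
      by (rule R_domain_common_sector[OF _ M S N])
    show "R_transform N z = R_transform M z + R_transform S z"
      unfolding R_transform_add_iff
    proof (rule holomorphic_sector_eqI[of "cauchy_inverse N" \<gamma> \<delta> "\<lambda>z. cauchy_inverse M z + (cauchy_inverse S z - 1 / z)" 1 \<delta>0])
      show "(\<lambda>z. cauchy_inverse M z + (cauchy_inverse S z - 1 / z)) holomorphic_on lower_sector \<gamma> \<delta>"
        using s lower_sector_nonzero by (intro holomorphic_intros) blast
    qed (use s \<delta>0 germ in auto)
  next
    fix L assume L: "real_distribution L \<and> (\<forall>z\<in>R_domain M \<inter> R_domain S \<inter> R_domain L. R_transform L z = R_transform M z + R_transform S z)"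
    then have L1: "real_distribution L" by blast
    obtain \<delta>4 where \<delta>4: "\<delta>4 > 0" "lower_sector 1 \<delta>4 \<subseteq> R_domain M"
      using sector_subset_R_domain[OF M] by blast
    obtain \<delta>5 where \<delta>5: "\<delta>5 > 0" "lower_sector 1 \<delta>5 \<subseteq> R_domain S"
      using sector_subset_R_domain[OF S] by blast
    obtain \<delta>6 where \<delta>6: "\<delta>6 > 0" "lower_sector 1 \<delta>6 \<subseteq> R_domain L"
      using sector_subset_R_domain[OF L1] by blast
    define \<delta> where "\<delta> = min \<delta>0 (min \<delta>4 (min \<delta>5 \<delta>6))"
    have subs: "lower_sector 1 \<delta> \<subseteq> lower_sector 1 \<delta>0" "lower_sector 1 \<delta> \<subseteq> lower_sector 1 \<delta>4"
      "lower_sector 1 \<delta> \<subseteq> lower_sector 1 \<delta>5" "lower_sector 1 \<delta> \<subseteq> lower_sector 1 \<delta>6"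
      unfolding \<delta>_def by (rule lower_sector_mono; simp)+
    show "L = N"
    proof (rule real_distribution_eqI_cauchy_inverse[OF L1 N])
      show "\<delta> > 0" using \<delta>0 \<delta>4 \<delta>5 \<delta>6 by (simp add: \<delta>_def)
      fix z assume z: "z \<in> lower_sector 1 \<delta>"
      then have "z \<in> R_domain M \<inter> R_domain S \<inter> R_domain L"
        using subs \<delta>4 \<delta>5 \<delta>6 by blast
      then have "R_transform L z = R_transform M z + R_transform S z" using L by blast
      moreover have "z \<in> lower_sector 1 \<delta>0" using subs(1) z by blast
      ultimately show "cauchy_inverse L z = cauchy_inverse N z"
        unfolding R_transform_add_iff by (simp add: germ)
    qed
  qed
qed

section \<open>The subordination function\<close>

text \<open>The left-hand side of the identity is the squared modulus of the difference of
  \<open>1 / a\<close> and \<open>cnj (1 / b)\<close>.\<close>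

lemma resolvent_identity:
  assumes "a \<noteq> 0" "b \<noteq> 0"
  shows "1 / (cmod a)\<^sup>2 + 1 / (cmod b)\<^sup>2 - 2 * Re (1 / (a * b)) = (cmod (a - cnj b))\<^sup>2 / ((cmod a)\<^sup>2 * (cmod b)\<^sup>2)"
proof -
  have "Re (1 / (a * b)) = Re (a * b) / ((cmod a)\<^sup>2 * (cmod b)\<^sup>2)"
    by (simp only: Re_divide cmod_power2[symmetric] norm_mult power_mult_distrib) simp
  moreover have "(cmod (a - cnj b))\<^sup>2 = (cmod a)\<^sup>2 + (cmod b)\<^sup>2 - 2 * Re (a * b)"
    unfolding cmod_power2 by (simp add: power2_eq_square algebra_simps)
  ultimately show ?thesis
    using assms by (simp add: diff_divide_distrib add_divide_distrib)
qed

locale semicircular_flow = real_distribution M for M +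
  fixes t :: real
  assumes t_pos: "t > 0"
    and integrable_square: "integrable M (\<lambda>u. u\<^sup>2)"
begin

definition H :: "complex \<Rightarrow> complex" where
  "H w = w + t * cauchy_transform M w"

definition \<Omega> :: "complex set" where
  "\<Omega> = {w. Im w > 0 \<and> t * energy M w < 1}"

text \<open>A lower bound for the integral of 1/(|w - u|^2 |w' - u|^2) over all w, w' of modulus at
  most R. The fourth power is two squared distances, each distance being at most R + |u|.\<close>

definition hoelder_const :: "real \<Rightarrow> real" where
  "hoelder_const R = (LINT u|M. 1 / (R + \<bar>u\<bar>) ^ 4)"

lemma Omega_Im: "w \<in> \<Omega> \<Longrightarrow> Im w > 0"
  and Omega_energy: "w \<in> \<Omega> \<Longrightarrow> t * energy M w < 1"
  by (auto simp: \<Omega>_def)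

lemma Omega_energy_le: "w \<in> \<Omega> \<Longrightarrow> energy M w \<le> 1 / t"
  using Omega_energy[of w] t_pos by (simp add: field_simps)

lemma Im_H: "Im w > 0 \<Longrightarrow> Im (H w) = Im w * (1 - t * energy M w)"
  by (simp add: H_def Im_cauchy_transform algebra_simps)

lemma Omega_iff_Im_H: "w \<in> \<Omega> \<longleftrightarrow> Im w > 0 \<and> Im (H w) > 0"
  using Im_H[of w] by (auto simp: \<Omega>_def zero_less_mult_iff)

lemma holomorphic_H: "H holomorphic_on {w. Im w > 0}"
  unfolding H_def by (intro holomorphic_intros holomorphic_cauchy_transform)

lemma open_Omega: "open \<Omega>"
proof -
  have "continuous_on {w. Im w > 0} (\<lambda>w. Im (H w))"
    by (intro continuous_intros holomorphic_on_imp_continuous_on holomorphic_H)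
  then have "open ({w. Im w > 0} \<inter> (\<lambda>w. Im (H w)) -` {0<..})"
    by (rule continuous_open_preimage) (auto simp: open_halfspace_Im_gt)
  also have "{w. Im w > 0} \<inter> (\<lambda>w. Im (H w)) -` {0<..} = \<Omega>"
    by (auto simp: Omega_iff_Im_H)
  finally show ?thesis .
qed

text \<open>In effect Cauchy-Schwarz, |G|^2 \<le> I < 1/t, carried out as the pointwise inequality 2
  sqrt t r \<le> t r^2 + 1 under the integral.\<close>

lemma norm_cauchy_transform_Omega_le:
  assumes "w \<in> \<Omega>"
  shows "cmod (cauchy_transform M w) \<le> 1 / sqrt t"
proof -
  have Im: "Im w > 0" by (rule Omega_Im[OF assms])
  have "cmod (cauchy_transform M w) \<le> (LINT u|M. (t * (1 / (cmod (w - complex_of_real u))\<^sup>2) + 1) / (2 * sqrt t))"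
    unfolding cauchy_transform_def
  proof (rule norm_integral_le_integral)
    fix u
    define r where "r = cmod (1 / (w - complex_of_real u))"
    have "0 \<le> (sqrt t * r - 1)\<^sup>2" by simp
    then have "2 * sqrt t * r \<le> t * r\<^sup>2 + 1"
      using t_pos by (simp add: power2_diff power_mult_distrib algebra_simps)
    then have "r \<le> (t * r\<^sup>2 + 1) / (2 * sqrt t)"
      using t_pos by (simp add: field_simps)
    then show "cmod (1 / (w - complex_of_real u)) \<le> (t * (1 / (cmod (w - complex_of_real u))\<^sup>2) + 1) / (2 * sqrt t)"
      by (simp add: r_def norm_divide power_divide)
  qed (intro integrable_divide Bochner_Integration.integrable_add integrable_mult_right integrable_energy Im, simp)
  also have "\<dots> = (t * energy M w + 1) / (2 * sqrt t)"
    unfolding energy_def integral_divide_zero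
    by (subst Bochner_Integration.integral_add, intro integrable_mult_right integrable_energy Im, simp)
       (simp only: integral_mult_right_zero, simp add: prob_UNIV)
  also have "\<dots> \<le> 2 / (2 * sqrt t)"
    using Omega_energy[OF assms] t_pos by (intro divide_right_mono) auto
  finally show ?thesis by simp
qed

definition moment_bound :: real where
  "moment_bound = ((LINT u|M. u\<^sup>2) + 1 / t) / 2"

text \<open>w G(w) - 1 is the integral of u/(w - u), and the arithmetic-geometric mean inequality
  splits this into u^2 and the energy kernel. Here the finite second moment enters.\<close>

lemma norm_mult_cauchy_transform_Omega_le:
  assumes "w \<in> \<Omega>"
  shows "cmod (w * cauchy_transform M w) \<le> moment_bound + 1"
proof -
  have Im: "Im w > 0" by (rule Omega_Im[OF assms])
  have "w * cauchy_transform M w - 1 = (CLINT u|M. w * (1 / (w - complex_of_real u))) - (CLINT u|M. 1)"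
    unfolding cauchy_transform_def by (simp only: integral_mult_right_zero) (simp add: prob_UNIV)
  also have "\<dots> = (CLINT u|M. w * (1 / (w - complex_of_real u)) - 1)"
    by (intro Bochner_Integration.integral_diff[symmetric] integrable_mult_right integrable_resolvent Im) simp
  also have "\<dots> = (CLINT u|M. complex_of_real u / (w - complex_of_real u))"
    using diff_of_real_nonzero[OF Im] by (intro Bochner_Integration.integral_cong refl) (simp add: field_simps)
  also have "cmod \<dots> \<le> (LINT u|M. (u\<^sup>2 + 1 / (cmod (w - complex_of_real u))\<^sup>2) / 2)"
  proof (rule norm_integral_le_integral)
    fix u
    define r where "r = 1 / cmod (w - complex_of_real u)"
    have "\<bar>u\<bar> * r \<le> (\<bar>u\<bar>\<^sup>2 + r\<^sup>2) / 2"
      using sum_squares_bound[of "\<bar>u\<bar>" r] by simp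
    then show "cmod (complex_of_real u / (w - complex_of_real u)) \<le> (u\<^sup>2 + 1 / (cmod (w - complex_of_real u))\<^sup>2) / 2"
      by (simp add: r_def norm_divide power_divide)
  qed (use integrable_energy[OF Im] integrable_square in auto)
  also have "\<dots> = ((LINT u|M. u\<^sup>2) + energy M w) / 2"
    unfolding energy_def using integrable_energy[OF Im] integrable_square by simp
  also have "\<dots> \<le> moment_bound"
    unfolding moment_bound_def using Omega_energy_le[OF assms] by simp
  finally have "cmod (w * cauchy_transform M w - 1) \<le> moment_bound" .
  then show ?thesis
    using norm_triangle_ineq2[of "w * cauchy_transform M w" 1] by simp
qed

lemma moment_bound_nonneg: "moment_bound \<ge> 0"
  unfolding moment_bound_def using t_pos by (intro divide_nonneg_nonneg add_nonneg_nonneg integral_nonneg_AE) auto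

lemma integrable_hoelder_const:
  assumes "R > 0"
  shows "integrable M (\<lambda>u. 1 / (R + \<bar>u\<bar>) ^ 4)"
proof (rule integrable_bounded)
  show "norm (1 / (R + \<bar>u\<bar>) ^ 4) \<le> 1 / R ^ 4" for u
  proof -
    have "R ^ 4 \<le> (R + \<bar>u\<bar>) ^ 4" using assms by (intro power_mono) auto
    then show ?thesis using assms by (auto simp: abs_of_pos intro!: divide_left_mono mult_pos_pos zero_less_power)
  qed
qed measurable

lemma hoelder_const_pos:
  assumes "R > 0"
  shows "hoelder_const R > 0"
  unfolding hoelder_const_def
  using assms by (intro expectation_greater integrable_hoelder_const AE_I2 divide_pos_pos zero_less_power) auto

text \<open>H(w) - H(w') = (w - w')(1 - t J). As both energies are at most 1/t, (2/t) Re (1 - t J)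
  is at least the sum of the energies minus 2 Re J, which by \<open>resolvent_identity\<close> is an
  integral with numerator |w - cnj w'|^2. Both points being in the upper half-plane, this numerator
  is at least |w - w'|^2; together with the factor w - w' it gives the cube.\<close>

lemma hoelder_H:
  assumes w: "w \<in> \<Omega>" "w' \<in> \<Omega>" and R: "cmod w \<le> R" "cmod w' \<le> R"
  shows "hoelder_const R * cmod (w - w') ^ 3 \<le> 2 / t * cmod (H w - H w')"
proof -
  have Im: "Im w > 0" "Im w' > 0" using w Omega_Im by auto
  have "cmod w > 0" using Im by auto
  then have R0: "R > 0" using R by linarith
  define d where "d = cmod (w - w')"
  define J where "J = (CLINT u|M. 1 / ((w - complex_of_real u) * (w' - complex_of_real u)))"
  have "H w - H w' = (w - w') + t * (cauchy_transform M w - cauchy_transform M w')"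
    by (simp add: H_def algebra_simps)
  then have HH: "H w - H w' = (w - w') * (1 - t * J)"
    unfolding cauchy_transform_diff[OF Im] J_def[symmetric] by (simp add: algebra_simps)
  have Re_J: "Re J = (LINT u|M. Re (1 / ((w - complex_of_real u) * (w' - complex_of_real u))))"
    unfolding J_def by (rule integral_Re[OF integrable_resolvent_mult[OF Im], symmetric])
  have int_J: "integrable M (\<lambda>u. Re (1 / ((w - complex_of_real u) * (w' - complex_of_real u))))"
    by (intro integrable_Re integrable_resolvent_mult Im)
  have dle: "d \<le> cmod (w - cnj w')"
    unfolding d_def using Im
    by (auto simp: cmod_def intro!: real_sqrt_le_mono power2_le_iff_abs_le[THEN iffD2] add_mono)
  have "d\<^sup>2 * hoelder_const R = (LINT u|M. d\<^sup>2 * (1 / (R + \<bar>u\<bar>) ^ 4))"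
    unfolding hoelder_const_def by (rule integral_mult_right_zero[symmetric])
  also have "\<dots> \<le> (LINT u|M. 1 / (cmod (w - complex_of_real u))\<^sup>2 + 1 / (cmod (w' - complex_of_real u))\<^sup>2
      - 2 * Re (1 / ((w - complex_of_real u) * (w' - complex_of_real u))))"
  proof (rule integral_mono)
    fix u
    let ?a = "w - complex_of_real u" and ?b = "w' - complex_of_real u"
    have nz: "?a \<noteq> 0" "?b \<noteq> 0" using Im by (auto intro!: diff_of_real_nonzero simp del: right_minus_eq)
    have "cmod ?a \<le> R + \<bar>u\<bar>" "cmod ?b \<le> R + \<bar>u\<bar>"
      using norm_triangle_ineq4[of w "complex_of_real u"] norm_triangle_ineq4[of w' "complex_of_real u"] R by auto
    then have "(cmod ?a)\<^sup>2 * (cmod ?b)\<^sup>2 \<le> (R + \<bar>u\<bar>)\<^sup>2 * (R + \<bar>u\<bar>)\<^sup>2"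
      using R0 by (intro mult_mono power_mono) auto
    also have "\<dots> = (R + \<bar>u\<bar>) ^ 4" by (simp flip: power_add)
    finally have "d\<^sup>2 / (R + \<bar>u\<bar>) ^ 4 \<le> (cmod (w - cnj w'))\<^sup>2 / ((cmod ?a)\<^sup>2 * (cmod ?b)\<^sup>2)"
      using nz dle by (intro frac_le power_mono) (auto simp: d_def)
    also have "w - cnj w' = ?a - cnj ?b" by simp
    also have "(cmod (?a - cnj ?b))\<^sup>2 / ((cmod ?a)\<^sup>2 * (cmod ?b)\<^sup>2) = 1 / (cmod ?a)\<^sup>2 + 1 / (cmod ?b)\<^sup>2 - 2 * Re (1 / (?a * ?b))"
      by (rule resolvent_identity[OF nz, symmetric])
    finally show "d\<^sup>2 * (1 / (R + \<bar>u\<bar>) ^ 4) \<le> 1 / (cmod ?a)\<^sup>2 + 1 / (cmod ?b)\<^sup>2 - 2 * Re (1 / (?a * ?b))"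
      by simp
  qed (intro integrable_mult_right integrable_hoelder_const R0 Bochner_Integration.integrable_diff
      Bochner_Integration.integrable_add integrable_energy Im int_J)+
  also have "\<dots> = energy M w + energy M w' - 2 * Re J"
    unfolding Re_J energy_def using integrable_energy[OF Im(1)] integrable_energy[OF Im(2)] int_J by simp
  also have "\<dots> \<le> 2 / t - 2 * Re J"
    using Omega_energy_le[OF w(1)] Omega_energy_le[OF w(2)] by simp
  also have "\<dots> = 2 / t * Re (1 - t * J)"
    using t_pos by (simp add: algebra_simps)
  also have "\<dots> \<le> 2 / t * cmod (1 - t * J)"
    using t_pos by (intro mult_left_mono complex_Re_le_cmod) auto
  finally have "d * (d\<^sup>2 * hoelder_const R) \<le> d * (2 / t * cmod (1 - t * J))"
    by (intro mult_left_mono) (auto simp: d_def)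
  then show ?thesis
    unfolding HH norm_mult d_def by (simp add: power3_eq_cube power2_eq_square algebra_simps)
qed

lemma inj_on_H: "inj_on H \<Omega>"
proof (rule inj_onI)
  fix w w' assume w: "w \<in> \<Omega>" "w' \<in> \<Omega>" "H w = H w'"
  define R where "R = max (cmod w) (cmod w')"
  have "R > 0" using Omega_Im[OF w(1)] by (auto simp: R_def less_max_iff_disj)
  have "hoelder_const R * cmod (w - w') ^ 3 \<le> 0"
    using hoelder_H[OF w(1,2), of R] w(3) by (simp add: R_def)
  then show "w = w'"
    using hoelder_const_pos[OF \<open>R > 0\<close>] by (simp add: mult_le_0_iff power_le_zero_eq)
qed

text \<open>A preimage of \<open>z\<close> under \<open>H\<close> is a fixed point of \<open>\<lambda>w. z - t * cauchy_transform M w\<close>,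
  which maps the part of a disc around \<open>z\<close> above the height of \<open>z\<close> into itself.\<close>

lemma ex_Omega_H_eq:
  assumes z: "Im z > 0"
  shows "\<exists>w\<in>\<Omega>. H w = z"
proof -
  define K where "K = {w. Im w \<ge> Im z} \<inter> cball z (t / Im z)"
  define T where "T = (\<lambda>w. z - t * cauchy_transform M w)"
  have K_sub: "K \<subseteq> {w. Im w > 0}" using z by (auto simp: K_def)
  have "compact K"
    unfolding K_def by (intro closed_Int_compact closed_halfspace_Im_ge compact_cball)
  moreover have "convex K"
    unfolding K_def by (intro convex_Int convex_halfspace_Im_ge convex_cball)
  moreover have "z \<in> K" using z t_pos by (simp add: K_def)
  moreover have "continuous_on K T"
    unfolding T_def using K_sub
    by (intro continuous_intros holomorphic_on_imp_continuous_on holomorphic_on_subset[OF holomorphic_cauchy_transform])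
  moreover have "T \<in> K \<rightarrow> K"
  proof
    fix w assume w: "w \<in> K"
    then have Im: "Im w > 0" "Im w \<ge> Im z" using K_sub by (auto simp: K_def)
    have "cmod (cauchy_transform M w) \<le> 1 / Im w" by (rule norm_cauchy_transform_le[OF Im(1)])
    also have "\<dots> \<le> 1 / Im z" using Im z by (intro divide_left_mono) auto
    finally have "t * cmod (cauchy_transform M w) \<le> t * (1 / Im z)"
      using t_pos by (intro mult_left_mono) auto
    then have "T w \<in> cball z (t / Im z)" using t_pos by (simp add: T_def dist_norm norm_mult)
    moreover have "Im (T w) = Im z + t * (Im w * energy M w)"
      by (simp add: T_def Im_cauchy_transform[OF Im(1)])
    ultimately show "T w \<in> K" using Im t_pos energy_nonneg by (simp add: K_def)
  qed
  ultimately obtain w where w: "w \<in> K" "T w = w"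
    using brouwer[of K T] by blast
  then have "H w = z" by (simp add: T_def H_def algebra_simps)
  moreover have "w \<in> \<Omega>" using w K_sub z \<open>H w = z\<close> by (auto simp: Omega_iff_Im_H)
  ultimately show ?thesis by blast
qed

lemma H_image_Omega: "H ` \<Omega> = {z. Im z > 0}"
  using ex_Omega_H_eq by (force simp: Omega_iff_Im_H)

definition \<omega> :: "complex \<Rightarrow> complex" where
  "\<omega> = the_inv_into \<Omega> H"

lemma omega_H: "w \<in> \<Omega> \<Longrightarrow> \<omega> (H w) = w"
  unfolding \<omega>_def by (rule the_inv_into_f_f[OF inj_on_H])

lemma omega_in_Omega: "Im z > 0 \<Longrightarrow> \<omega> z \<in> \<Omega>"
  unfolding \<omega>_def by (rule the_inv_into_into[OF inj_on_H]) (auto simp: H_image_Omega)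

lemma H_omega: "Im z > 0 \<Longrightarrow> H (\<omega> z) = z"
  unfolding \<omega>_def by (rule f_the_inv_into_f[OF inj_on_H]) (auto simp: H_image_Omega)

lemma holomorphic_omega: "\<omega> holomorphic_on {z. Im z > 0}"
proof -
  have "H holomorphic_on \<Omega>"
    by (rule holomorphic_on_subset[OF holomorphic_H]) (auto simp: Omega_Im)
  then obtain g where g: "g holomorphic_on (H ` \<Omega>)" "\<And>w. w \<in> \<Omega> \<Longrightarrow> g (H w) = w"
    by (rule holomorphic_has_inverse[OF _ open_Omega inj_on_H]) metis
  show ?thesis
  proof (rule holomorphic_transform)
    show "g holomorphic_on {z. Im z > 0}" using g(1) by (simp add: H_image_Omega)
    show "g z = \<omega> z" if "z \<in> {z. Im z > 0}" for z
      using that g(2)[OF omega_in_Omega[of z]] by (simp add: H_omega)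
  qed
qed

lemma Im_omega_pos: "Im z > 0 \<Longrightarrow> Im (\<omega> z) > 0"
  using Omega_Im omega_in_Omega by blast

lemma omega_eq: "Im z > 0 \<Longrightarrow> \<omega> z = z - t * cauchy_transform M (\<omega> z)"
  using H_omega[of z] by (simp add: H_def algebra_simps)

lemma Im_omega_ge:
  assumes "Im z > 0"
  shows "Im (\<omega> z) \<ge> Im z"
proof -
  have "Im (\<omega> z) = Im z + t * (Im (\<omega> z) * energy M (\<omega> z))"
    using arg_cong[OF omega_eq[OF assms], of Im] Im_cauchy_transform[OF Im_omega_pos[OF assms]] by simp
  moreover have "t * (Im (\<omega> z) * energy M (\<omega> z)) \<ge> 0"
    using t_pos energy_nonneg Im_omega_pos[OF assms] by simp
  ultimately show ?thesis by linarith
qed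

lemma norm_omega_diff_le:
  assumes "Im z > 0"
  shows "cmod (\<omega> z - z) \<le> sqrt t"
proof -
  have "cmod (\<omega> z - z) = t * cmod (cauchy_transform M (\<omega> z))"
    using arg_cong[OF omega_eq[OF assms], of "\<lambda>w. cmod (w - z)"] t_pos by (simp add: norm_mult)
  also have "\<dots> \<le> t * (1 / sqrt t)"
    using t_pos by (intro mult_left_mono norm_cauchy_transform_Omega_le omega_in_Omega assms) auto
  also have "\<dots> = sqrt t" using t_pos by (simp add: real_div_sqrt)
  finally show ?thesis .
qed

definition g :: "complex \<Rightarrow> complex" where
  "g z = cauchy_transform M (\<omega> z)"

lemma holomorphic_g: "g holomorphic_on {z. Im z > 0}"
  unfolding g_def
  by (rule holomorphic_on_compose_gen[OF holomorphic_omega holomorphic_cauchy_transform, unfolded o_def])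
     (auto simp: Im_omega_pos)

lemma norm_g_le: "Im z > 0 \<Longrightarrow> cmod (g z) \<le> 1 / sqrt t"
  unfolding g_def by (intro norm_cauchy_transform_Omega_le omega_in_Omega)

lemma norm_mult_g_le:
  assumes "Im z > 0"
  shows "cmod (z * g z) \<le> moment_bound + 2"
proof -
  have "z * g z = \<omega> z * g z - (\<omega> z - z) * g z" by (simp add: algebra_simps)
  also have "cmod \<dots> \<le> cmod (\<omega> z * g z) + cmod (\<omega> z - z) * cmod (g z)"
    by (metis norm_mult norm_triangle_ineq4)
  also have "\<dots> \<le> (moment_bound + 1) + sqrt t * (1 / sqrt t)"
    using norm_mult_cauchy_transform_Omega_le[OF omega_in_Omega[OF assms]] t_pos
    by (intro add_mono mult_mono norm_omega_diff_le norm_g_le assms) (auto simp: g_def)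
  finally show ?thesis using t_pos by simp
qed

definition decay_const :: real where
  "decay_const = 1 / sqrt t + moment_bound + 2"

lemma decay_const_pos: "decay_const > 0"
  using t_pos moment_bound_nonneg by (simp add: decay_const_def add_pos_nonneg)

text \<open>The sum of the bounds for |g| and |z g|. It does not deteriorate near the real line, so
  it survives the passage to boundary values.\<close>

lemma norm_g_decay:
  assumes "Im z > 0"
  shows "cmod (g z) \<le> decay_const / (1 + cmod z)"
proof -
  have "(1 + cmod z) * cmod (g z) \<le> decay_const"
    using norm_g_le[OF assms] norm_mult_g_le[OF assms] by (simp add: decay_const_def norm_mult algebra_simps)
  moreover have "1 + cmod z > 0" by (simp add: add_pos_nonneg)
  ultimately show ?thesis by (simp add: field_simps)
qed

lemma Im_g_eq: "Im z > 0 \<Longrightarrow> Im (\<omega> z) = Im z - t * Im (g z)"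
  using arg_cong[OF omega_eq, of z Im] by (simp add: g_def)

lemma hoelder_omega:
  assumes "Im z > 0" "Im z' > 0" "cmod z \<le> R" "cmod z' \<le> R"
  shows "hoelder_const (R + sqrt t) * cmod (\<omega> z - \<omega> z') ^ 3 \<le> 2 / t * cmod (z - z')"
proof -
  have "cmod (\<omega> v) \<le> R + sqrt t" if "Im v > 0" "cmod v \<le> R" for v
    using norm_omega_diff_le[OF that(1)] norm_triangle_ineq2[of "\<omega> v" v] that(2) by simp
  then show ?thesis
    using hoelder_H[OF omega_in_Omega[OF assms(1)] omega_in_Omega[OF assms(2)], of "R + sqrt t"] assms
    by (simp add: H_omega)
qed

end

section \<open>Cauchy's formula in the half-plane\<close>

lemma norm_inverse_real_diff_le:
  assumes "Im z \<noteq> 0"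
  shows "cmod (1 / (complex_of_real s - z)) \<le> ((1 + cmod z) / \<bar>Im z\<bar> + 1) / (1 + \<bar>s\<bar>)"
proof -
  have nz: "complex_of_real s - z \<noteq> 0" using assms by auto
  have Im: "\<bar>Im z\<bar> \<le> cmod (complex_of_real s - z)"
    using abs_Im_le_cmod[of "complex_of_real s - z"] by simp
  have "1 + cmod z = (1 + cmod z) / \<bar>Im z\<bar> * \<bar>Im z\<bar>" using assms by simp
  also have "\<dots> \<le> (1 + cmod z) / \<bar>Im z\<bar> * cmod (complex_of_real s - z)"
    by (rule mult_left_mono[OF Im]) (simp add: add_nonneg_nonneg)
  finally have "1 + \<bar>s\<bar> \<le> ((1 + cmod z) / \<bar>Im z\<bar> + 1) * cmod (complex_of_real s - z)"
    using norm_triangle_ineq2[of "complex_of_real s" z] by (simp add: algebra_simps)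
  moreover have "cmod (complex_of_real s - z) > 0" using nz by simp
  moreover have "1 + \<bar>s\<bar> > 0" by simp
  ultimately show ?thesis
    by (simp add: norm_divide divide_simps)
qed

lemma decay_product_le:
  fixes s :: real
  assumes "0 \<le> K" "a \<le> C / (1 + \<bar>s\<bar>)" "b \<le> K / (1 + \<bar>s\<bar>)" "0 \<le> a" "0 \<le> b"
  shows "a * b \<le> C * K * (1 / (1 + s\<^sup>2))"
proof -
  have s: "1 + \<bar>s\<bar> > 0" by simp
  have C: "0 \<le> C" using assms(2,4) s by (simp add: pos_le_divide_eq) (smt (verit) mult_nonneg_nonneg)
  have "a * b \<le> (C / (1 + \<bar>s\<bar>)) * (K / (1 + \<bar>s\<bar>))"
    using assms C s by (intro mult_mono) auto
  also have "\<dots> = C * K / (1 + \<bar>s\<bar>)\<^sup>2" by (simp add: power2_eq_square)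
  also have "\<dots> \<le> C * K / (1 + s\<^sup>2)"
    using assms(1) C s by (intro divide_left_mono mult_nonneg_nonneg mult_pos_pos)
      (auto simp: power2_sum add_pos_nonneg)
  finally show ?thesis by simp
qed

lemma integrable_decay_divide:
  fixes f :: "real \<Rightarrow> complex"
  assumes "f \<in> borel_measurable lborel" "\<And>s. cmod (f s) \<le> C / (1 + \<bar>s\<bar>)" "Im z \<noteq> 0"
  shows "integrable lborel (\<lambda>s. f s / (complex_of_real s - z))"
proof (rule Bochner_Integration.integrable_bound)
  define K where "K = (1 + cmod z) / \<bar>Im z\<bar> + 1"
  show "integrable lborel (\<lambda>s. C * K * (1 / (1 + s\<^sup>2)))"
    by (intro integrable_mult_right integrable_inverse_1_plus_square_lborel)
  have "cmod (f s / (complex_of_real s - z)) \<le> C * K * (1 / (1 + s\<^sup>2))" for s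
  proof -
    have "K \<ge> 0" by (simp add: K_def add_nonneg_nonneg)
    from decay_product_le[OF this assms(2) norm_inverse_real_diff_le[OF assms(3), folded K_def]]
    show ?thesis by (simp add: norm_divide norm_mult)
  qed
  then show "AE s in lborel. norm (f s / (complex_of_real s - z)) \<le> norm (C * K * (1 / (1 + s\<^sup>2)))"
    by (intro AE_I2) (metis abs_ge_self order_trans real_norm_def)
qed (use assms(1) in measurable)

lemma integral_symmetric_interval_tendsto:
  fixes h :: "real \<Rightarrow> complex"
  assumes "integrable lborel h"
  shows "(\<lambda>n. integral {- real n..real n} h) \<longlonglongrightarrow> integral\<^sup>L lborel h"
proof -
  have "(\<lambda>n. LINT x|lborel. indicator {- real n..real n} x *\<^sub>R h x) \<longlonglongrightarrow> integral\<^sup>L lborel h"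
  proof (rule integral_dominated_convergence)
    show "integrable lborel (\<lambda>x. norm (h x))" using assms by (rule integrable_norm)
    show "AE x in lborel. (\<lambda>n. indicator {- real n..real n} x *\<^sub>R h x) \<longlonglongrightarrow> h x"
    proof (intro AE_I2 tendsto_eventually)
      fix x :: real
      obtain N where "\<bar>x\<bar> \<le> real N" using real_arch_simple by blast
      then show "\<forall>\<^sub>F n in sequentially. indicator {- real n..real n} x *\<^sub>R h x = h x"
        by (intro eventually_sequentiallyI[of N]) (auto simp: indicator_def)
    qed
    show "AE x in lborel. norm (indicator {- real n..real n} x *\<^sub>R h x) \<le> norm (h x)" for n
      by (intro AE_I2) (auto simp: indicator_def)
  qed (use assms in measurable)
  moreover have "(LINT x|lborel. indicator {- real n..real n} x *\<^sub>R h x) = integral {- real n..real n} h" for n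
  proof -
    have "set_integrable lborel {- real n..real n} h"
      unfolding set_integrable_def by (rule integrable_mult_indicator[OF _ assms]) simp
    then show ?thesis
      using set_borel_integral_eq_integral(2) by (simp add: set_lebesgue_integral_def)
  qed
  ultimately show ?thesis by simp
qed

text \<open>Cauchy's formula on the rectangle with corners -n and n + i n: on the three sides off
  the real line the integrand is of order 1/n^2, while their length is of order n. The case of z in
  the lower half-plane is included because the Poisson formula applies it to the conjugate
  point.\<close>

lemma half_plane_cauchy_integral:
  fixes f :: "complex \<Rightarrow> complex"
  assumes hol: "f holomorphic_on {z. Im z > - e}" and e: "e > 0"
    and bound: "\<And>z. Im z \<ge> 0 \<Longrightarrow> cmod (f z) \<le> C / (1 + cmod z)"
    and z: "Im z \<noteq> 0"
  shows "(CLINT s|lborel. f (complex_of_real s) / (complex_of_real s - z)) = (if Im z > 0 then 2 * pi * \<i> * f z else 0)"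
proof -
  define h where "h = (\<lambda>w. f w / (w - z))"
  define V where "V = (if Im z > 0 then 2 * pi * \<i> * f z else 0)"
  have C: "C \<ge> 0" using order_trans[OF norm_ge_zero bound[of 0]] by simp
  have cont: "continuous_on ({w. Im w \<ge> 0} - {z}) h"
    unfolding h_def using e
    by (intro continuous_intros holomorphic_on_imp_continuous_on holomorphic_on_subset[OF hol]) auto
  have cont_R: "continuous_on UNIV (\<lambda>s. f (complex_of_real s))"
    by (rule continuous_on_compose2[OF holomorphic_on_imp_continuous_on[OF hol]])
       (use e in \<open>auto intro!: continuous_intros\<close>)
  have int: "integrable lborel (\<lambda>s. f (complex_of_real s) / (complex_of_real s - z))"
  proof (rule integrable_decay_divide[OF _ _ z])
    show "(\<lambda>s. f (complex_of_real s)) \<in> borel_measurable lborel"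
      using borel_measurable_continuous_onI[OF cont_R] by simp
    show "cmod (f (complex_of_real s)) \<le> C / (1 + \<bar>s\<bar>)" for s
      using bound[of "complex_of_real s"] by simp
  qed
  \<comment> \<open>The three remaining sides have total length 4 n, which accounts for a factor 4;
    6 leaves room.\<close>
  have est: "cmod (V - integral {- real n..real n} (\<lambda>s. h (complex_of_real s))) \<le> 6 * C / (real n - cmod z)"
    if n: "real n > cmod z" for n
  proof -
    define r where "r = real n"
    have r: "r > cmod z" "r > 0" using n norm_ge_zero[of z] unfolding r_def by linarith+
    define a where "a = Complex (- r) 0"
    define b where "b = Complex r 0"
    define c where "c = Complex r r"
    define d where "d = Complex (- r) r"
    have path: "rectpath a c = linepath a b +++ linepath b c +++ linepath c d +++ linepath d a"
      by (simp add: rectpath_def a_def b_def c_def d_def Let_def)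
    have Imz: "\<bar>Re z\<bar> < r" "\<bar>Im z\<bar> < r"
      using abs_Re_le_cmod[of z] abs_Im_le_cmod[of z] r by linarith+
    have segs: "closed_segment a b \<subseteq> {w. Im w \<ge> 0} - {z}"
      "closed_segment b c \<subseteq> {w. Im w \<ge> 0 \<and> cmod w \<ge> r}"
      "closed_segment c d \<subseteq> {w. Im w \<ge> 0 \<and> cmod w \<ge> r}"
      "closed_segment d a \<subseteq> {w. Im w \<ge> 0 \<and> cmod w \<ge> r}"
    proof -
      show "closed_segment a b \<subseteq> {w. Im w \<ge> 0} - {z}"
        using z r by (auto simp: a_def b_def closed_segment_same_Im)
      have "cmod w \<ge> r" if "\<bar>Re w\<bar> = r \<or> \<bar>Im w\<bar> = r" for w
        using that abs_Re_le_cmod[of w] abs_Im_le_cmod[of w] by auto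
      then show "closed_segment b c \<subseteq> {w. Im w \<ge> 0 \<and> cmod w \<ge> r}"
        "closed_segment c d \<subseteq> {w. Im w \<ge> 0 \<and> cmod w \<ge> r}"
        "closed_segment d a \<subseteq> {w. Im w \<ge> 0 \<and> cmod w \<ge> r}"
        using r by (auto simp: a_def b_def c_def d_def closed_segment_same_Im closed_segment_same_Re closed_segment_eq_real_ivl)
    qed
    have segs': "closed_segment b c \<subseteq> {w. Im w \<ge> 0} - {z}" "closed_segment c d \<subseteq> {w. Im w \<ge> 0} - {z}"
      "closed_segment d a \<subseteq> {w. Im w \<ge> 0} - {z}"
      using segs r by auto
    have I: "h contour_integrable_on linepath a b" "h contour_integrable_on linepath b c"
      "h contour_integrable_on linepath c d" "h contour_integrable_on linepath d a"
      by (intro contour_integrable_continuous_linepath continuous_on_subset[OF cont] segs segs')+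
    define I1 where "I1 = contour_integral (linepath a b) h"
    define I2 where "I2 = contour_integral (linepath b c) h"
    define I3 where "I3 = contour_integral (linepath c d) h"
    define I4 where "I4 = contour_integral (linepath d a) h"
    have hI: "(h has_contour_integral I1) (linepath a b)" "(h has_contour_integral I2) (linepath b c)"
      "(h has_contour_integral I3) (linepath c d)" "(h has_contour_integral I4) (linepath d a)"
      unfolding I1_def I2_def I3_def I4_def by (intro has_contour_integral_integral I)+
    have "(h has_contour_integral (I1 + (I2 + (I3 + I4)))) (rectpath a c)"
      unfolding path by (intro has_contour_integral_join hI valid_path_join valid_path_linepath) simp_all
    moreover have "(h has_contour_integral V) (rectpath a c)"
    proof -
      have img: "path_image (rectpath a c) \<subseteq> {w. Im w \<ge> 0} - {z}"
        unfolding path using segs(1) segs' by (auto simp: path_image_join)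
      show ?thesis
      proof (cases "Im z > 0")
        case True
        have "z \<in> box a c" using Imz True by (auto simp: in_box_complex_iff a_def c_def)
        then have wn: "winding_number (rectpath a c) z = 1" by (rule winding_number_rectpath)
        have "(h has_contour_integral (2 * pi * \<i> * winding_number (rectpath a c) z * f z)) (rectpath a c)"
          unfolding h_def
        proof (rule Cauchy_integral_formula_convex_simple[OF convex_halfspace_Im_gt hol])
          show "z \<in> interior {z. Im z > - e}"
            using True e by (simp add: interior_open open_halfspace_Im_gt)
          show "path_image (rectpath a c) \<subseteq> {z. Im z > - e} - {z}" using img e by auto
        qed auto
        then show ?thesis using wn True by (simp add: V_def)
      next
        case False
        then have Im: "Im z < 0" using z by simp
        have "(h has_contour_integral 0) (rectpath a c)"
        proof (rule Cauchy_theorem_convex_simple)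
          show "h holomorphic_on ({w. Im w > - e} \<inter> {w. Im w > Im z})"
            unfolding h_def by (intro holomorphic_intros holomorphic_on_subset[OF hol]) auto
          show "convex ({w. Im w > - e} \<inter> {w. Im w > Im z})"
            by (intro convex_Int convex_halfspace_Im_gt)
          show "path_image (rectpath a c) \<subseteq> {w. Im w > - e} \<inter> {w. Im w > Im z}"
            using img e Im by auto
        qed auto
        then show ?thesis using False by (simp add: V_def)
      qed
    qed
    ultimately have V: "V = I1 + (I2 + (I3 + I4))" by (rule has_contour_integral_unique[symmetric])
    define B where "B = C / (1 + r) * (1 / (r - cmod z))"
    have B0: "B \<ge> 0" using C r by (simp add: B_def)
    have hB: "cmod (h w) \<le> B" if "Im w \<ge> 0" "cmod w \<ge> r" for w
    proof -
      have "cmod (f w) \<le> C / (1 + r)"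
        using bound[OF that(1)] that(2) C r by (elim order_trans) (intro divide_left_mono mult_pos_pos, auto)
      moreover have "1 / cmod (w - z) \<le> 1 / (r - cmod z)"
        using norm_triangle_ineq2[of w z] that(2) r by (intro divide_left_mono mult_pos_pos) auto
      ultimately have "cmod (f w) * (1 / cmod (w - z)) \<le> B"
        unfolding B_def using C r by (intro mult_mono) auto
      then show ?thesis by (simp add: h_def norm_divide)
    qed
    have b2: "cmod I2 \<le> B * cmod (c - b)"
      by (rule has_contour_integral_bound_linepath[OF hI(2) B0]) (use segs hB in blast)
    have b3: "cmod I3 \<le> B * cmod (d - c)"
      by (rule has_contour_integral_bound_linepath[OF hI(3) B0]) (use segs hB in blast)
    have b4: "cmod I4 \<le> B * cmod (a - d)"
      by (rule has_contour_integral_bound_linepath[OF hI(4) B0]) (use segs hB in blast)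
    have len: "cmod (c - b) = r" "cmod (d - c) = 2 * r" "cmod (a - d) = r"
    proof -
      have "c - b = \<i> * of_real r" "d - c = of_real (- 2 * r)" "a - d = - (\<i> * of_real r)"
        by (simp_all add: complex_eq_iff a_def b_def c_def d_def)
      note eqs = this
      show "cmod (c - b) = r" "cmod (d - c) = 2 * r" "cmod (a - d) = r"
        unfolding eqs norm_mult norm_minus_cancel norm_of_real norm_ii using r by simp_all
    qed
    have "I1 = integral {- r..r} (\<lambda>s. h (complex_of_real s))"
      unfolding I1_def using r
      by (subst contour_integral_linepath_Reals_eq) (auto simp: a_def b_def complex_is_Real_iff)
    then have "cmod (V - integral {- real n..real n} (\<lambda>s. h (complex_of_real s))) = cmod (I2 + (I3 + I4))"
      by (simp add: V r_def)
    also have "\<dots> \<le> cmod I2 + (cmod I3 + cmod I4)"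
      by (meson add_left_mono norm_triangle_ineq order_trans)
    also have "\<dots> \<le> B * (4 * r)" using b2 b3 b4 len by (simp add: algebra_simps)
    also have "\<dots> = 4 * C * (r / (1 + r)) * (1 / (r - cmod z))" by (simp add: B_def)
    also have "\<dots> \<le> 4 * C * 1 * (1 / (r - cmod z))"
      using C r by (intro mult_right_mono mult_left_mono) (auto simp: divide_le_eq)
    also have "\<dots> \<le> 6 * C / (real n - cmod z)"
      using C r by (simp add: r_def divide_right_mono)
    finally show ?thesis .
  qed
  have "(\<lambda>n. V - integral {- real n..real n} (\<lambda>s. h (complex_of_real s))) \<longlonglongrightarrow> 0"
  proof (rule Lim_null_comparison)
    obtain N where "cmod z < real N" using reals_Archimedean2 by blast
    then show "\<forall>\<^sub>F n in sequentially. cmod (V - integral {- real n..real n} (\<lambda>s. h (complex_of_real s))) \<le> 6 * C / (real n - cmod z)"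
      by (intro eventually_sequentiallyI[of N] est) auto
    show "(\<lambda>n. 6 * C / (real n - cmod z)) \<longlonglongrightarrow> 0"
      using tendsto_divide_0[OF tendsto_const[of "6 * C"] filterlim_at_top_imp_at_infinity[OF
          filterlim_tendsto_add_at_top[OF tendsto_const[of "- cmod z"] filterlim_real_sequentially]]]
      by simp
  qed
  moreover have "(\<lambda>n. V - integral {- real n..real n} (\<lambda>s. h (complex_of_real s))) \<longlonglongrightarrow> V - (CLINT s|lborel. h (complex_of_real s))"
    using int by (intro tendsto_diff tendsto_const integral_symmetric_interval_tendsto) (simp add: h_def)
  ultimately have "V - (CLINT s|lborel. h (complex_of_real s)) = 0"
    using LIMSEQ_unique by blast
  then show ?thesis by (simp add: h_def V_def)
qed

text \<open>The Cauchy integral at \<open>cnj z\<close> vanishes, and so does its conjugate, which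
  has the same kernel 1/(s - z) but \<open>cnj f\<close> in place of \<open>f\<close>. Subtracting
  it replaces \<open>f\<close> by twice its imaginary part (times \<i>) and leaves the value at
  \<open>z\<close> unchanged.\<close>

corollary half_plane_poisson:
  fixes f :: "complex \<Rightarrow> complex"
  assumes hol: "f holomorphic_on {z. Im z > - e}" and e: "e > 0"
    and bound: "\<And>z. Im z \<ge> 0 \<Longrightarrow> cmod (f z) \<le> C / (1 + cmod z)"
    and z: "Im z > 0"
  shows "(CLINT s|lborel. complex_of_real (- Im (f (complex_of_real s)) / pi) / (z - complex_of_real s)) = f z"
proof -
  have cont_R: "continuous_on UNIV (\<lambda>s. f (complex_of_real s))"
    by (rule continuous_on_compose2[OF holomorphic_on_imp_continuous_on[OF hol]])
       (use e in \<open>auto intro!: continuous_intros\<close>)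
  have int: "integrable lborel (\<lambda>s. f (complex_of_real s) / (complex_of_real s - w))" if "Im w \<noteq> 0" for w
  proof (rule integrable_decay_divide[OF _ _ that])
    show "(\<lambda>s. f (complex_of_real s)) \<in> borel_measurable lborel"
      using borel_measurable_continuous_onI[OF cont_R] by simp
    show "cmod (f (complex_of_real s)) \<le> C / (1 + \<bar>s\<bar>)" for s
      using bound[of "complex_of_real s"] by simp
  qed
  have A: "(CLINT s|lborel. f (complex_of_real s) / (complex_of_real s - z)) = 2 * pi * \<i> * f z"
    using half_plane_cauchy_integral[OF hol e bound, of z] z by simp
  have "(CLINT s|lborel. f (complex_of_real s) / (complex_of_real s - cnj z)) = 0"
    using half_plane_cauchy_integral[OF hol e bound, of "cnj z"] z by simp
  then have "(CLINT s|lborel. cnj (f (complex_of_real s) / (complex_of_real s - cnj z))) = 0"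
    by (simp only: Bochner_Integration.integral_cnj complex_cnj_zero)
  then have B: "(CLINT s|lborel. cnj (f (complex_of_real s)) / (complex_of_real s - z)) = 0" by simp
  have intB: "integrable lborel (\<lambda>s. cnj (f (complex_of_real s)) / (complex_of_real s - z))"
    using integrable_cnj[OF int[of "cnj z"]] z by simp
  have "2 * pi * \<i> * f z = (CLINT s|lborel. f (complex_of_real s) / (complex_of_real s - z) - cnj (f (complex_of_real s)) / (complex_of_real s - z))"
    using A B by (subst Bochner_Integration.integral_diff[OF int intB]) (use z in auto)
  also have "\<dots> = (CLINT s|lborel. 2 * pi * \<i> * (complex_of_real (- Im (f (complex_of_real s)) / pi) / (z - complex_of_real s)))"
  proof (intro Bochner_Integration.integral_cong refl)
    fix s
    have 1: "a - cnj a = 2 * \<i> * complex_of_real (Im a)" for a by (simp add: complex_eq_iff)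
    have "f (complex_of_real s) / (complex_of_real s - z) - cnj (f (complex_of_real s)) / (complex_of_real s - z)
        = (2 * \<i> * complex_of_real (Im (f (complex_of_real s)))) / (complex_of_real s - z)"
      by (simp only: 1 diff_divide_distrib[symmetric])
    also have "\<dots> = 2 * pi * \<i> * (complex_of_real (- Im (f (complex_of_real s)) / pi) / (z - complex_of_real s))"
    proof -
      have "2 * \<i> * y / d = 2 * p * \<i> * (- y / p / - d)" if "d \<noteq> 0" "p \<noteq> 0" for y p d :: complex
        using that by (simp add: field_simps)
      from this[of "complex_of_real s - z" "complex_of_real pi" "complex_of_real (Im (f (complex_of_real s)))"]
      show ?thesis using diff_of_real_nonzero[OF z, of s] by simp
    qed
    finally show "f (complex_of_real s) / (complex_of_real s - z) - cnj (f (complex_of_real s)) / (complex_of_real s - z)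
      = 2 * pi * \<i> * (complex_of_real (- Im (f (complex_of_real s)) / pi) / (z - complex_of_real s))" .
  qed
  also have "\<dots> = 2 * pi * \<i> * (CLINT s|lborel. complex_of_real (- Im (f (complex_of_real s)) / pi) / (z - complex_of_real s))"
    by (rule integral_mult_right_zero)
  finally have eq: "2 * pi * \<i> * f z = \<dots>" .
  have "2 * pi * \<i> \<noteq> 0" by simp
  from iffD1[OF mult_left_cancel[OF this] eq] show ?thesis by (rule sym)
qed

section \<open>Boundary values and density\<close>

context semicircular_flow
begin

definition approach :: "real \<Rightarrow> nat \<Rightarrow> complex" where
  "approach x n = Complex x (inverse (real (Suc n)))"

lemma Im_approach_pos: "Im (approach x n) > 0"
  by (simp add: approach_def)

lemma approach_tendsto: "approach x \<longlonglongrightarrow> complex_of_real x"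
proof -
  have "(\<lambda>n. Complex x (inverse (real (Suc n)))) \<longlonglongrightarrow> Complex x 0"
    by (intro tendsto_Complex tendsto_const LIMSEQ_inverse_real_of_nat)
  then show ?thesis by (simp add: approach_def[abs_def] complex_of_real_def)
qed

lemma norm_approach_le: "cmod (approach x n) \<le> \<bar>x\<bar> + 1"
proof -
  have "inverse (real (Suc n)) \<le> 1" by (simp add: inverse_le_1_iff)
  moreover have "cmod (approach x n) \<le> \<bar>x\<bar> + \<bar>inverse (real (Suc n))\<bar>"
    using cmod_le[of "approach x n"] by (simp add: approach_def)
  ultimately show ?thesis by simp
qed

definition omega_bd :: "real \<Rightarrow> complex" where
  "omega_bd x = lim (\<lambda>n. \<omega> (approach x n))"

lemma omega_approach_tendsto: "(\<lambda>n. \<omega> (approach x n)) \<longlonglongrightarrow> omega_bd x"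
proof -
  define c where "c = hoelder_const (\<bar>x\<bar> + 1 + sqrt t)"
  have c: "c > 0" unfolding c_def using t_pos by (intro hoelder_const_pos) (simp add: add_nonneg_pos)
  have "Cauchy (\<lambda>n. \<omega> (approach x n))"
  proof (rule CauchyI)
    fix e :: real assume e: "e > 0"
    have "e ^ 3 * c * t / 2 > 0" using e c t_pos by simp
    then obtain N where N: "\<And>m n. m \<ge> N \<Longrightarrow> n \<ge> N \<Longrightarrow> cmod (approach x m - approach x n) < e ^ 3 * c * t / 2"
      using CauchyD[OF LIMSEQ_imp_Cauchy[OF approach_tendsto]] by metis
    show "\<exists>N. \<forall>m\<ge>N. \<forall>n\<ge>N. cmod (\<omega> (approach x m) - \<omega> (approach x n)) < e"
    proof (intro exI[of _ N] allI impI)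
      fix m n assume mn: "m \<ge> N" "n \<ge> N"
      have "c * cmod (\<omega> (approach x m) - \<omega> (approach x n)) ^ 3 \<le> 2 / t * cmod (approach x m - approach x n)"
        unfolding c_def by (intro hoelder_omega Im_approach_pos norm_approach_le)
      also have "\<dots> < 2 / t * (e ^ 3 * c * t / 2)"
        using N[OF mn] t_pos by (intro mult_strict_left_mono) auto
      also have "\<dots> = c * e ^ 3" using t_pos by simp
      finally have "cmod (\<omega> (approach x m) - \<omega> (approach x n)) ^ 3 < e ^ 3" using c by simp
      then show "cmod (\<omega> (approach x m) - \<omega> (approach x n)) < e"
        using e by (intro power_less_imp_less_base[of _ 3 e]) auto
    qed
  qed
  then show ?thesis
    unfolding omega_bd_def by (simp add: Cauchy_convergent convergent_LIMSEQ_iff[symmetric])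
qed

lemma hoelder_omega_bd:
  assumes "Im z > 0" "cmod z \<le> R" "\<bar>x\<bar> \<le> R"
  shows "hoelder_const (R + 1 + sqrt t) * cmod (omega_bd x - \<omega> z) ^ 3 \<le> 2 / t * cmod (complex_of_real x - z)"
proof (rule LIMSEQ_le)
  show "(\<lambda>n. hoelder_const (R + 1 + sqrt t) * cmod (\<omega> (approach x n) - \<omega> z) ^ 3)
      \<longlonglongrightarrow> hoelder_const (R + 1 + sqrt t) * cmod (omega_bd x - \<omega> z) ^ 3"
    by (intro tendsto_intros omega_approach_tendsto)
  show "(\<lambda>n. 2 / t * cmod (approach x n - z)) \<longlonglongrightarrow> 2 / t * cmod (complex_of_real x - z)"
    by (intro tendsto_intros approach_tendsto)
  have "cmod (approach x n) \<le> R + 1" for n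
    using norm_approach_le[of x n] assms(3) by simp
  then show "\<exists>N. \<forall>n\<ge>N. hoelder_const (R + 1 + sqrt t) * cmod (\<omega> (approach x n) - \<omega> z) ^ 3 \<le> 2 / t * cmod (approach x n - z)"
    using assms by (intro exI[of _ 0] allI impI hoelder_omega Im_approach_pos) auto
qed

text \<open>The boundary value, defined along vertical lines, is the limit along every approach
  within the half-plane. This is needed for sequences H(v n), which do not approach the real line
  vertically.\<close>

lemma omega_tendsto_boundary:
  assumes "(z \<longlongrightarrow> complex_of_real x) F" "eventually (\<lambda>k. Im (z k) > 0) F"
  shows "((\<lambda>k. \<omega> (z k)) \<longlongrightarrow> omega_bd x) F"
proof -
  define R where "R = \<bar>x\<bar> + 1"
  define c where "c = hoelder_const (R + 1 + sqrt t)"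
  have c: "c > 0" unfolding c_def R_def using t_pos by (intro hoelder_const_pos) (simp add: add_nonneg_pos)
  have "eventually (\<lambda>k. dist (z k) (complex_of_real x) < 1) F"
    using assms(1) by (rule tendstoD) simp
  then have ev: "eventually (\<lambda>k. norm (cmod (omega_bd x - \<omega> (z k)) ^ 3) \<le> 2 / t / c * cmod (complex_of_real x - z k)) F"
    using assms(2)
  proof eventually_elim
    case (elim k)
    have "cmod (z k) \<le> R"
      using elim(1) norm_triangle_ineq2[of "z k" "complex_of_real x"] by (simp add: R_def dist_norm)
    then have "c * cmod (omega_bd x - \<omega> (z k)) ^ 3 \<le> 2 / t * cmod (complex_of_real x - z k)"
      unfolding c_def using elim by (intro hoelder_omega_bd) (auto simp: R_def)
    then have "cmod (omega_bd x - \<omega> (z k)) ^ 3 \<le> (2 / t * cmod (complex_of_real x - z k)) / c"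
      by (subst pos_le_divide_eq[OF c]) (simp add: mult.commute)
    then show ?case by simp
  qed
  have "((\<lambda>k. 2 / t / c * cmod (complex_of_real x - z k)) \<longlongrightarrow> 2 / t / c * cmod (complex_of_real x - complex_of_real x)) F"
    by (intro tendsto_intros assms(1))
  then have "((\<lambda>k. cmod (omega_bd x - \<omega> (z k)) ^ 3) \<longlongrightarrow> 0) F"
    using ev by (intro Lim_null_comparison[OF ev]) simp
  then have "((\<lambda>k. omega_bd x - \<omega> (z k)) \<longlongrightarrow> 0) F"
    by (simp add: tendsto_norm_zero_iff)
  then have "((\<lambda>k. omega_bd x - (omega_bd x - \<omega> (z k))) \<longlongrightarrow> omega_bd x - 0) F"
    by (intro tendsto_diff tendsto_const)
  then show ?thesis by simp
qed

lemma isCont_omega_bd: "isCont omega_bd x"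
proof -
  define R where "R = \<bar>x\<bar> + 2"
  define c where "c = hoelder_const (R + 1 + sqrt t)"
  have c: "c > 0" unfolding c_def R_def using t_pos by (intro hoelder_const_pos) (simp add: add_nonneg_pos)
  have le: "c * cmod (omega_bd x - omega_bd y) ^ 3 \<le> 2 / t * \<bar>x - y\<bar>" if "\<bar>y\<bar> \<le> \<bar>x\<bar> + 1" for y
  proof (rule LIMSEQ_le)
    show "(\<lambda>n. c * cmod (omega_bd x - \<omega> (approach y n)) ^ 3) \<longlonglongrightarrow> c * cmod (omega_bd x - omega_bd y) ^ 3"
      by (intro tendsto_intros omega_approach_tendsto)
    have "(\<lambda>n. 2 / t * cmod (complex_of_real x - approach y n)) \<longlonglongrightarrow> 2 / t * cmod (complex_of_real x - complex_of_real y)"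
      by (intro tendsto_intros approach_tendsto)
    then show "(\<lambda>n. 2 / t * cmod (complex_of_real x - approach y n)) \<longlonglongrightarrow> 2 / t * \<bar>x - y\<bar>"
      by (simp flip: of_real_diff)
    have "cmod (approach y n) \<le> R" for n using norm_approach_le[of y n] that by (simp add: R_def)
    then show "\<exists>N. \<forall>n\<ge>N. c * cmod (omega_bd x - \<omega> (approach y n)) ^ 3 \<le> 2 / t * cmod (complex_of_real x - approach y n)"
      unfolding c_def by (intro exI[of _ 0] allI impI hoelder_omega_bd Im_approach_pos) (auto simp: R_def)
  qed
  have "eventually (\<lambda>y. dist y x < 1) (at x)"
    by (auto simp: eventually_at intro: exI[of _ 1])
  then have ev: "eventually (\<lambda>y. norm (cmod (omega_bd x - omega_bd y) ^ 3) \<le> 2 / t / c * \<bar>x - y\<bar>) (at x)"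
  proof eventually_elim
    case (elim y)
    then have "\<bar>y\<bar> \<le> \<bar>x\<bar> + 1" by (auto simp: dist_real_def)
    then have "cmod (omega_bd x - omega_bd y) ^ 3 \<le> (2 / t * \<bar>x - y\<bar>) / c"
      using le[of y] by (subst pos_le_divide_eq[OF c]) (simp add: mult.commute)
    then show ?case by simp
  qed
  have "((\<lambda>y. 2 / t / c * \<bar>x - y\<bar>) \<longlongrightarrow> 2 / t / c * \<bar>x - x\<bar>) (at x)"
    by (intro tendsto_intros)
  then have "((\<lambda>y. cmod (omega_bd x - omega_bd y) ^ 3) \<longlongrightarrow> 0) (at x)"
    using ev by (intro Lim_null_comparison[OF ev]) simp
  then have "((\<lambda>y. omega_bd x - omega_bd y) \<longlongrightarrow> 0) (at x)"
    by (simp add: tendsto_norm_zero_iff)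
  then have "((\<lambda>y. omega_bd x - (omega_bd x - omega_bd y)) \<longlongrightarrow> omega_bd x - 0) (at x)"
    by (intro tendsto_diff tendsto_const)
  then show ?thesis by (simp add: isCont_def)
qed

text \<open>Stieltjes inversion in disguise: Im \<omega>(z) - Im z = - t Im g(z), so on the real
  line this is the boundary value of - Im g / \<pi>. Written through \<omega>, it inherits
  continuity from the Hoelder estimate.\<close>

definition flow_density :: "real \<Rightarrow> real" where
  "flow_density x = Im (omega_bd x) / (pi * t)"

lemma continuous_on_flow_density: "continuous_on UNIV flow_density"
  unfolding flow_density_def
  by (intro continuous_intros continuous_at_imp_continuous_on ballI isCont_omega_bd) (use t_pos in auto)

lemma borel_measurable_flow_density [measurable]: "flow_density \<in> borel_measurable borel"
  by (rule borel_measurable_continuous_onI[OF continuous_on_flow_density])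

lemma Im_omega_bd_nonneg: "Im (omega_bd x) \<ge> 0"
proof (rule LIMSEQ_le_const)
  show "(\<lambda>n. Im (\<omega> (approach x n))) \<longlonglongrightarrow> Im (omega_bd x)"
    by (intro tendsto_intros omega_approach_tendsto)
qed (use Im_omega_pos[OF Im_approach_pos] in \<open>auto intro: less_imp_le\<close>)

lemma norm_omega_bd_diff_le: "cmod (omega_bd x - complex_of_real x) \<le> sqrt t"
proof (rule LIMSEQ_le_const2)
  show "(\<lambda>n. cmod (\<omega> (approach x n) - approach x n)) \<longlonglongrightarrow> cmod (omega_bd x - complex_of_real x)"
    by (intro tendsto_intros omega_approach_tendsto approach_tendsto)
qed (use norm_omega_diff_le[OF Im_approach_pos] in auto)

lemma flow_density_nonneg: "flow_density x \<ge> 0"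
  using t_pos Im_omega_bd_nonneg by (simp add: flow_density_def)

lemma Im_g_approach_tendsto: "(\<lambda>n. - Im (g (approach x n)) / pi) \<longlonglongrightarrow> flow_density x"
proof -
  have "(\<lambda>n. (Im (\<omega> (approach x n)) - Im (approach x n)) / (pi * t)) \<longlonglongrightarrow> (Im (omega_bd x) - Im (complex_of_real x)) / (pi * t)"
    using t_pos by (intro tendsto_intros omega_approach_tendsto approach_tendsto) auto
  moreover have "(Im (\<omega> (approach x n)) - Im (approach x n)) / (pi * t) = - Im (g (approach x n)) / pi" for n
  proof -
    have eq: "Im (\<omega> (approach x n)) - Im (approach x n) = t * - Im (g (approach x n))"
      using Im_g_eq[OF Im_approach_pos, of x n] by simp
    show ?thesis unfolding eq using t_pos by simp
  qed
  ultimately show ?thesis by (simp add: flow_density_def)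
qed

lemma cmod_real_le_approach: "\<bar>x\<bar> \<le> cmod (approach x n)"
  using abs_Re_le_cmod[of "approach x n"] by (simp add: approach_def)

lemma abs_Im_g_approach_le: "\<bar>- Im (g (approach x n)) / pi\<bar> \<le> decay_const / (1 + \<bar>x\<bar>)"
proof -
  have "\<bar>Im (g (approach x n))\<bar> \<le> cmod (g (approach x n))" by (rule abs_Im_le_cmod)
  also have "\<dots> \<le> decay_const / (1 + cmod (approach x n))"
    by (intro norm_g_decay Im_approach_pos)
  also have "\<dots> \<le> decay_const / (1 + \<bar>x\<bar>)"
    using decay_const_pos cmod_real_le_approach[of x n] by (intro divide_left_mono mult_pos_pos) auto
  finally have *: "\<bar>Im (g (approach x n))\<bar> \<le> decay_const / (1 + \<bar>x\<bar>)" .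
  have "\<bar>- Im (g (approach x n)) / pi\<bar> \<le> \<bar>Im (g (approach x n))\<bar> / 1"
    using pi_ge_two by (simp only: abs_divide abs_minus_cancel) (intro divide_left_mono, auto)
  with * show ?thesis by simp
qed

lemma flow_density_le: "flow_density x \<le> decay_const / (1 + \<bar>x\<bar>)"
proof (rule LIMSEQ_le_const2[OF Im_g_approach_tendsto])
  show "\<exists>N. \<forall>n\<ge>N. - Im (g (approach x n)) / pi \<le> decay_const / (1 + \<bar>x\<bar>)"
    using abs_Im_g_approach_le by (intro exI[of _ 0] allI impI) (rule abs_le_D1)
qed

text \<open>Shifting by i e places the real line inside the domain of holomorphy. The decay constant
  is independent of \<open>e\<close>, so that \<open>e\<close> can later be sent to 0 by dominated
  convergence.\<close>

lemma g_shift_poisson: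
  assumes e: "e > 0" and z: "Im z > 0"
  shows "(CLINT s|lborel. complex_of_real (- Im (g (complex_of_real s + \<i> * complex_of_real e)) / pi) / (z - complex_of_real s)) = g (z + \<i> * complex_of_real e)"
proof (rule half_plane_poisson[where f = "\<lambda>z. g (z + \<i> * complex_of_real e)", OF _ e _ z])
  show "(\<lambda>z. g (z + \<i> * complex_of_real e)) holomorphic_on {z. Im z > - e}"
    by (rule holomorphic_on_compose_gen[OF _ holomorphic_g, unfolded o_def]) (auto intro!: holomorphic_intros)
  fix w assume w: "Im w \<ge> 0"
  have "cmod w \<le> cmod (w + \<i> * complex_of_real e)"
    using w e by (auto simp: cmod_def intro!: real_sqrt_le_mono power_mono)
  then have "decay_const / (1 + cmod (w + \<i> * complex_of_real e)) \<le> decay_const / (1 + cmod w)"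
    using decay_const_pos by (intro divide_left_mono mult_pos_pos) (auto intro: add_pos_nonneg)
  with norm_g_decay[of "w + \<i> * complex_of_real e"] w e
  show "cmod (g (w + \<i> * complex_of_real e)) \<le> decay_const / (1 + cmod w)" by simp
qed

lemma norm_kernel_le: "Im z > 0 \<Longrightarrow> cmod (1 / (z - complex_of_real s)) \<le> ((1 + cmod z) / Im z + 1) / (1 + \<bar>s\<bar>)"
  using norm_inverse_real_diff_le[of z s] by (simp add: norm_divide norm_minus_commute)

lemma flow_density_cauchy_transform:
  assumes z: "Im z > 0"
  shows "(CLINT s|lborel. complex_of_real (flow_density s) / (z - complex_of_real s)) = g z"
proof -
  define K where "K = (1 + cmod z) / Im z + 1"
  have K: "K \<ge> 0" using z by (simp add: K_def add_nonneg_nonneg)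
  have eq: "complex_of_real s + \<i> * complex_of_real (inverse (real (Suc n))) = approach s n" for s n
    by (simp add: approach_def complex_eq_iff del: of_real_inverse)
  have g_cont: "continuous_on UNIV (\<lambda>s. g (approach s n))" for n
    by (rule continuous_on_compose2[OF holomorphic_on_imp_continuous_on[OF holomorphic_g]])
       (auto intro!: continuous_intros simp: Im_approach_pos eq[symmetric] simp del: of_real_inverse)
  have g_meas: "(\<lambda>s. g (approach s n)) \<in> borel_measurable lborel" for n
    using borel_measurable_continuous_onI[OF g_cont] by simp
  have "(\<lambda>n. CLINT s|lborel. complex_of_real (- Im (g (approach s n)) / pi) / (z - complex_of_real s))
     \<longlonglongrightarrow> (CLINT s|lborel. complex_of_real (flow_density s) / (z - complex_of_real s))"
  proof (rule integral_dominated_convergence)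
    show "integrable lborel (\<lambda>s::real. decay_const * K * (1 / (1 + s\<^sup>2)))"
      by (intro integrable_mult_right integrable_inverse_1_plus_square_lborel)
    show "AE s in lborel. (\<lambda>n. complex_of_real (- Im (g (approach s n)) / pi) / (z - complex_of_real s))
        \<longlonglongrightarrow> complex_of_real (flow_density s) / (z - complex_of_real s)"
      using diff_of_real_nonzero[OF z]
      by (intro AE_I2 tendsto_divide tendsto_of_real Im_g_approach_tendsto tendsto_const)
    show "AE s in lborel. cmod (complex_of_real (- Im (g (approach s n)) / pi) / (z - complex_of_real s)) \<le> decay_const * K * (1 / (1 + s\<^sup>2))" for n
    proof (intro AE_I2)
      fix s
      show "cmod (complex_of_real (- Im (g (approach s n)) / pi) / (z - complex_of_real s)) \<le> decay_const * K * (1 / (1 + s\<^sup>2))"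
        using decay_product_le[OF K abs_Im_g_approach_le norm_kernel_le[OF z, folded K_def], of s n]
        by (simp add: norm_divide norm_mult)
    qed
  qed (use g_meas in measurable)
  moreover have "(CLINT s|lborel. complex_of_real (- Im (g (approach s n)) / pi) / (z - complex_of_real s)) = g (z + \<i> * complex_of_real (inverse (real (Suc n))))" for n
    using g_shift_poisson[of "inverse (real (Suc n))" z] z unfolding eq by simp
  moreover have "(\<lambda>n. g (z + \<i> * complex_of_real (inverse (real (Suc n))))) \<longlonglongrightarrow> g z"
  proof -
    have "isCont g z"
      using holomorphic_on_imp_continuous_on[OF holomorphic_g] z
      by (auto simp: continuous_on_eq_continuous_at open_halfspace_Im_gt)
    moreover have "(\<lambda>n. z + \<i> * complex_of_real (inverse (real (Suc n)))) \<longlonglongrightarrow> z + \<i> * complex_of_real 0"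
      by (intro tendsto_intros LIMSEQ_inverse_real_of_nat)
    ultimately show ?thesis by (auto intro: isCont_tendsto_compose)
  qed
  ultimately show ?thesis using LIMSEQ_unique by simp
qed

lemma integrable_flow_density_kernel:
  assumes "Im z > 0"
  shows "integrable lborel (\<lambda>s. complex_of_real (flow_density s) / (z - complex_of_real s))"
proof -
  have "integrable lborel (\<lambda>s. - (complex_of_real (flow_density s) / (complex_of_real s - z)))"
    using assms flow_density_nonneg flow_density_le
    by (intro Bochner_Integration.integrable_minus integrable_decay_divide[where C = decay_const]) auto
  then show ?thesis by (simp add: minus_divide_right)
qed

text \<open>This limit will be the total mass of the density. As \<omega>(iy) stays within sqrt t of
  iy while G(\<omega>(iy)) is O(1/y), iy g(iy) has the same limit as v G(v) at v = \<omega>(iy),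
  namely 1.\<close>

lemma g_imaginary_axis_tendsto: "(\<lambda>n. - (real (Suc n) * Im (g (Complex 0 (real (Suc n)))))) \<longlonglongrightarrow> 1"
proof -
  have "(\<lambda>n. Complex 0 (real (Suc n)) * g (Complex 0 (real (Suc n)))) \<longlonglongrightarrow> 1"
  proof (rule LIMSEQ_I)
    fix e :: real assume e: "e > 0"
    obtain Y where Y: "Y > 0" "\<And>y. y \<ge> Y \<Longrightarrow> (LINT u|M. min (1 + 1) (\<bar>u\<bar> / y)) < e / 2"
      using ex_tail_bound[of 1 "e / 2"] e by auto
    \<comment> \<open>Beyond \<open>Y\<close> the tail integral is below e/2; beyond sqrt t the
      point \<omega>(iy) lies in the cone of aperture 1; beyond 2 sqrt t / e the correction
      (\<omega>(iy) - iy) G(\<omega>(iy)) is below e/2.\<close>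
    obtain N where N: "real N \<ge> max Y (max (sqrt t) (2 * sqrt t / e))"
      using real_arch_simple by blast
    show "\<exists>N. \<forall>n\<ge>N. cmod (Complex 0 (real (Suc n)) * g (Complex 0 (real (Suc n))) - 1) < e"
    proof (intro exI[of _ N] allI impI)
      fix n assume "N \<le> n"
      define y where "y = real (Suc n)"
      have y: "y \<ge> Y" "y \<ge> sqrt t" "y > 2 * sqrt t / e" "y > 0"
        using N \<open>N \<le> n\<close> by (auto simp: y_def)
      define v where "v = \<omega> (Complex 0 y)"
      have v: "cmod (v - Complex 0 y) \<le> sqrt t" "Im v \<ge> y"
        using norm_omega_diff_le[of "Complex 0 y"] Im_omega_ge[of "Complex 0 y"] y(4) by (auto simp: v_def)
      have "\<bar>Re v\<bar> \<le> 1 * Im v"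
        using abs_Re_le_cmod[of "v - Complex 0 y"] v y(2) by simp
      then have 1: "cmod (v * cauchy_transform M v - 1) < e / 2"
        using norm_mult_cauchy_transform_minus_1_le[of 1 y v] Y(2)[OF y(1)] v(2) y(4) by simp
      have "cmod (cauchy_transform M v) \<le> 1 / Im v"
        using v y by (intro norm_cauchy_transform_le) auto
      also have "\<dots> \<le> 1 / y" using v y by (intro divide_left_mono) auto
      finally have "cmod (v - Complex 0 y) * cmod (cauchy_transform M v) \<le> sqrt t * (1 / y)"
        using v(1) t_pos by (intro mult_mono) auto
      also have "\<dots> < e / 2" using y(3,4) e by (simp add: field_simps)
      finally have 2: "cmod ((v - Complex 0 y) * cauchy_transform M v) < e / 2" by (simp add: norm_mult)
      have "Complex 0 y * g (Complex 0 y) - 1 = (v * cauchy_transform M v - 1) - (v - Complex 0 y) * cauchy_transform M v"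
        by (simp add: g_def v_def algebra_simps)
      also have "cmod \<dots> < e"
        using norm_triangle_ineq4[of "v * cauchy_transform M v - 1" "(v - Complex 0 y) * cauchy_transform M v"] 1 2
        by linarith
      finally show "cmod (Complex 0 (real (Suc n)) * g (Complex 0 (real (Suc n))) - 1) < e"
        by (simp add: y_def)
    qed
  qed
  from tendsto_Re[OF this] show ?thesis by simp
qed

text \<open>The weights y^2/(y^2 + s^2) increase to 1 with y, and weighted by them the density
  integrates to - y Im g(iy). Monotone convergence then yields integrability and total mass
  together.\<close>

lemma has_bochner_integral_flow_density: "has_bochner_integral lborel flow_density 1"
proof -
  define k where "k = (\<lambda>n s. flow_density s * ((real (Suc n))\<^sup>2 / ((real (Suc n))\<^sup>2 + s\<^sup>2)))"
  have k_eq: "k n s = - (real (Suc n) * Im (complex_of_real (flow_density s) / (Complex 0 (real (Suc n)) - complex_of_real s)))" for n s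
  proof -
    have "p * (y\<^sup>2 / (y\<^sup>2 + s\<^sup>2)) = - (y * Im (complex_of_real p / (Complex 0 y - complex_of_real s)))" for p y
      by (simp add: Im_divide power2_eq_square add.commute)
    then show ?thesis by (simp only: k_def)
  qed
  have int_k: "integrable lborel (k n)" for n
    unfolding k_eq by (intro Bochner_Integration.integrable_minus integrable_mult_right integrable_Im integrable_flow_density_kernel) simp
  have int_k_eq: "integral\<^sup>L lborel (k n) = - (real (Suc n) * Im (g (Complex 0 (real (Suc n)))))" for n
  proof -
    have "integral\<^sup>L lborel (k n) = - (real (Suc n) * Im (CLINT s|lborel. complex_of_real (flow_density s) / (Complex 0 (real (Suc n)) - complex_of_real s)))"
      unfolding k_eq by (subst integral_Im[symmetric, OF integrable_flow_density_kernel])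
        (simp_all only: Bochner_Integration.integral_minus integral_mult_right_zero, simp)
    then show ?thesis by (subst (asm) flow_density_cauchy_transform) auto
  qed
  show ?thesis
  proof (rule has_bochner_integral_monotone_convergence)
    show "integrable lborel (k n)" for n by (rule int_k)
    show "AE s in lborel. mono (\<lambda>n. k n s)"
    proof (intro AE_I2 monoI)
      fix s and m n :: nat assume "m \<le> n"
      have "(real (Suc m))\<^sup>2 / ((real (Suc m))\<^sup>2 + s\<^sup>2) \<le> (real (Suc n))\<^sup>2 / ((real (Suc n))\<^sup>2 + s\<^sup>2)"
      proof -
        have le: "(real (Suc m))\<^sup>2 \<le> (real (Suc n))\<^sup>2" using \<open>m \<le> n\<close> by (intro power_mono) auto
        have "a / (a + c) \<le> b / (b + c)" if "a \<le> b" "0 < a" "0 \<le> c" for a b c :: real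
          using that mult_right_mono[OF that(1,3)] by (simp add: divide_simps) (simp add: algebra_simps)
        then show ?thesis using le by simp
      qed
      then show "k m s \<le> k n s" unfolding k_def by (intro mult_left_mono flow_density_nonneg)
    qed
    show "AE s in lborel. (\<lambda>n. k n s) \<longlonglongrightarrow> flow_density s"
    proof (intro AE_I2)
      fix s :: real
      have "(\<lambda>n. 1 / (1 + (s * inverse (real (Suc n)))\<^sup>2)) \<longlonglongrightarrow> 1 / (1 + (s * 0)\<^sup>2)"
        by (intro tendsto_intros LIMSEQ_inverse_real_of_nat) simp
      moreover have "1 / (1 + (s * inverse (real (Suc n)))\<^sup>2) = (real (Suc n))\<^sup>2 / ((real (Suc n))\<^sup>2 + s\<^sup>2)" for n
        by (simp add: field_simps power2_eq_square del: of_nat_Suc)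
      ultimately have "(\<lambda>n. (real (Suc n))\<^sup>2 / ((real (Suc n))\<^sup>2 + s\<^sup>2)) \<longlonglongrightarrow> 1" by simp
      from tendsto_mult[OF tendsto_const this, of "flow_density s"] show "(\<lambda>n. k n s) \<longlonglongrightarrow> flow_density s"
        by (simp add: k_def)
    qed
    show "(\<lambda>n. integral\<^sup>L lborel (k n)) \<longlonglongrightarrow> 1"
      unfolding int_k_eq by (rule g_imaginary_axis_tendsto)
  qed simp
qed

section \<open>The measure with the boundary density and its subordination relation\<close>

definition flow_law :: "real measure" where
  "flow_law = density lborel (\<lambda>x. ennreal (flow_density x))"

lemma real_distribution_flow_law: "real_distribution flow_law"
proof -
  have "(\<integral>\<^sup>+ x. ennreal (flow_density x) \<partial>lborel) = 1"
    using has_bochner_integral_flow_density flow_density_nonneg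
    by (subst nn_integral_eq_integral) (auto simp: has_bochner_integral_iff)
  then have "prob_space flow_law"
    by (intro prob_spaceI) (simp add: flow_law_def emeasure_density)
  then show ?thesis by (simp add: real_distribution_def real_distribution_axioms_def flow_law_def)
qed

lemma cauchy_transform_flow_law: "Im z > 0 \<Longrightarrow> cauchy_transform flow_law z = g z"
  unfolding cauchy_transform_def flow_law_def
  by (subst integral_density)
     (auto simp: flow_density_nonneg scaleR_conv_of_real flow_density_cauchy_transform[symmetric] simp del: of_real_divide)

lemma high_in_Omega:
  assumes "Im w > sqrt t"
  shows "w \<in> \<Omega>"
proof -
  have Im: "Im w > 0" using assms t_pos by (meson less_trans real_sqrt_gt_zero)
  have "t < (Im w)\<^sup>2" using assms t_pos Im by (metis real_sqrt_less_iff real_sqrt_abs abs_of_pos)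
  then have "t * (1 / (Im w)\<^sup>2) < 1" using Im by simp
  moreover have "t * energy M w \<le> t * (1 / (Im w)\<^sup>2)"
    using t_pos by (intro mult_left_mono energy_le Im) auto
  ultimately have "t * energy M w < 1" by linarith
  then show ?thesis using Im by (simp add: \<Omega>_def)
qed

lemma cauchy_transform_flow_law_subordinate:
  assumes "Im w > sqrt t"
  shows "cauchy_transform flow_law (w + t * cauchy_transform M w) = cauchy_transform M w"
proof -
  have w: "w \<in> \<Omega>" by (rule high_in_Omega[OF assms])
  then have "cauchy_transform flow_law (H w) = cauchy_transform M w"
    by (simp add: cauchy_transform_flow_law g_def omega_H Omega_iff_Im_H)
  then show ?thesis by (simp add: H_def)
qed

end

section \<open>The flow started at the point mass at 0 is the semicircle law\<close>

lemma semicircular_flow_return: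
  assumes "t > 0"
  shows "semicircular_flow (return borel 0) t"
proof -
  interpret real_distribution "return borel 0" by (rule real_distribution_return)
  have "integrable (return borel 0) (\<lambda>u::real. u\<^sup>2)"
    by (rule integrable_const_bound[of _ 0]) (simp_all add: AE_return)
  then show ?thesis
    using assms by unfold_locales
qed

text \<open>For the point mass at 0, G(w) = 1/w and H(w) = x becomes this quadratic. A real root
  makes the discriminant x^2 - 4 t a square, hence nonnegative; a non-real root has real part x/2,
  and then 4 t - x^2 = (2 Im w)^2.\<close>

lemma quadratic_root_upper:
  fixes w :: complex and x t :: real
  assumes root: "w\<^sup>2 - x * w + t = 0" and Im: "Im w \<ge> 0" and t: "t > 0"
  shows "2 * Im w = sqrt (4 * t - x\<^sup>2) * indicator {- 2 * sqrt t..2 * sqrt t} x"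
proof -
  have Re_eq: "(Re w)\<^sup>2 - (Im w)\<^sup>2 - x * Re w + t = 0"
    using arg_cong[OF root, of Re] by (simp add: power2_eq_square)
  have Im_eq: "2 * Re w * Im w - x * Im w = 0"
    using arg_cong[OF root, of Im] by (simp add: power2_eq_square algebra_simps)
  have mem: "x \<in> {- 2 * sqrt t..2 * sqrt t} \<longleftrightarrow> x\<^sup>2 \<le> 4 * t"
  proof -
    have "x \<in> {- 2 * sqrt t..2 * sqrt t} \<longleftrightarrow> \<bar>x\<bar> \<le> \<bar>2 * sqrt t\<bar>"
      using t by (auto simp: abs_le_iff)
    also have "\<dots> \<longleftrightarrow> x\<^sup>2 \<le> (2 * sqrt t)\<^sup>2" by (rule abs_le_square_iff)
    finally show ?thesis using t by (simp add: power_mult_distrib)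
  qed
  show ?thesis
  proof (cases "Im w = 0")
    case True
    then have "x\<^sup>2 - 4 * t = (2 * Re w - x)\<^sup>2"
      using Re_eq by (simp add: power2_eq_square algebra_simps)
    then have "x\<^sup>2 \<ge> 4 * t" by (metis diff_ge_0_iff_ge zero_le_power2)
    then show ?thesis using True mem by (auto simp: indicator_def)
  next
    case False
    have "(2 * Re w - x) * Im w = 0" using Im_eq by (simp add: algebra_simps)
    then have "x = 2 * Re w" using False by simp
    then have "4 * t - x\<^sup>2 = (2 * Im w)\<^sup>2"
      using Re_eq by (simp add: power2_eq_square algebra_simps)
    moreover from this have "x\<^sup>2 \<le> 4 * t" by (metis diff_ge_0_iff_ge zero_le_power2)
    moreover have "sqrt ((2 * Im w)\<^sup>2) = 2 * Im w" using Im by (subst real_sqrt_abs) simp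
    ultimately show ?thesis using mem by (simp add: indicator_def)
  qed
qed

lemma semicircle_eq_flow_law:
  assumes t: "t > 0"
  shows "semicircle t = semicircular_flow.flow_law (return borel 0) t"
proof -
  interpret semicircular_flow "return borel 0" t by (rule semicircular_flow_return[OF t])
  have "1 / (2 * pi * t) * sqrt (4 * t - x\<^sup>2) * indicator {- 2 * sqrt t..2 * sqrt t} x = flow_density x" for x
  proof -
    have root: "(\<omega> (approach x n))\<^sup>2 - approach x n * \<omega> (approach x n) + t = 0" for n
    proof -
      have nz: "\<omega> (approach x n) \<noteq> 0"
        using Im_omega_pos[OF Im_approach_pos, of x n] by auto
      have eq: "\<omega> (approach x n) = approach x n - t * (1 / \<omega> (approach x n))"
        using omega_eq[OF Im_approach_pos, of x n] by (simp add: cauchy_transform_return)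
      have "(w :: complex)\<^sup>2 - a * w + c = 0" if "w = a - c * (1 / w)" "w \<noteq> 0" for w a c
      proof -
        have "w * w = (a - c * (1 / w)) * w" using that(1) by simp
        also have "\<dots> = a * w - c" using that(2) by (simp add: algebra_simps)
        finally show ?thesis by (simp add: power2_eq_square)
      qed
      from this[OF eq nz] show ?thesis .
    qed
    have "(\<lambda>n. (\<omega> (approach x n))\<^sup>2 - approach x n * \<omega> (approach x n) + t) \<longlonglongrightarrow> (omega_bd x)\<^sup>2 - complex_of_real x * omega_bd x + t"
      by (intro tendsto_intros omega_approach_tendsto approach_tendsto)
    then have "(omega_bd x)\<^sup>2 - complex_of_real x * omega_bd x + t = 0"
      unfolding root by (simp add: LIMSEQ_const_iff)
    note root_eq = quadratic_root_upper[OF this Im_omega_bd_nonneg t]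
    have "flow_density x = (2 * Im (omega_bd x)) / (2 * pi * t)"
      by (simp add: flow_density_def)
    then have "flow_density x = (sqrt (4 * t - x\<^sup>2) * indicator {- 2 * sqrt t..2 * sqrt t} x) / (2 * pi * t)"
      unfolding root_eq .
    then show ?thesis by (simp only: times_divide_eq_left mult_1 mult.assoc)
  qed
  then show ?thesis unfolding semicircle_def flow_law_def by simp
qed

lemma (in semicircular_flow) free_convolution_semicircle: "M \<boxplus> semicircle t = flow_law"
proof -
  interpret S: semicircular_flow "return borel 0" t by (rule semicircular_flow_return[OF t_pos])
  show ?thesis
  proof (rule free_convolution_eqI[OF real_distribution_axioms real_distribution_flow_law _ t_pos])
    show "real_distribution (semicircle t)"
      unfolding semicircle_eq_flow_law[OF t_pos] by (rule S.real_distribution_flow_law)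
    show "cauchy_transform flow_law (w + t * cauchy_transform M w) = cauchy_transform M w" if "Im w > sqrt t" for w
      by (rule cauchy_transform_flow_law_subordinate[OF that])
    show "cauchy_transform (semicircle t) (w + t / w) = 1 / w" if "Im w > sqrt t" for w :: complex
      unfolding semicircle_eq_flow_law[OF t_pos]
      using S.cauchy_transform_flow_law_subordinate[OF that] by (simp add: cauchy_transform_return)
  qed
qed

section \<open>Unimodality\<close>

text \<open>With \<open>a\<close> a maximum point as one end of the triple, the minimum in the
  quasi-concavity condition is the value at the other end, which is monotonicity on each side of
  \<open>a\<close>. The point mass at \<open>a\<close> is zero.\<close>

lemma unimodal_density:
  fixes p :: "real \<Rightarrow> real"
  assumes meas: "p \<in> borel_measurable borel"
    and nonneg: "\<And>x. p x \<ge> 0"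
    and max: "\<And>x. p x \<le> p a"
    and quasi: "\<And>x y z. x < y \<Longrightarrow> y < z \<Longrightarrow> min (p x) (p z) \<le> p y"
  shows "unimodal (density lborel (\<lambda>x. ennreal (p x)))"
  unfolding unimodal_def
proof (intro conjI exI[of _ a] exI[of _ p] allI ballI)
  show "mono_on {..<a} p"
  proof (rule mono_onI)
    fix x y assume "x \<in> {..<a}" "y \<in> {..<a}" "x \<le> y"
    then show "p x \<le> p y"
      using quasi[of x y a] max[of x] by (cases "x = y") auto
  qed
  show "antimono_on {a<..} p"
  proof (rule monotone_onI)
    fix x y assume "x \<in> {a<..}" "y \<in> {a<..}" "x \<le> y"
    then show "p y \<le> p x"
      using quasi[of a x y] max[of y] by (cases "x = y") auto
  qed
  fix A :: "real set" assume A: "A \<in> sets borel"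
  have "AE x in lborel. ennreal (p x) * indicator {a} x = 0"
    using AE_lborel_singleton[of a] by eventually_elim (auto simp: indicator_def)
  then have "emeasure (density lborel (\<lambda>x. ennreal (p x))) {a} = 0"
    using meas by (subst emeasure_density) (auto simp: nn_integral_0_iff_AE)
  then show "emeasure (density lborel (\<lambda>x. ennreal (p x))) A =
      emeasure (density lborel (\<lambda>x. ennreal (p x))) {a} * indicator A a + (\<integral>\<^sup>+ x\<in>A. ennreal (p x) \<partial>lborel)"
    using meas A by (simp add: emeasure_density)
qed (use nonneg in auto)

lemma continuous_decay_attains_max:
  fixes p :: "real \<Rightarrow> real"
  assumes cont: "continuous_on UNIV p" and decay: "\<And>x. p x \<le> C / (1 + \<bar>x\<bar>)" and pos: "p x0 > 0"
  shows "\<exists>a. \<forall>x. p x \<le> p a"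
proof -
  have "0 < C / (1 + \<bar>x0\<bar>)" using decay[of x0] pos by linarith
  then have C: "C > 0" by (simp add: zero_less_divide_iff) linarith
  \<comment> \<open>Beyond C / p(x0) the decay bound has fallen below p(x0), so the maximum over the
    compact interval is global.\<close>
  define R where "R = max \<bar>x0\<bar> (C / p x0)"
  have "compact {-R..R}" by simp
  moreover have "x0 \<in> {-R..R}" by (auto simp: R_def)
  ultimately obtain a where a: "a \<in> {-R..R}" "\<And>x. x \<in> {-R..R} \<Longrightarrow> p x \<le> p a"
    using continuous_attains_sup[of "{-R..R}" p] continuous_on_subset[OF cont] by (metis empty_iff top_greatest)
  have "p x \<le> p a" for x
  proof (cases "x \<in> {-R..R}")
    case False
    then have "\<bar>x\<bar> > R" by auto
    then have x: "C / p x0 < 1 + \<bar>x\<bar>" by (auto simp: R_def)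
    have "p x \<le> C / (1 + \<bar>x\<bar>)" by (rule decay)
    also have "\<dots> \<le> p x0" using x pos C by (simp add: divide_simps mult.commute split: if_splits)
    also have "\<dots> \<le> p a" using a \<open>x0 \<in> {-R..R}\<close> by blast
    finally show ?thesis .
  qed (use a in blast)
  then show ?thesis by blast
qed

section \<open>The energy along horizontal lines\<close>

context real_distribution
begin

lemma energy_Complex: "energy M (Complex x c) = (LINT u|M. 1 / ((x - u)\<^sup>2 + c\<^sup>2))"
  unfolding energy_def by (intro Bochner_Integration.integral_cong refl) (simp add: cmod_power2)

lemma integrable_energy_Complex:
  assumes "c > 0"
  shows "integrable M (\<lambda>u. 1 / ((x - u)\<^sup>2 + c\<^sup>2))"
  using integrable_energy[of "Complex x c"] assms by (simp add: cmod_power2)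

lemma energy_antimono:
  assumes "0 < c" "c \<le> c'"
  shows "energy M (Complex x c') \<le> energy M (Complex x c)"
  unfolding energy_Complex using assms
  by (intro integral_mono integrable_energy_Complex divide_left_mono add_left_mono power_mono mult_pos_pos)
     (auto simp: add_nonneg_pos)

lemma energy_mono_AE:
  assumes "0 < c" "AE u in M. \<bar>y - u\<bar> \<le> \<bar>x - u\<bar>"
  shows "energy M (Complex x c) \<le> energy M (Complex y c)"
  unfolding energy_Complex
proof (intro integral_mono_AE integrable_energy_Complex assms(1))
  show "AE u in M. 1 / ((x - u)\<^sup>2 + c\<^sup>2) \<le> 1 / ((y - u)\<^sup>2 + c\<^sup>2)"
    using assms(2)
    by eventually_elim (use assms(1) in \<open>auto intro!: divide_left_mono mult_pos_pos simp: add_nonneg_pos abs_le_square_iff\<close>)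
qed

lemma energy_ge_AE:
  assumes "0 < c" "AE u in M. \<bar>x - u\<bar> \<le> D"
  shows "1 / (D\<^sup>2 + c\<^sup>2) \<le> energy M (Complex x c)"
proof -
  have "(LINT u|M. 1 / (D\<^sup>2 + c\<^sup>2)) \<le> energy M (Complex x c)"
    unfolding energy_Complex
  proof (intro integral_mono_AE integrable_energy_Complex assms(1))
    show "AE u in M. 1 / (D\<^sup>2 + c\<^sup>2) \<le> 1 / ((x - u)\<^sup>2 + c\<^sup>2)"
      using assms(2)
    proof eventually_elim
      fix u assume u: "\<bar>x - u\<bar> \<le> D"
      have "(x - u)\<^sup>2 \<le> D\<^sup>2" using power_mono[OF u abs_ge_zero, of 2] by simp
      then show "1 / (D\<^sup>2 + c\<^sup>2) \<le> 1 / ((x - u)\<^sup>2 + c\<^sup>2)"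
        using assms(1) by (intro divide_left_mono mult_pos_pos) (auto simp: add_nonneg_pos)
    qed
  qed simp
  then show ?thesis by (simp add: prob_UNIV)
qed

lemma energy_le_AE:
  assumes "0 < c" "0 < L" "AE u in M. L \<le> \<bar>x - u\<bar>"
  shows "energy M (Complex x c) \<le> 1 / L\<^sup>2"
proof -
  have "energy M (Complex x c) \<le> (LINT u|M. 1 / L\<^sup>2)"
    unfolding energy_Complex
  proof (intro integral_mono_AE integrable_energy_Complex assms(1))
    show "AE u in M. 1 / ((x - u)\<^sup>2 + c\<^sup>2) \<le> 1 / L\<^sup>2"
      using assms(3)
    proof eventually_elim
      fix u assume u: "L \<le> \<bar>x - u\<bar>"
      have "L\<^sup>2 \<le> (x - u)\<^sup>2" using power_mono[OF u, of 2] assms(2) by simp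
      then show "1 / ((x - u)\<^sup>2 + c\<^sup>2) \<le> 1 / L\<^sup>2"
        using assms(1,2) by (intro divide_left_mono mult_pos_pos) (auto simp: add_nonneg_pos intro: order_trans)
    qed
  qed simp
  then show ?thesis by (simp add: prob_UNIV)
qed

end

text \<open>The inflection points of the kernel are at c/sqrt 3 and -c/sqrt 3; this is the source of
  the factor 3.\<close>

lemma concave_on_cauchy_kernel:
  fixes c D :: real
  assumes "c > 0" "3 * D\<^sup>2 \<le> c\<^sup>2"
  shows "concave_on {-D..D} (\<lambda>v. 1 / (v\<^sup>2 + c\<^sup>2))"
proof (rule f''_le0_imp_concave)
  have pos: "v\<^sup>2 + c\<^sup>2 > 0" for v using assms by (simp add: add_nonneg_pos)
  show "((\<lambda>v. 1 / (v\<^sup>2 + c\<^sup>2)) has_real_derivative - 2 * v / (v\<^sup>2 + c\<^sup>2)\<^sup>2) (at v)" for v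
    using pos[of v] assms(1) by (auto intro!: derivative_eq_intros simp: power2_eq_square)
  show "((\<lambda>v. - 2 * v / (v\<^sup>2 + c\<^sup>2)\<^sup>2) has_real_derivative (6 * v\<^sup>2 - 2 * c\<^sup>2) / (v\<^sup>2 + c\<^sup>2) ^ 3) (at v)" for v
  proof -
    define q where "q = v\<^sup>2 + c\<^sup>2"
    have q: "q \<noteq> 0" using pos[of v] unfolding q_def by linarith
    have "((\<lambda>v. - 2 * v / (v\<^sup>2 + c\<^sup>2)\<^sup>2) has_real_derivative
        ((- 2) * (v\<^sup>2 + c\<^sup>2)\<^sup>2 - (- 2 * v) * (2 * (v\<^sup>2 + c\<^sup>2) * (2 * v))) / ((v\<^sup>2 + c\<^sup>2)\<^sup>2 * (v\<^sup>2 + c\<^sup>2)\<^sup>2)) (at v)"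
      using pos[of v] assms(1) by (auto intro!: derivative_eq_intros)
        (simp only: minus_divide_left, intro arg_cong2[where f = "(/)"] refl, simp add: algebra_simps)
    also have "((- 2) * (v\<^sup>2 + c\<^sup>2)\<^sup>2 - (- 2 * v) * (2 * (v\<^sup>2 + c\<^sup>2) * (2 * v))) / ((v\<^sup>2 + c\<^sup>2)\<^sup>2 * (v\<^sup>2 + c\<^sup>2)\<^sup>2)
        = (8 * v\<^sup>2 - 2 * q) / q ^ 3"
      unfolding q_def[symmetric] using q by (simp add: field_simps power2_eq_square power3_eq_cube)
    also have "(8 * v\<^sup>2 - 2 * q) = 6 * v\<^sup>2 - 2 * c\<^sup>2" by (simp add: q_def)
    finally show ?thesis by (simp add: q_def)
  qed
  show "(6 * v\<^sup>2 - 2 * c\<^sup>2) / (v\<^sup>2 + c\<^sup>2) ^ 3 \<le> 0" if "v \<in> {-D..D}" for v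
  proof -
    have "\<bar>v\<bar> \<le> D" using that by auto
    then have "v\<^sup>2 \<le> D\<^sup>2" using power_mono[of "\<bar>v\<bar>" D 2] by simp
    then show ?thesis using assms(2) pos[of v] by (intro divide_nonpos_pos) auto
  qed
qed simp

context real_distribution
begin

text \<open>For x and u in [a, b] the difference x - u stays in the interval where the kernel is
  concave. The energy is thus an average of functions concave on [a, b], and a concave function is
  at least the smaller of its values at two surrounding points.\<close>

lemma energy_concave_min:
  assumes c: "c > 0" and D: "3 * (b - a)\<^sup>2 \<le> c\<^sup>2" and supp: "AE u in M. a \<le> u \<and> u \<le> b"
    and x: "a \<le> x" "x \<le> y" "y \<le> z" "z \<le> b"
  shows "min (energy M (Complex x c)) (energy M (Complex z c)) \<le> energy M (Complex y c)"
proof -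
  obtain l where l: "0 \<le> l" "l \<le> 1" "y = (1 - l) * x + l * z"
  proof (cases "x = z")
    case True
    then show ?thesis using x that[of 0] by simp
  next
    case False
    then show ?thesis using x that[of "(y - x) / (z - x)"]
      by (auto simp: divide_simps) (auto simp: algebra_simps)
  qed
  have "(1 - l) * energy M (Complex x c) + l * energy M (Complex z c)
      = (LINT u|M. (1 - l) * (1 / ((x - u)\<^sup>2 + c\<^sup>2)) + l * (1 / ((z - u)\<^sup>2 + c\<^sup>2)))"
    unfolding energy_Complex
    by (subst Bochner_Integration.integral_add) (intro integrable_mult_right integrable_energy_Complex c | simp only: integral_mult_right_zero)+
  also have "\<dots> \<le> energy M (Complex y c)"
    unfolding energy_Complex
  proof (intro integral_mono_AE integrable_energy_Complex c Bochner_Integration.integrable_add integrable_mult_right)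
    show "AE u in M. (1 - l) * (1 / ((x - u)\<^sup>2 + c\<^sup>2)) + l * (1 / ((z - u)\<^sup>2 + c\<^sup>2)) \<le> 1 / ((y - u)\<^sup>2 + c\<^sup>2)"
      using supp
    proof eventually_elim
      fix u assume u: "a \<le> u \<and> u \<le> b"
      have "x - u \<in> {-(b - a)..b - a}" "z - u \<in> {-(b - a)..b - a}" using u x by auto
      from concave_onD[OF concave_on_cauchy_kernel[OF c D] l(1,2) this]
      have "(1 - l) * (1 / ((x - u)\<^sup>2 + c\<^sup>2)) + l * (1 / ((z - u)\<^sup>2 + c\<^sup>2)) \<le> 1 / (((1 - l) * (x - u) + l * (z - u))\<^sup>2 + c\<^sup>2)"
        by simp
      also have "(1 - l) * (x - u) + l * (z - u) = y - u" by (simp add: l(3) algebra_simps)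
      finally show "(1 - l) * (1 / ((x - u)\<^sup>2 + c\<^sup>2)) + l * (1 / ((z - u)\<^sup>2 + c\<^sup>2)) \<le> 1 / ((y - u)\<^sup>2 + c\<^sup>2)" .
    qed
  qed
  finally have 1: "(1 - l) * energy M (Complex x c) + l * energy M (Complex z c) \<le> energy M (Complex y c)" .
  define m where "m = min (energy M (Complex x c)) (energy M (Complex z c))"
  have "(1 - l) * m + l * m \<le> (1 - l) * energy M (Complex x c) + l * energy M (Complex z c)"
    using l by (intro add_mono mult_left_mono) (auto simp: m_def)
  then have "m \<le> energy M (Complex y c)" using 1 by (simp add: algebra_simps)
  then show ?thesis by (simp add: m_def)
qed

text \<open>At heights \<open>c\<close> with \<open>c\<^sup>2 + (b - a)\<^sup>2 \<le> t\<close> the energy is at least \<open>1 / t\<close> over all of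
  \<open>[a, b]\<close>; at larger heights it is concave there because \<open>t \<ge> 4 * (b - a)\<^sup>2\<close>.\<close>

lemma energy_superlevel_interval:
  assumes c: "c > 0" and t: "t > 0" "t \<ge> 4 * (b - a)\<^sup>2" and supp: "AE u in M. a \<le> u \<and> u \<le> b"
    and s: "s < 1 / t" and xyz: "x < y" "y < z"
    and x: "s < energy M (Complex x c)" and z: "s < energy M (Complex z c)"
  shows "s < energy M (Complex y c)"
proof -
  consider "y \<le> a" | "b \<le> y" | "a < y" "y < b" "c\<^sup>2 + (b - a)\<^sup>2 \<le> t" | "a < y" "y < b" "c\<^sup>2 + (b - a)\<^sup>2 > t"
    by linarith
  then show ?thesis
  proof cases
    case 1
    have "AE u in M. \<bar>y - u\<bar> \<le> \<bar>x - u\<bar>" using supp by eventually_elim (use 1 xyz in auto)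
    from energy_mono_AE[OF c this] x show ?thesis by linarith
  next
    case 2
    have "AE u in M. \<bar>y - u\<bar> \<le> \<bar>z - u\<bar>" using supp by eventually_elim (use 2 xyz in auto)
    from energy_mono_AE[OF c this] z show ?thesis by linarith
  next
    case 3
    have "AE u in M. \<bar>y - u\<bar> \<le> b - a" using supp by eventually_elim (use 3 in auto)
    from energy_ge_AE[OF c this] have "1 / ((b - a)\<^sup>2 + c\<^sup>2) \<le> energy M (Complex y c)" .
    moreover have "1 / t \<le> 1 / ((b - a)\<^sup>2 + c\<^sup>2)"
      using 3 c t by (intro divide_left_mono mult_pos_pos) (auto simp: add_nonneg_pos)
    ultimately show ?thesis using s by linarith
  next
    case 4
    have D: "3 * (b - a)\<^sup>2 \<le> c\<^sup>2" using 4 t by linarith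
    \<comment> \<open>Replacing an outer point by the nearest point of [a, b] brings it closer to
      almost all the mass, so the energy can only grow; afterwards concavity on [a, b]
      applies.\<close>
    define x' where "x' = max x a"
    define z' where "z' = min z b"
    have "AE u in M. \<bar>x' - u\<bar> \<le> \<bar>x - u\<bar>" using supp by eventually_elim (auto simp: x'_def)
    from energy_mono_AE[OF c this] x have 1: "s < energy M (Complex x' c)" by linarith
    have "AE u in M. \<bar>z' - u\<bar> \<le> \<bar>z - u\<bar>" using supp by eventually_elim (auto simp: z'_def)
    from energy_mono_AE[OF c this] z have 2: "s < energy M (Complex z' c)" by linarith
    have "min (energy M (Complex x' c)) (energy M (Complex z' c)) \<le> energy M (Complex y c)"
      using 4 xyz by (intro energy_concave_min[OF c D supp]) (auto simp: x'_def z'_def)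
    then show ?thesis using 1 2 by auto
  qed
qed

end

section \<open>Level curves of Im H and quasi-concavity of the density\<close>

locale unimodal_flow = semicircular_flow +
  assumes superlevel: "\<And>c s x y z. 0 < c \<Longrightarrow> s < 1 / t \<Longrightarrow> x < y \<Longrightarrow> y < z \<Longrightarrow>
    s < energy M (Complex x c) \<Longrightarrow> s < energy M (Complex z c) \<Longrightarrow> s < energy M (Complex y c)"
begin

text \<open>On a vertical line Im H = c (1 - t I), and this product increases strictly with the
  height c from where it is positive on. If the energy at the lower height were at most the stated
  level, Im H would already be at least \<open>e\<close> there and so exceed \<open>e\<close> at
  \<open>w\<close>.\<close>

lemma energy_below_level:
  assumes w: "w \<in> \<Omega>" and H: "Im (H w) = e" and e: "e > 0" and c: "0 < c" "c < Im w"
  shows "(1 - e / c) / t < energy M (Complex (Re w) c)"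
proof (rule ccontr)
  define E where "E = energy M (Complex (Re w) c)"
  define E' where "E' = energy M w"
  assume "\<not> (1 - e / c) / t < energy M (Complex (Re w) c)"
  then have "t * E \<le> 1 - e / c"
    using t_pos by (simp add: E_def not_less field_simps)
  then have 1: "e / c \<le> 1 - t * E" by simp
  then have "e \<le> c * (1 - t * E)" using c by (simp add: field_simps)
  have "0 < e / c" using e c by simp
  then have pos: "0 < 1 - t * E" using 1 by linarith
  have "E' \<le> E"
    unfolding E_def E'_def using energy_antimono[of c "Im w" "Re w"] c by simp
  then have "1 - t * E \<le> 1 - t * E'" using t_pos by simp
  have "c * (1 - t * E) < Im w * (1 - t * E)" using pos c by simp
  also have "\<dots> \<le> Im w * (1 - t * E')" using \<open>1 - t * E \<le> 1 - t * E'\<close> c by (intro mult_left_mono) auto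
  also have "\<dots> = e" using Im_H[of w] H c by (simp add: E'_def)
  finally show False using \<open>e \<le> c * (1 - t * E)\<close> by linarith
qed

lemma energy_at_level:
  assumes w: "w \<in> \<Omega>" and H: "Im (H w) = e"
  shows "energy M w = (1 - e / Im w) / t"
proof -
  have "Im w > 0" by (rule Omega_Im[OF w])
  moreover have "e = Im w * (1 - t * energy M w)" using Im_H[OF \<open>Im w > 0\<close>] H by simp
  ultimately show ?thesis using t_pos by simp
qed

context
  fixes e :: real
  assumes e: "e > 0"
begin

definition level_omega :: "real \<Rightarrow> complex" where
  "level_omega x = \<omega> (Complex x e)"

lemma level_omega: "level_omega x \<in> \<Omega>" "H (level_omega x) = Complex x e" "Im (level_omega x) > 0"
  using e by (auto simp: level_omega_def H_omega intro: omega_in_Omega Im_omega_pos)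

text \<open>Of two points of the curve with the same abscissa, the lower one would lie strictly
  below the curve, where the energy exceeds the value that it must have on the curve. So the curve
  is a graph.\<close>

lemma level_omega_Re_inj: "inj (\<lambda>x. Re (level_omega x))"
proof (rule injI)
  fix x y assume Re_eq: "Re (level_omega x) = Re (level_omega y)"
  have *: "\<not> Im (level_omega x) < Im (level_omega y)" if "Re (level_omega x) = Re (level_omega y)" for x y
  proof
    assume less: "Im (level_omega x) < Im (level_omega y)"
    have "(1 - e / Im (level_omega x)) / t < energy M (Complex (Re (level_omega y)) (Im (level_omega x)))"
      using energy_below_level[of "level_omega y" e "Im (level_omega x)"] level_omega e less by simp
    moreover have "Complex (Re (level_omega y)) (Im (level_omega x)) = level_omega x"
      using that by (simp add: complex_eq_iff)
    ultimately show False
      using energy_at_level[of "level_omega x" e] level_omega by simp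
  qed
  have "level_omega x = level_omega y"
    using *[OF Re_eq] *[OF Re_eq[symmetric]] Re_eq by (simp add: complex_eq_iff)
  then have "Complex x e = Complex y e" using level_omega(2) by metis
  then show "x = y" by simp
qed

lemma level_omega_Re_continuous: "continuous_on UNIV (\<lambda>x. Re (level_omega x))"
proof -
  have "continuous_on UNIV (\<lambda>x. \<omega> (complex_of_real x + \<i> * complex_of_real e))"
    by (rule continuous_on_compose2[OF holomorphic_on_imp_continuous_on[OF holomorphic_omega]])
       (use e in \<open>auto intro!: continuous_intros\<close>)
  moreover have "complex_of_real x + \<i> * complex_of_real e = Complex x e" for x by (simp add: complex_eq_iff)
  ultimately show ?thesis unfolding level_omega_def by (auto intro!: continuous_intros)
qed

text \<open>Suppose the height dips at \<open>y\<close> to c, and let s be the energy at that point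
  of the curve. The points for \<open>x\<close> and \<open>z\<close> lie above height c, so at
  height c under them the energy exceeds s. The interval property of superlevel sets transfers this
  to the point for \<open>y\<close>, where the energy equals s.\<close>

lemma level_omega_quasiconcave:
  assumes "x < y" "y < z"
  shows "min (Im (level_omega x)) (Im (level_omega z)) \<le> Im (level_omega y)"
proof (rule ccontr)
  define c where "c = Im (level_omega y)"
  define s where "s = (1 - e / c) / t"
  have c: "c > 0" by (simp add: c_def level_omega)
  assume "\<not> ?thesis"
  then have less: "c < Im (level_omega x)" "c < Im (level_omega z)" by (auto simp: c_def)
  have 1: "s < energy M (Complex (Re (level_omega x)) c)"
    unfolding s_def by (rule energy_below_level) (use level_omega e c less in auto)
  have 2: "s < energy M (Complex (Re (level_omega z)) c)"
    unfolding s_def by (rule energy_below_level) (use level_omega e c less in auto)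
  have s: "s < 1 / t" unfolding s_def using e c t_pos by (intro divide_strict_right_mono) auto
  have "continuous_on {x..z} (\<lambda>x. Re (level_omega x))" "inj_on (\<lambda>x. Re (level_omega x)) {x..z}"
    using level_omega_Re_continuous level_omega_Re_inj by (auto intro: continuous_on_subset inj_on_subset)
  \<comment> \<open>A continuous injective function is strictly monotone, so the middle abscissa
    lies between the outer two. The direction is left open, as \<open>superlevel\<close> treats the
    two ends alike.\<close>
  from continuous_inj_imp_mono[OF assms this]
  have "s < energy M (Complex (Re (level_omega y)) c)"
    using superlevel[OF c s] 1 2 by blast
  then have "s < energy M (level_omega y)" by (simp add: c_def)
  then show False
    using energy_at_level[of "level_omega y" e] level_omega by (simp add: s_def c_def)
qed

end

lemma flow_density_quasiconcave:
  assumes "x < y" "y < z"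
  shows "min (flow_density x) (flow_density z) \<le> flow_density y"
proof -
  have lim: "(\<lambda>n. Im (\<omega> (approach x n))) \<longlonglongrightarrow> Im (omega_bd x)" for x
    by (intro tendsto_intros omega_approach_tendsto)
  have "min (Im (omega_bd x)) (Im (omega_bd z)) \<le> Im (omega_bd y)"
  proof (rule LIMSEQ_le)
    show "(\<lambda>n. min (Im (\<omega> (approach x n))) (Im (\<omega> (approach z n)))) \<longlonglongrightarrow> min (Im (omega_bd x)) (Im (omega_bd z))"
      by (intro tendsto_min lim)
    show "\<exists>N. \<forall>n\<ge>N. min (Im (\<omega> (approach x n))) (Im (\<omega> (approach z n))) \<le> Im (\<omega> (approach y n))"
      using level_omega_quasiconcave[OF _ assms] by (intro exI[of _ 0] allI impI) (simp add: level_omega_def approach_def)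
  qed (rule lim)
  then have "min (Im (omega_bd x)) (Im (omega_bd z)) / (pi * t) \<le> Im (omega_bd y) / (pi * t)"
    using t_pos by (intro divide_right_mono) auto
  then show ?thesis
    using t_pos by (simp add: flow_density_def min_divide_distrib_right)
qed

lemma unimodal_flow_law: "unimodal flow_law"
proof -
  have "\<exists>x. flow_density x > 0"
  proof (rule ccontr)
    assume "\<not> (\<exists>x. flow_density x > 0)"
    then have "flow_density x = 0" for x
      by (intro order_antisym flow_density_nonneg) (auto simp: not_less)
    then have "flow_density = (\<lambda>x. 0)" by (rule ext)
    then show False using has_bochner_integral_flow_density by (simp add: has_bochner_integral_iff)
  qed
  then obtain a where "\<And>x. flow_density x \<le> flow_density a"
    using continuous_decay_attains_max[OF continuous_on_flow_density flow_density_le] by blast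
  then show ?thesis
    unfolding flow_law_def
    by (rule unimodal_density[OF borel_measurable_flow_density flow_density_nonneg _ flow_density_quasiconcave])
qed

end

text \<open>The complement of the support is a union of open null sets; by the Lindelof property
  countably many of them suffice, so it is null.\<close>

lemma AE_msupport:
  assumes sets: "sets \<mu> = sets borel"
  shows "AE x in \<mu>. x \<in> msupport \<mu>"
proof -
  define F where "F = {U. open U \<and> emeasure \<mu> U = 0}"
  obtain F' where F': "F' \<subseteq> F" "countable F'" "\<Union>F' = \<Union>F"
    by (rule Lindelof[of F]) (auto simp: F_def)
  have "(\<Union>U\<in>F'. U) \<in> null_sets \<mu>"
    using F' by (intro null_sets_UN') (auto simp: F_def null_sets_def sets)
  then have "\<Union>F' \<in> null_sets \<mu>" by simp
  then have "AE x in \<mu>. x \<notin> \<Union>F'" by (rule AE_not_in)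
  moreover have "x \<in> msupport \<mu>" if "x \<notin> \<Union>F'" for x
    using that unfolding F'(3) by (auto simp: F_def msupport_def zero_less_iff_neq_zero)
  ultimately show ?thesis by (auto elim: eventually_mono)
qed

theorem unimodal_compact_support:
  assumes \<mu>: "real_distribution \<mu>" and comp: "compact (msupport \<mu>)"
    and t: "t > 0" "t \<ge> 4 * (diameter (msupport \<mu>))\<^sup>2"
  shows "unimodal (\<mu> \<boxplus> semicircle t)"
proof -
  interpret real_distribution \<mu> by fact
  define K where "K = msupport \<mu>"
  have AE_K: "AE x in \<mu>. x \<in> K" unfolding K_def by (rule AE_msupport) simp
  have "K \<noteq> {}"
  proof
    assume "K = {}"
    with AE_K show False using prob_space_axioms AE_False by simp
  qed
  define a where "a = Inf K"
  define b where "b = Sup K"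
  have K: "compact K" using comp by (simp add: K_def)
  have ab: "a \<in> K" "b \<in> K"
    unfolding a_def b_def using K \<open>K \<noteq> {}\<close>
    by (auto intro!: closed_contains_Inf closed_contains_Sup compact_imp_closed
        bounded_imp_bdd_below bounded_imp_bdd_above compact_imp_bounded)
  have K_sub: "a \<le> x \<and> x \<le> b" if "x \<in> K" for x
    unfolding a_def b_def using that K
    by (auto intro!: cInf_lower cSup_upper bounded_imp_bdd_below bounded_imp_bdd_above compact_imp_bounded)
  have supp: "AE u in \<mu>. a \<le> u \<and> u \<le> b"
    using AE_K by eventually_elim (rule K_sub)
  have "b - a \<le> diameter K"
    using diameter_bounded_bound[OF compact_imp_bounded[OF K] ab(2,1)] by (simp add: dist_real_def)
  then have "(b - a)\<^sup>2 \<le> (diameter K)\<^sup>2"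
    using K_sub[OF ab(1)] by (intro power_mono) auto
  then have t': "t \<ge> 4 * (b - a)\<^sup>2" using t(2) by (simp add: K_def)
  have "integrable \<mu> (\<lambda>u. u\<^sup>2)"
  proof (rule integrable_const_bound)
    show "AE u in \<mu>. norm (u\<^sup>2) \<le> (\<bar>a\<bar> + \<bar>b\<bar>)\<^sup>2"
      using supp
    proof eventually_elim
      fix u assume "a \<le> u \<and> u \<le> b"
      then have "\<bar>u\<bar> \<le> \<bar>a\<bar> + \<bar>b\<bar>" by auto
      then show "norm (u\<^sup>2) \<le> (\<bar>a\<bar> + \<bar>b\<bar>)\<^sup>2"
        using power_mono[of "\<bar>u\<bar>" "\<bar>a\<bar> + \<bar>b\<bar>" 2] by simp
    qed
  qed measurable
  then interpret unimodal_flow \<mu> t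
    using t(1) energy_superlevel_interval[OF _ t(1) t' supp]
    by unfold_locales
  show ?thesis
    unfolding free_convolution_semicircle by (rule unimodal_flow_law)
qed

section \<open>Measures with gaps\<close>

lemma emeasure_continuous_density_pos:
  fixes p :: "real \<Rightarrow> real"
  assumes cont: "continuous_on UNIV p" and U: "open U" "x \<in> U" and pos: "p x > 0"
  shows "emeasure (density lborel (\<lambda>x. ennreal (p x))) U > 0"
proof -
  define c where "c = p x / 2"
  have c: "c > 0" using pos by (simp add: c_def)
  have "open (U \<inter> {y. c < p y})"
    using cont by (intro open_Int U open_Collect_less continuous_on_const)
  moreover have "x \<in> U \<inter> {y. c < p y}" using U pos by (simp add: c_def)
  ultimately obtain d where d: "d > 0" "ball x d \<subseteq> U \<inter> {y. c < p y}"
    by (meson openE)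
  have "0 < ennreal c * emeasure lborel {x - d<..<x + d}"
    using c d by (simp add: ennreal_zero_less_mult_iff)
  also have "\<dots> = (\<integral>\<^sup>+ y. ennreal c * indicator {x - d<..<x + d} y \<partial>lborel)"
    by (subst nn_integral_cmult_indicator) auto
  also have "\<dots> \<le> (\<integral>\<^sup>+ y. ennreal (p y) * indicator U y \<partial>lborel)"
  proof (rule nn_integral_mono)
    fix y
    show "ennreal c * indicator {x - d<..<x + d} y \<le> ennreal (p y) * indicator U y"
    proof (cases "y \<in> {x - d<..<x + d}")
      case True
      then have "y \<in> ball x d" by (auto simp: dist_real_def)
      then have "y \<in> U" "c < p y" using d by auto
      then show ?thesis using True by (simp add: ennreal_leI)
    qed simp
  qed
  also have "\<dots> = emeasure (density lborel (\<lambda>x. ennreal (p x))) U"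
    using borel_measurable_continuous_onI[OF cont] U by (subst emeasure_density) auto
  finally show ?thesis .
qed

text \<open>The mode \<open>a\<close> leaves at least one half of the gap entirely on one of its
  sides. There \<open>f\<close> is monotone away from \<open>a\<close> and must vanish within the
  gap, hence also beyond it, so all mass on that side of the gap is lost.\<close>

lemma not_unimodal_gap:
  assumes mass: "emeasure \<rho> {..<z1} > 0" "emeasure \<rho> {z2<..} > 0"
    and gap: "z1 < z2" "emeasure \<rho> {z1<..<z2} = 0"
  shows "\<not> unimodal \<rho>"
proof
  assume uni: "unimodal \<rho>"
  then have sets: "sets \<rho> = sets borel" by (simp add: unimodal_def)
  obtain a f where F: "(\<forall>x. 0 \<le> f x) \<and> mono_on {..<a} f \<and> antimono_on {a<..} f \<and>
      (\<forall>A\<in>sets borel. emeasure \<rho> A = emeasure \<rho> {a} * indicator A a + (\<integral>\<^sup>+ x\<in>A. ennreal (f x) \<partial>lborel))"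
    using uni[unfolded unimodal_def, THEN conjunct2] by (elim exE) (rule that)
  note f = F[THEN conjunct1, rule_format] F[THEN conjunct2, THEN conjunct1]
    F[THEN conjunct2, THEN conjunct2, THEN conjunct1]
  note em = F[THEN conjunct2, THEN conjunct2, THEN conjunct2, rule_format]
  have zero: "c = 0" if "u < v" "{u<..<v} \<subseteq> {z1<..<z2}" "\<And>y. y \<in> {u<..<v} \<Longrightarrow> c \<le> f y" "0 \<le> c" for c u v
  proof -
    have "ennreal c * emeasure lborel {u<..<v} = (\<integral>\<^sup>+ y. ennreal c * indicator {u<..<v} y \<partial>lborel)"
      by (subst nn_integral_cmult_indicator) auto
    also have "\<dots> \<le> (\<integral>\<^sup>+ y\<in>{z1<..<z2}. ennreal (f y) \<partial>lborel)"
    proof (rule nn_integral_mono)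
      fix y
      show "ennreal c * indicator {u<..<v} y \<le> ennreal (f y) * indicator {z1<..<z2} y"
      proof (cases "y \<in> {u<..<v}")
        case True
        then have "y \<in> {z1<..<z2}" using that(2) by blast
        then show ?thesis using True that(3)[OF True] by (simp add: ennreal_leI)
      qed simp
    qed
    also have "\<dots> \<le> emeasure \<rho> {z1<..<z2}" by (subst em) (auto intro: add_increasing)
    finally have "ennreal c * emeasure lborel {u<..<v} = 0" using gap by simp
    then show "c = 0" using that(1,4) by (simp add: ennreal_eq_0_iff)
  qed
  define m where "m = (z1 + z2) / 2"
  show False
  proof (cases "a \<le> m")
    case True
    \<comment> \<open>A point strictly inside the right half: on (m, s) the values of
      \<open>f\<close> are at least \<open>f s\<close>, so the massless gap forces
      \<open>f s = 0\<close>.\<close>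
    define s where "s = (m + z2) / 2"
    have ord: "z1 < m" "m < s" "s < z2" using gap(1) by (auto simp: m_def s_def field_simps)
    have "f s = 0"
    proof (rule zero[OF ord(2)])
      show "{m<..<s} \<subseteq> {z1<..<z2}" using ord by auto
      show "f s \<le> f y" if "y \<in> {m<..<s}" for y
        using that True ord by (intro monotone_onD[OF f(3)]) auto
    qed (rule f(1))
    have "f y = 0" if "y > z2" for y
    proof -
      have "f y \<le> f s" using that True ord by (intro monotone_onD[OF f(3)]) auto
      then show ?thesis using \<open>f s = 0\<close> f(1)[of y] by simp
    qed
    then have "(\<integral>\<^sup>+ x\<in>{z2<..}. ennreal (f x) \<partial>lborel) = (\<integral>\<^sup>+ x. 0 \<partial>(lborel :: real measure))"
      by (intro nn_integral_cong) (auto simp: indicator_def)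
    moreover have "a \<notin> {z2<..}" using True ord by auto
    ultimately have "emeasure \<rho> {z2<..} = 0" by (subst em) auto
    then show False using mass by simp
  next
    case False
    define s where "s = (z1 + m) / 2"
    have ord: "z1 < s" "s < m" "m < z2" using gap(1) by (auto simp: m_def s_def field_simps)
    have "f s = 0"
    proof (rule zero[OF ord(2)])
      show "{s<..<m} \<subseteq> {z1<..<z2}" using ord by auto
      show "f s \<le> f y" if "y \<in> {s<..<m}" for y
        using that False ord by (intro mono_onD[OF f(2)]) auto
    qed (rule f(1))
    have "f y = 0" if "y < z1" for y
    proof -
      have "f y \<le> f s" using that False ord by (intro mono_onD[OF f(2)]) auto
      then show ?thesis using \<open>f s = 0\<close> f(1)[of y] by simp
    qed
    then have "(\<integral>\<^sup>+ x\<in>{..<z1}. ennreal (f x) \<partial>lborel) = (\<integral>\<^sup>+ x. 0 \<partial>(lborel :: real measure))"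
      by (intro nn_integral_cong) (auto simp: indicator_def)
    moreover have "a \<notin> {..<z1}" using False ord by auto
    ultimately have "emeasure \<rho> {..<z1} = 0" by (subst em) auto
    then show False using mass by simp
  qed
qed

section \<open>The density inside a gap and near an atom\<close>

context semicircular_flow
begin

text \<open>The product kernel is at most the mean of the two energy kernels, so |t J| \<le> 1 and
  |1 - t J| \<le> 2. This lets H extend continuously to real points approached from within
  \<Omega>.\<close>

lemma H_lipschitz:
  assumes "w \<in> \<Omega>" "w' \<in> \<Omega>"
  shows "cmod (H w - H w') \<le> 2 * cmod (w - w')"
proof -
  have Im: "Im w > 0" "Im w' > 0" using assms Omega_Im by auto
  define J where "J = (CLINT u|M. 1 / ((w - complex_of_real u) * (w' - complex_of_real u)))"
  have "cmod J \<le> (LINT u|M. (1 / (cmod (w - complex_of_real u))\<^sup>2 + 1 / (cmod (w' - complex_of_real u))\<^sup>2) / 2)"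
    unfolding J_def
  proof (rule norm_integral_le_integral)
    fix u
    have "2 * (1 / cmod (w - complex_of_real u)) * (1 / cmod (w' - complex_of_real u))
        \<le> (1 / cmod (w - complex_of_real u))\<^sup>2 + (1 / cmod (w' - complex_of_real u))\<^sup>2"
      by (rule sum_squares_bound)
    then show "cmod (1 / ((w - complex_of_real u) * (w' - complex_of_real u)))
       \<le> (1 / (cmod (w - complex_of_real u))\<^sup>2 + 1 / (cmod (w' - complex_of_real u))\<^sup>2) / 2"
      by (simp add: norm_divide norm_mult power_divide)
  qed (intro integrable_divide Bochner_Integration.integrable_add integrable_energy Im)
  also have "\<dots> = (energy M w + energy M w') / 2"
    unfolding energy_def using integrable_energy[OF Im(1)] integrable_energy[OF Im(2)] by simp
  also have "\<dots> \<le> 1 / t" using Omega_energy_le[OF assms(1)] Omega_energy_le[OF assms(2)] by simp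
  finally have J: "t * cmod J \<le> 1" using t_pos by (simp add: field_simps)
  have "H w - H w' = (w - w') + t * (cauchy_transform M w - cauchy_transform M w')"
    by (simp add: H_def algebra_simps)
  then have HH: "H w - H w' = (w - w') * (1 - t * J)"
    unfolding cauchy_transform_diff[OF Im] J_def[symmetric] by (simp add: algebra_simps)
  have "cmod (1 - t * J) \<le> 2"
    using norm_triangle_ineq4[of 1 "t * J"] J t_pos by (simp add: norm_mult)
  then have "cmod (w - w') * cmod (1 - t * J) \<le> cmod (w - w') * 2" by (intro mult_left_mono) auto
  then show ?thesis by (simp add: HH norm_mult)
qed

text \<open>Reads off boundary values from the side of \<Omega>: it is enough to exhibit points of
  \<Omega> whose images tend to \<open>x\<close>.\<close>

lemma omega_bd_eqI:
  assumes "v \<longlonglongrightarrow> w" "\<And>n. v n \<in> \<Omega>" "(\<lambda>n. H (v n)) \<longlonglongrightarrow> complex_of_real x"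
  shows "omega_bd x = w"
proof -
  have "(\<lambda>n. \<omega> (H (v n))) \<longlonglongrightarrow> omega_bd x"
    using assms(2) by (intro omega_tendsto_boundary assms(3)) (auto simp: Omega_iff_Im_H)
  then have "v \<longlonglongrightarrow> omega_bd x" using assms(2) by (simp add: omega_H)
  then show ?thesis using assms(1) LIMSEQ_unique by blast
qed

text \<open>Around the centre of the gap the energy is so small that \<Omega> reaches down to the
  real line. There H extends to a continuous real function \<open>h\<close> that moves points by at
  most sqrt t. At each value of \<open>h\<close> the boundary value of \<omega> is real, so the
  density vanishes, and the intermediate value theorem shows that \<open>h\<close> attains
  \<open>y\<close>.\<close>

lemma flow_density_zero_in_gap:
  assumes gap: "AE u in M. \<bar>m - u\<bar> \<ge> 4 * sqrt t" and y: "\<bar>y - m\<bar> \<le> sqrt t"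
  shows "flow_density y = 0"
proof -
  \<comment> \<open>The half-width 2 sqrt t balances two needs: points of \<open>I\<close> remain 2
    sqrt t away from the mass, so that t times the energy is at most 1/4, and after the displacement
    by sqrt t the values of \<open>h\<close> still cover the interval of half-width sqrt t.\<close>
  define I where "I = {m - 2 * sqrt t..m + 2 * sqrt t}"
  have Om: "approach x n \<in> \<Omega>" if "x \<in> I" for x n
  proof -
    have "AE u in M. 2 * sqrt t \<le> \<bar>x - u\<bar>"
      using gap by eventually_elim (use that in \<open>auto simp: I_def\<close>)
    then have "energy M (approach x n) \<le> 1 / (2 * sqrt t)\<^sup>2"
      unfolding approach_def using t_pos by (intro energy_le_AE) auto
    then have "t * energy M (approach x n) \<le> 1 / 4"
      using t_pos by (simp add: power_mult_distrib field_simps)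
    then show ?thesis using Im_approach_pos by (simp add: \<Omega>_def)
  qed
  define h where "h = (\<lambda>x. lim (\<lambda>n. H (approach x n)))"
  have h: "(\<lambda>n. H (approach x n)) \<longlonglongrightarrow> h x" if "x \<in> I" for x
  proof -
    have "Cauchy (\<lambda>n. H (approach x n))"
    proof (rule CauchyI)
      fix e :: real assume "e > 0"
      then have "e / 2 > 0" by simp
      then obtain N where N: "\<And>m n. m \<ge> N \<Longrightarrow> n \<ge> N \<Longrightarrow> cmod (approach x m - approach x n) < e / 2"
        using CauchyD[OF LIMSEQ_imp_Cauchy[OF approach_tendsto]] by metis
      have "cmod (H (approach x m) - H (approach x n)) < e" if "m \<ge> N" "n \<ge> N" for m n
        using H_lipschitz[OF Om[OF \<open>x \<in> I\<close>, of m] Om[OF \<open>x \<in> I\<close>, of n]] N[OF that] by linarith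
      then show "\<exists>N. \<forall>m\<ge>N. \<forall>n\<ge>N. cmod (H (approach x m) - H (approach x n)) < e" by blast
    qed
    then show ?thesis unfolding h_def by (simp add: Cauchy_convergent convergent_LIMSEQ_iff[symmetric])
  qed
  have h_real: "h x = complex_of_real (Re (h x))" if x: "x \<in> I" for x
  proof -
    have "(\<lambda>n. Im (H (approach x n))) \<longlonglongrightarrow> 0"
    proof (rule Lim_null_comparison)
      show "\<forall>\<^sub>F n in sequentially. norm (Im (H (approach x n))) \<le> Im (approach x n)"
      proof (intro always_eventually allI)
        fix n
        have "Im (approach x n) * (1 - t * energy M (approach x n)) \<le> Im (approach x n) * 1"
          using Im_approach_pos[of x n] t_pos energy_nonneg[of "approach x n"] by (intro mult_left_mono) auto
        moreover have "Im (H (approach x n)) > 0" using Om[OF x] by (simp add: Omega_iff_Im_H)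
        ultimately show "norm (Im (H (approach x n))) \<le> Im (approach x n)"
          using Im_H[OF Im_approach_pos, of x n] by simp
      qed
      show "(\<lambda>n. Im (approach x n)) \<longlonglongrightarrow> 0"
        using tendsto_Im[OF approach_tendsto[of x]] by simp
    qed
    then have "Im (h x) = 0" using tendsto_Im[OF h[OF x]] LIMSEQ_unique by blast
    then show ?thesis by (simp add: complex_eq_iff)
  qed
  have zero: "flow_density (Re (h x)) = 0" if x: "x \<in> I" for x
  proof -
    have "(\<lambda>n. H (approach x n)) \<longlonglongrightarrow> complex_of_real (Re (h x))"
      using h[OF x] h_real[OF x] by simp
    from omega_bd_eqI[OF approach_tendsto Om[OF x] this] show ?thesis
      by (simp add: flow_density_def)
  qed
  have near: "\<bar>Re (h x) - x\<bar> \<le> sqrt t" if x: "x \<in> I" for x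
  proof -
    have "cmod (h x - complex_of_real x) \<le> sqrt t"
    proof (rule LIMSEQ_le_const2)
      show "(\<lambda>n. cmod (H (approach x n) - approach x n)) \<longlonglongrightarrow> cmod (h x - complex_of_real x)"
        by (intro tendsto_intros h x approach_tendsto)
      have "cmod (H (approach x n) - approach x n) \<le> sqrt t" for n
        using norm_omega_diff_le[of "H (approach x n)"] Om[OF x, of n]
        by (simp add: Omega_iff_Im_H omega_H norm_minus_commute)
      then show "\<exists>N. \<forall>n\<ge>N. cmod (H (approach x n) - approach x n) \<le> sqrt t" by blast
    qed
    then show ?thesis using abs_Re_le_cmod[of "h x - complex_of_real x"] by simp
  qed
  have lip: "dist (Re (h x)) (Re (h x')) \<le> 2 * dist x x'" if x: "x \<in> I" "x' \<in> I" for x x'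
  proof -
    have "cmod (h x - h x') \<le> 2 * cmod (complex_of_real x - complex_of_real x')"
    proof (rule LIMSEQ_le)
      show "(\<lambda>n. cmod (H (approach x n) - H (approach x' n))) \<longlonglongrightarrow> cmod (h x - h x')"
        by (intro tendsto_intros h x)
      show "(\<lambda>n. 2 * cmod (approach x n - approach x' n)) \<longlonglongrightarrow> 2 * cmod (complex_of_real x - complex_of_real x')"
        by (intro tendsto_intros approach_tendsto)
    qed (use H_lipschitz[OF Om Om] x in blast)
    then show ?thesis
      using abs_Re_le_cmod[of "h x - h x'"] by (simp add: dist_real_def flip: of_real_diff)
  qed
  have "continuous_on I (\<lambda>x. Re (h x))"
    unfolding continuous_on_iff
  proof (intro ballI allI impI)
    fix x e :: real assume "x \<in> I" "e > 0"
    then show "\<exists>d>0. \<forall>x'\<in>I. dist x' x < d \<longrightarrow> dist (Re (h x')) (Re (h x)) < e"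
      using lip by (intro exI[of _ "e / 2"] conjI ballI impI) (auto intro: le_less_trans[OF lip])
  qed
  moreover have "m - 2 * sqrt t \<in> I" "m + 2 * sqrt t \<in> I" using t_pos by (auto simp: I_def)
  moreover have "Re (h (m - 2 * sqrt t)) \<le> y" "y \<le> Re (h (m + 2 * sqrt t))"
    using near[OF \<open>m - 2 * sqrt t \<in> I\<close>] near[OF \<open>m + 2 * sqrt t \<in> I\<close>] y by linarith+
  ultimately obtain x where "x \<in> I" "Re (h x) = y"
    using IVT'[of "\<lambda>x. Re (h x)" "m - 2 * sqrt t" y "m + 2 * sqrt t"] by (auto simp: I_def)
  then show ?thesis using zero by blast
qed

text \<open>Above an atom the energy grows like the inverse square of the height, so it equals 1/t
  at some positive height. At this point H is real, and the point is the boundary value of \<omega>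
  there, with positive imaginary part.\<close>

lemma flow_density_pos_near_atom:
  assumes atom: "prob {a} > 0"
  shows "\<exists>x. \<bar>x - a\<bar> \<le> sqrt t \<and> flow_density x > 0"
proof -
  define E where "E = (\<lambda>y. energy M (Complex a y))"
  \<comment> \<open>At this height the atom alone contributes exactly 1/t to the energy, whereas at
    height sqrt t the total is at most 1/t.\<close>
  define y1 where "y1 = sqrt (t * prob {a})"
  have y1: "y1 > 0" using t_pos atom by (simp add: y1_def)
  have "t * prob {a} \<le> t * 1" using t_pos by (intro mult_left_mono) auto
  then have y12: "y1 \<le> sqrt t" by (simp add: y1_def)
  have E1: "1 / t \<le> E y1"
  proof -
    have "(LINT u|M. indicator {a} u * (1 / y1\<^sup>2)) \<le> E y1"
      unfolding E_def energy_Complex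
    proof (rule integral_mono)
      show "integrable M (\<lambda>u. indicator {a} u * (1 / y1\<^sup>2))"
        by (intro integrable_mult_left integrable_real_indicator) (auto simp: emeasure_eq_measure)
      show "integrable M (\<lambda>u. 1 / ((a - u)\<^sup>2 + y1\<^sup>2))" by (rule integrable_energy_Complex[OF y1])
    qed (auto simp: indicator_def)
    then have "prob {a} * (1 / y1\<^sup>2) \<le> E y1" by simp
    then show ?thesis using atom t_pos by (simp add: y1_def)
  qed
  have E2: "E (sqrt t) \<le> 1 / t"
    using energy_le[of "Complex a (sqrt t)"] t_pos by (simp add: E_def)
  have E_cont: "continuous_on {y1..sqrt t} E"
  proof -
    have "continuous_on {y1..sqrt t} (\<lambda>y. Im (cauchy_transform M (complex_of_real a + \<i> * complex_of_real y)) / - y)"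
      by (intro continuous_intros continuous_on_compose2[OF holomorphic_on_imp_continuous_on[OF holomorphic_cauchy_transform]])
         (use y1 in auto)
    moreover have "Im (cauchy_transform M (complex_of_real a + \<i> * complex_of_real y)) / - y = E y" if "y \<in> {y1..sqrt t}" for y
    proof -
      have "complex_of_real a + \<i> * complex_of_real y = Complex a y" by (simp add: complex_eq_iff)
      then show ?thesis using that y1 Im_cauchy_transform[of "Complex a y"] by (simp add: E_def)
    qed
    ultimately show ?thesis by (rule continuous_on_eq)
  qed
  obtain y where y: "y1 \<le> y" "E y = 1 / t"
    using IVT2'[OF E2 E1 y12 E_cont] by auto
  have y0: "y > 0" using y y1 by simp
  define w where "w = Complex a y"
  \<comment> \<open>The energy decreases strictly with the height, so the points directly above
    \<open>w\<close> belong to \<Omega> and approach \<open>w\<close>.\<close>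
  define v where "v = (\<lambda>n. Complex a (y + inverse (real (Suc n))))"
  have v_lim: "v \<longlonglongrightarrow> w"
    unfolding v_def w_def using tendsto_add[OF tendsto_const LIMSEQ_inverse_real_of_nat, of y]
    by (intro tendsto_Complex tendsto_const) simp
  have v_Om: "v n \<in> \<Omega>" for n
  proof -
    define d where "d = inverse (real (Suc n))"
    have d: "d > 0" by (simp add: d_def)
    have "0 < (LINT u|M. 1 / ((a - u)\<^sup>2 + y\<^sup>2) - 1 / ((a - u)\<^sup>2 + (y + d)\<^sup>2))"
    proof (rule expectation_greater)
      show "integrable M (\<lambda>u. 1 / ((a - u)\<^sup>2 + y\<^sup>2) - 1 / ((a - u)\<^sup>2 + (y + d)\<^sup>2))"
        using y0 d by (intro Bochner_Integration.integrable_diff integrable_energy_Complex) auto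
      show "AE u in M. 0 < 1 / ((a - u)\<^sup>2 + y\<^sup>2) - 1 / ((a - u)\<^sup>2 + (y + d)\<^sup>2)"
      proof (intro AE_I2)
        fix u
        have "y\<^sup>2 < (y + d)\<^sup>2" using y0 d by (intro power_strict_mono) auto
        moreover have "0 < (a - u)\<^sup>2 + y\<^sup>2" using y0 by (simp add: add_nonneg_pos)
        ultimately show "0 < 1 / ((a - u)\<^sup>2 + y\<^sup>2) - 1 / ((a - u)\<^sup>2 + (y + d)\<^sup>2)"
          by (simp add: divide_strict_left_mono)
      qed
    qed
    also have "\<dots> = E y - E (y + d)"
      unfolding E_def energy_Complex using y0 d by (intro Bochner_Integration.integral_diff integrable_energy_Complex) auto
    finally have "E (y + d) < 1 / t" using y(2) by simp
    then have "t * energy M (v n) < 1" using t_pos by (simp add: E_def v_def d_def field_simps)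
    moreover have "Im (v n) = y + d" by (simp add: v_def d_def)
    then have "Im (v n) > 0" using y0 d by linarith
    ultimately show ?thesis by (simp add: \<Omega>_def)
  qed
  define x where "x = Re (H w)"
  have "Im (H w) = 0" using Im_H[of w] y y0 t_pos by (simp add: w_def E_def)
  then have Hw: "H w = complex_of_real x" by (simp add: x_def complex_eq_iff)
  have "isCont H w"
    using holomorphic_on_imp_continuous_on[OF holomorphic_H] y0
    by (auto simp: continuous_on_eq_continuous_at open_halfspace_Im_gt w_def)
  then have "(\<lambda>n. H (v n)) \<longlonglongrightarrow> complex_of_real x"
    using isCont_tendsto_compose[OF _ v_lim, of H] by (simp add: Hw)
  from omega_bd_eqI[OF v_lim v_Om this] have bd: "omega_bd x = w" .
  have "\<bar>Re (w - complex_of_real x)\<bar> \<le> sqrt t"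
    using norm_omega_bd_diff_le[of x] abs_Re_le_cmod[of "w - complex_of_real x"] unfolding bd by linarith
  then have "\<bar>x - a\<bar> \<le> sqrt t" by (simp add: w_def abs_minus_commute)
  moreover have "flow_density x > 0" using y0 t_pos by (simp add: flow_density_def bd w_def)
  ultimately show ?thesis by blast
qed

lemma not_unimodal_flow_law:
  assumes gap: "AE u in M. \<bar>m - u\<bar> \<ge> 4 * sqrt t"
    and atoms: "prob {a} > 0" "prob {b} > 0" "a < m" "m < b"
  shows "\<not> unimodal flow_law"
proof -
  \<comment> \<open>The gap condition holds only almost everywhere, but a point of positive mass
    cannot be an exception.\<close>
  have far: "\<bar>m - c\<bar> \<ge> 4 * sqrt t" if "prob {c} > 0" for c
  proof (rule ccontr)
    assume "\<not> \<bar>m - c\<bar> \<ge> 4 * sqrt t"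
    then have "AE u in M. u \<notin> {c}" using gap by (auto elim: eventually_mono)
    then have "prob {c} = 0"
      using AE_iff_measurable[of "{c}" M "\<lambda>u. u \<notin> {c}"] by (simp add: measure_def)
    then show False using that by simp
  qed
  have st: "sqrt t > 0" using t_pos by simp
  obtain x1 where x1: "\<bar>x1 - a\<bar> \<le> sqrt t" "flow_density x1 > 0"
    using flow_density_pos_near_atom[OF atoms(1)] by blast
  obtain x2 where x2: "\<bar>x2 - b\<bar> \<le> sqrt t" "flow_density x2 > 0"
    using flow_density_pos_near_atom[OF atoms(2)] by blast
  have ord: "x1 < m - sqrt t" "m + sqrt t < x2"
    using far[OF atoms(1)] far[OF atoms(2)] atoms(3,4) x1 x2 st by linarith+
  show ?thesis
  proof (rule not_unimodal_gap)
    show "emeasure flow_law {..<m - sqrt t} > 0"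
      unfolding flow_law_def using ord x1
      by (intro emeasure_continuous_density_pos[OF continuous_on_flow_density, where x = x1]) auto
    show "emeasure flow_law {m + sqrt t<..} > 0"
      unfolding flow_law_def using ord x2
      by (intro emeasure_continuous_density_pos[OF continuous_on_flow_density, where x = x2]) auto
    show "m - sqrt t < m + sqrt t" using st by simp
    have "ennreal (flow_density y) * indicator {m - sqrt t<..<m + sqrt t} y = 0" for y
      using flow_density_zero_in_gap[OF gap, of y] by (auto simp: indicator_def abs_le_iff)
    then show "emeasure flow_law {m - sqrt t<..<m + sqrt t} = 0"
      unfolding flow_law_def by (subst emeasure_density) (simp_all only: nn_integral_const, simp_all)
  qed
qed

end

text \<open>Atoms at the squares: the gaps grow without bound, and the weights are chosen to make both
  \<open>f\<close> and the second moment summable.\<close>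

lemma ex_atomic_distribution:
  fixes f :: "real \<Rightarrow> real"
  assumes f: "f \<in> borel_measurable borel" "\<And>x. 0 \<le> f x"
  obtains \<mu> where "real_distribution \<mu>" "\<And>n. measure \<mu> {(real n)\<^sup>2} > 0"
    "AE u in \<mu>. u \<in> range (\<lambda>n. (real n)\<^sup>2)" "(\<integral>\<^sup>+ x. ennreal (f x) \<partial>\<mu>) < \<infinity>" "integrable \<mu> (\<lambda>u. u\<^sup>2)"
proof -
  define s where "s = (\<lambda>n. (real n)\<^sup>2)"
  \<comment> \<open>The denominator dominates 1, \<open>f\<close> and the square at the atom, so
    \<open>w\<close> times any of them is at most 2^-(n+1).\<close>
  define w where "w = (\<lambda>n. (1 / 2) ^ Suc n / (1 + f (s n) + (s n)\<^sup>2))"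
  have den: "1 + f (s n) + (s n)\<^sup>2 \<ge> 1" for n using f(2)[of "s n"] by simp
  have w_pos: "w n > 0" for n using den[of n] by (simp add: w_def)
  have w_le: "w n \<le> (1 / 2) ^ Suc n" for n
    using den[of n] by (simp add: w_def divide_le_eq mult_le_cancel_left1)
  have sum_half: "summable (\<lambda>n. (1 / 2 :: real) ^ Suc n)"
    using power_half_series by (rule sums_summable)
  have w_sum: "summable w"
    by (rule summable_comparison_test'[OF sum_half, of 0]) (use w_pos w_le in \<open>auto simp: less_imp_le abs_of_pos\<close>)
  define W where "W = suminf w"
  have W: "W > 0" unfolding W_def by (rule suminf_pos[OF w_sum w_pos])
  define P where "P = embed_pmf (\<lambda>n. w n / W)"
  have pmf_P: "pmf P n = w n / W" for n
    unfolding P_def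
  proof (rule pmf_embed_pmf)
    show "0 \<le> w x / W" for x using w_pos[of x] W by simp
    have "(\<lambda>n. w n / W) sums (W / W)"
      unfolding W_def by (intro sums_divide summable_sums w_sum)
    then have "(\<Sum>n. ennreal (w n / W)) = ennreal 1"
      using W w_pos by (subst suminf_ennreal2) (auto simp: sums_iff less_imp_le)
    then show "(\<integral>\<^sup>+ x. ennreal (w x / W) \<partial>count_space UNIV) = 1"
      by (simp add: nn_integral_count_space_nat)
  qed
  define \<mu> where "\<mu> = distr (measure_pmf P) borel s"
  have dist: "real_distribution \<mu>"
    unfolding \<mu>_def by (simp add: real_distribution_def real_distribution_axioms_def measure_pmf.prob_space_distr)
  have inj: "inj s" unfolding s_def by (rule injI) simp
  \<comment> \<open>One estimate for two integrals: it is applied to \<open>f\<close> and to the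
    square.\<close>
  have weighted: "(\<integral>\<^sup>+ x. ennreal (h x) \<partial>\<mu>) < \<infinity>"
    if h: "h \<in> borel_measurable borel" "\<And>x. 0 \<le> h x" "\<And>n. h (s n) \<le> 1 + f (s n) + (s n)\<^sup>2" for h
  proof -
    have "(\<integral>\<^sup>+ x. ennreal (h x) \<partial>\<mu>) = (\<Sum>n. ennreal (pmf P n) * ennreal (h (s n)))"
      unfolding \<mu>_def using h(1) by (simp add: nn_integral_distr nn_integral_measure_pmf nn_integral_count_space_nat)
    also have "\<dots> \<le> (\<Sum>n. ennreal ((1 / 2) ^ Suc n / W))"
    proof (intro suminf_le allI)
      fix n
      have "w n * h (s n) \<le> w n * (1 + f (s n) + (s n)\<^sup>2)"
        using h(3) w_pos[of n] by (intro mult_left_mono) auto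
      also have "\<dots> = (1 / 2) ^ Suc n"
        unfolding w_def times_divide_eq_left using den[of n] by (intro nonzero_mult_div_cancel_right) linarith
      finally have "pmf P n * h (s n) \<le> (1 / 2) ^ Suc n / W"
        unfolding pmf_P times_divide_eq_left using W by (intro divide_right_mono) auto
      then show "ennreal (pmf P n) * ennreal (h (s n)) \<le> ennreal ((1 / 2) ^ Suc n / W)"
        using h(2) by (simp only: ennreal_mult'[OF pmf_nonneg, symmetric] ennreal_leI)
    qed auto
    also have "\<dots> = ennreal (\<Sum>n. (1 / 2) ^ Suc n / W)"
      using W by (intro suminf_ennreal2 summable_divide sum_half) auto
    finally show ?thesis by (simp add: le_less_trans)
  qed
  show ?thesis
  proof (rule that[OF dist])
    show "measure \<mu> {(real n)\<^sup>2} > 0" for n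
    proof -
      have "s -` {s n} = {n}" using inj by (auto dest: injD)
      then have "measure \<mu> {s n} = pmf P n"
        unfolding \<mu>_def by (subst measure_distr) (auto simp: pmf.rep_eq)
      then show ?thesis using w_pos[of n] W by (simp add: pmf_P s_def)
    qed
    have "range s \<in> sets borel" by (rule sets.countable) auto
    then have "AE u in \<mu>. u \<in> range s"
      unfolding \<mu>_def by (subst AE_distr_iff) simp_all
    then show "AE u in \<mu>. u \<in> range (\<lambda>n. (real n)\<^sup>2)" by (simp add: s_def)
    show "(\<integral>\<^sup>+ x. ennreal (f x) \<partial>\<mu>) < \<infinity>"
      by (rule weighted) (use f in auto)
    have "(\<integral>\<^sup>+ x. ennreal (x\<^sup>2) \<partial>\<mu>) < \<infinity>"
      by (rule weighted) (use f in \<open>auto simp: add_increasing\<close>)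
    then show "integrable \<mu> (\<lambda>u. u\<^sup>2)"
      unfolding integrable_iff_bounded by (simp add: \<mu>_def)
  qed
qed

theorem ex_never_unimodal:
  fixes f :: "real \<Rightarrow> real"
  assumes f: "f \<in> borel_measurable borel" "\<And>x. 0 \<le> f x"
  shows "\<exists>\<mu>. real_distribution \<mu> \<and> (\<forall>t>0. \<not> unimodal (\<mu> \<boxplus> semicircle t)) \<and>
    (\<integral>\<^sup>+ x. ennreal (f x) \<partial>\<mu>) < \<infinity> \<and> \<not> compact (msupport \<mu>)"
proof -
  obtain \<mu> where \<mu>: "real_distribution \<mu>" "\<And>n. measure \<mu> {(real n)\<^sup>2} > 0"
    "AE u in \<mu>. u \<in> range (\<lambda>n. (real n)\<^sup>2)" "(\<integral>\<^sup>+ x. ennreal (f x) \<partial>\<mu>) < \<infinity>" "integrable \<mu> (\<lambda>u. u\<^sup>2)"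
    using ex_atomic_distribution[OF f] by blast
  interpret real_distribution \<mu> by (rule \<mu>(1))
  have "\<not> unimodal (\<mu> \<boxplus> semicircle t)" if t: "t > 0" for t
  proof -
    interpret semicircular_flow \<mu> t by unfold_locales (use t \<mu>(5) in auto)
    obtain n where n: "4 * sqrt t \<le> real n" using real_arch_simple by blast
    \<comment> \<open>The midpoint between n^2 and (n+1)^2, at distance n + 1/2 from both; n is
      chosen after \<open>t\<close>, while the measure does not depend on \<open>t\<close>.\<close>
    define m where "m = (real n)\<^sup>2 + real n + 1 / 2"
    have "4 * sqrt t \<le> \<bar>m - (real k)\<^sup>2\<bar>" for k
    proof (cases "k \<le> n")
      case True
      then have "(real k)\<^sup>2 \<le> (real n)\<^sup>2" by (intro power_mono) auto
      then show ?thesis using n unfolding m_def by linarith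
    next
      case False
      then have "real n + 1 \<le> real k" by linarith
      then have "(real n + 1)\<^sup>2 \<le> (real k)\<^sup>2" by (intro power_mono) auto
      then have "(real n)\<^sup>2 + 2 * real n + 1 \<le> (real k)\<^sup>2" by (simp add: power2_sum)
      then show ?thesis using n unfolding m_def by linarith
    qed
    then have "AE u in \<mu>. \<bar>m - u\<bar> \<ge> 4 * sqrt t"
      using \<mu>(3) by (auto elim!: eventually_mono)
    moreover have "(real n)\<^sup>2 < m" "m < (real (Suc n))\<^sup>2"
      by (auto simp: m_def power2_eq_square algebra_simps)
    ultimately have "\<not> unimodal flow_law"
      using \<mu>(2) by (intro not_unimodal_flow_law)
    then show ?thesis by (simp add: free_convolution_semicircle)
  qed
  moreover have "\<not> compact (msupport \<mu>)"
  proof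
    assume "compact (msupport \<mu>)"
    then have "bounded (msupport \<mu>)" by (rule compact_imp_bounded)
    then obtain B where B: "\<And>x. x \<in> msupport \<mu> \<Longrightarrow> \<bar>x\<bar> \<le> B"
      by (auto simp: bounded_iff)
    obtain n where n: "B < real n" using reals_Archimedean2 by blast
    have "(real (Suc n))\<^sup>2 \<in> msupport \<mu>"
      unfolding msupport_def
    proof (intro CollectI allI impI)
      fix U :: "real set" assume U: "open U" "(real (Suc n))\<^sup>2 \<in> U"
      have "0 < emeasure \<mu> {(real (Suc n))\<^sup>2}"
        using \<mu>(2)[of "Suc n"] by (simp add: emeasure_eq_measure)
      also have "\<dots> \<le> emeasure \<mu> U" using U by (intro emeasure_mono) auto
      finally show "emeasure \<mu> U > 0" .
    qed
    then have "(real (Suc n))\<^sup>2 \<le> B" using B by fastforce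
    moreover have "real n \<le> (real (Suc n))\<^sup>2" by (simp add: power2_eq_square algebra_simps)
    ultimately show False using n by linarith
  qed
  ultimately show ?thesis using \<mu>(1,4) by blast
qed

theorem theorem1p2:
  shows "(\<forall>\<mu>. real_distribution \<mu> \<longrightarrow> compact (msupport \<mu>) \<longrightarrow>
            (\<forall>t>0. t \<ge> 4 * (diameter (msupport \<mu>))\<^sup>2 \<longrightarrow> unimodal (\<mu> \<boxplus> semicircle t)))
       \<and> (\<forall>f :: real \<Rightarrow> real. f \<in> borel_measurable borel \<longrightarrow> (\<forall>x. 0 \<le> f x) \<longrightarrow>
            (\<exists>\<mu>. real_distribution \<mu> \<and>
                 (\<forall>t>0. \<not> unimodal (\<mu> \<boxplus> semicircle t)) \<and>
                 (\<integral>\<^sup>+ x. ennreal (f x) \<partial>\<mu>) < \<infinity> \<and>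
                 \<not> compact (msupport \<mu>)))"
  using unimodal_compact_support ex_never_unimodal by blast

end
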